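(* For all $m\ge 4$, $n\ge 0$ and $1\le k\le m-2$, the wide melting lollipop graph $WL_{m,n}^{(k)}$, which is the labelled unit interval graph on $m+n$ vertices given by the sequence $(w_i)_{i=1}^{m+n}$ with $w_i=1$ for $1\le i\le m-1$, $w_m=k+1$, and $w_i=i-2$ for $m+1\le i\le m+n$, is $(e)$-positive.
   Context: All graphs are finite and simple with nonempty vertex set. A labelled graph on $d$ vertices is a graph with vertex set $[d]=\{1,\dots,d\}$. A labelled unit interval graph is a labelled graph $G$ such that whenever $i\le v<w\le j$ and $ij\in E(G)$, also $vw\in E(G)$; it is determined by the weakly increasing sequence $(w_i)$, where $w_i\le i$ is the smallest label in the closed neighbourhood of $i$ (so for $j<i$, $ji$ is an edge iff $j\ge w_i$). For a set partition $\pi$ of $[d]$, let $B_{\pi,i}$ be the block containing $i$, and let $e_\pi=\sum x_{i_1}\cdots x_{i_d}$ in noncommuting variables $x_1,x_2,\dots$, summed over all tuples $(i_1,\dots,i_d)$ of positive integers with $i_j\ne i_k$ whenever $j\neq k$ and $B_{\pi,j}=B_{\pi,k}$. The $e_\pi$, over set partitions $\pi$ of $[d]$, form a $\mathbb Q$-basis of $\mathrm{NCSym}^d$, the degree-$d$ part of the algebra of symmetric functions in noncommuting variables. For $d\ge 1$ let $\mathrm{type}(\pi)=(\lambda,b)$, where $b=|B_{\pi,d}|$ and $\lambda$ is the integer partition (possibly empty) formed by the sizes of the other blocks. $\mathrm{UBCSym}^d$ is the $\mathbb Q$-vector space with basis $\{e_{(\lambda,b)}\}$ over pairs of a partition $\lambda$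 and an integer $b\ge 1$ with $|\lambda|+b=d$, and $\nu:\mathrm{NCSym}^d\to\mathrm{UBCSym}^d$ is the linear map with $\nu(e_\pi)=e_{\mathrm{type}(\pi)}$. For a labelled graph $G$ on $d$ vertices, $Y_G=\sum_\kappa x_{\kappa(1)}\cdots x_{\kappa(d)}\in\mathrm{NCSym}^d$, summed over all proper colourings $\kappa:[d]\to\mathbb Z_{>0}$ of $G$, and $y_G=\nu(Y_G)$. $G$ is $(e)$-positive if all coefficients of $y_G$ in the basis $\{e_{(\lambda,b)}\}$ are nonnegative. *)

theory Defs
  imports
    Complex_Main
    "HOL-Library.FuncSet"
    "HOL-Combinatorics.Permutations"
    "HOL-Library.Disjoint_Sets"
    "HOL-Library.Multiset"
    "HOL-Library.Function_Algebras"
    "HOL-Library.Poly_Mapping"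
begin

text \<open>A labelled graph on \<open>d\<close> vertices has vertex set \<open>{1..d}\<close> and is given by \<open>d\<close> together with
  its set \<open>E\<close> of edges, an edge being an unordered pair \<open>{u, v}\<close> of distinct vertices.\<close>

definition labelled_graph :: "nat \<Rightarrow> nat set set \<Rightarrow> bool" where
  "labelled_graph d E \<longleftrightarrow> 1 \<le> d \<and> E \<subseteq> {{u, v} | u v. u \<in> {1..d} \<and> v \<in> {1..d} \<and> u \<noteq> v}"

definition labelled_unit_interval_graph :: "nat \<Rightarrow> nat set set \<Rightarrow> bool" where
  "labelled_unit_interval_graph d E \<longleftrightarrow> labelled_graph d E \<and>
     (\<forall>i j v w. i \<le> v \<and> v < w \<and> w \<le> j \<and> {i, j} \<in> E \<longrightarrow> {v, w} \<in> E)"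

definition least_closed_nbr :: "nat set set \<Rightarrow> nat \<Rightarrow> nat" where
  "least_closed_nbr E i = Min (insert i {j. {j, i} \<in> E})"

definition edges_of_seq :: "nat \<Rightarrow> (nat \<Rightarrow> nat) \<Rightarrow> nat set set" where
  "edges_of_seq d w = {{j, i} | j i. 1 \<le> j \<and> j < i \<and> i \<le> d \<and> w i \<le> j}"

definition WL_seq :: "nat \<Rightarrow> nat \<Rightarrow> nat \<Rightarrow> nat" where
  "WL_seq m k i = (if i \<le> m - 1 then 1 else if i = m then k + 1 else i - 2)"

definition WL :: "nat \<Rightarrow> nat \<Rightarrow> nat \<Rightarrow> nat set set" where
  "WL m n k = edges_of_seq (m + n) (WL_seq m k)"

lemma doubleton_in_edges_of_seq:
  "{a, b} \<in> edges_of_seq d w \<longleftrightarrow>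
     (1 \<le> a \<and> a < b \<and> b \<le> d \<and> w b \<le> a) \<or> (1 \<le> b \<and> b < a \<and> a \<le> d \<and> w a \<le> b)"
  unfolding edges_of_seq_def by (auto simp: doubleton_eq_iff)

text \<open>The graph \<open>WL m n k\<close> is indeed the labelled unit interval graph whose sequence is \<open>WL_seq m k\<close>.\<close>

lemma labelled_unit_interval_graph_WL:
  assumes "4 \<le> m" "1 \<le> k" "k \<le> m - 2"
  shows "labelled_unit_interval_graph (m + n) (WL m n k)"
proof -
  have mono: "WL_seq m k a \<le> WL_seq m k b" if "a \<le> b" for a b
    using that assms by (auto simp: WL_seq_def)
  have "labelled_graph (m + n) (WL m n k)"
  proof -
    have "\<exists>u v. e = {u, v} \<and> u \<in> {1..m + n} \<and> v \<in> {1..m + n} \<and> u \<noteq> v" if e: "e \<in> WL m n k" for e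
    proof -
      obtain j i where "e = {j, i}" "1 \<le> j" "j < i" "i \<le> m + n"
        using e unfolding WL_def edges_of_seq_def by blast
      then show ?thesis by (intro exI[of _ j] exI[of _ i]) auto
    qed
    then show ?thesis using assms unfolding labelled_graph_def by auto
  qed
  moreover have "{v, w} \<in> WL m n k"
    if ij: "i \<le> v" "v < w" "w \<le> j" "{i, j} \<in> WL m n k" for i j v w
  proof -
    have "1 \<le> i" "j \<le> m + n" "WL_seq m k j \<le> i"
      using ij unfolding WL_def doubleton_in_edges_of_seq by auto
    with ij mono[of w j] have "1 \<le> v" "w \<le> m + n" "WL_seq m k w \<le> v" by simp_all
    with ij(2) show ?thesis unfolding WL_def doubleton_in_edges_of_seq by blast
  qed
  ultimately show ?thesis
    unfolding labelled_unit_interval_graph_def by blast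
qed

lemma least_closed_nbr_WL:
  assumes "4 \<le> m" "1 \<le> k" "k \<le> m - 2" "i \<in> {1..m + n}"
  shows "least_closed_nbr (WL m n k) i = WL_seq m k i"
proof -
  have mono: "WL_seq m k a \<le> WL_seq m k b" if "a \<le> b" for a b
    using that assms by (auto simp: WL_seq_def)
  have le: "1 \<le> WL_seq m k i" "WL_seq m k i \<le> i"
    using assms by (auto simp: WL_seq_def)
  show ?thesis unfolding least_closed_nbr_def
  proof (rule Min_eqI)
    show "finite (insert i {j. {j, i} \<in> WL m n k})"
      by (rule finite_subset[of _ "insert i {..m + n}"])
        (auto simp: WL_def doubleton_in_edges_of_seq)
    show "WL_seq m k i \<le> y" if "y \<in> insert i {j. {j, i} \<in> WL m n k}" for y
      using that le mono[of i y] unfolding WL_def doubleton_in_edges_of_seq by auto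
    show "WL_seq m k i \<in> insert i {j. {j, i} \<in> WL m n k}"
      using assms le unfolding WL_def doubleton_in_edges_of_seq by auto
  qed
qed

text \<open>A formal series over \<open>\<rat>\<close> in noncommuting variables \<open>x\<^sub>1, x\<^sub>2, \<dots>\<close> is its coefficient function:
  the list \<open>[i\<^sub>1, \<dots>, i\<^sub>d]\<close> stands for the monomial \<open>x\<^bsub>i\<^sub>1\<^esub> \<cdots> x\<^bsub>i\<^sub>d\<^esub>\<close>. Addition of series is the pointwise
  one of \<open>Function_Algebras\<close>.\<close>

type_synonym nc_series = "nat list \<Rightarrow> rat"

definition nc_scale :: "rat \<Rightarrow> nc_series \<Rightarrow> nc_series" where
  "nc_scale c f = (\<lambda>u. c * f u)"

global_interpretation NC: vector_space nc_scale
  by unfold_locales (auto simp: nc_scale_def fun_eq_iff algebra_simps)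

definition NCSym :: "nat \<Rightarrow> nc_series set" where
  "NCSym d = {f. (\<forall>u. f u \<noteq> 0 \<longrightarrow> length u = d \<and> set u \<subseteq> {0<..}) \<and>
                 (\<forall>\<sigma> u. \<sigma> permutes {0<..} \<longrightarrow> f (map \<sigma> u) = f u)}"

text \<open>The formal sum of \<open>x\<^bsub>t(1)\<^esub> \<cdots> x\<^bsub>t(d)\<^esub>\<close> over the \<open>t \<in> T\<close>, for a set \<open>T\<close> of tuples indexed
  by \<open>{1..d}\<close>. Each monomial arises from at most one such tuple, so the cardinality
  below is that of a finite set.\<close>

definition monomial_sum :: "nat \<Rightarrow> (nat \<Rightarrow> nat) set \<Rightarrow> nc_series" where
  "monomial_sum d T = (\<lambda>u. of_nat (card {t \<in> T. map t [1..<Suc d] = u}))"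

definition block :: "nat set set \<Rightarrow> nat \<Rightarrow> nat set" where
  "block \<pi> i = (THE B. B \<in> \<pi> \<and> i \<in> B)"

definition nc_e :: "nat \<Rightarrow> nat set set \<Rightarrow> nc_series" where
  "nc_e d \<pi> = monomial_sum d {t \<in> {1..d} \<rightarrow>\<^sub>E {0<..}.
     \<forall>j\<in>{1..d}. \<forall>k\<in>{1..d}. j \<noteq> k \<and> block \<pi> j = block \<pi> k \<longrightarrow> t j \<noteq> t k}"

definition proper_colourings :: "nat \<Rightarrow> nat set set \<Rightarrow> (nat \<Rightarrow> nat) set" where
  "proper_colourings d E =
     {\<kappa> \<in> {1..d} \<rightarrow>\<^sub>E {0<..}. \<forall>u\<in>{1..d}. \<forall>v\<in>{1..d}. {u, v} \<in> E \<longrightarrow> \<kappa> u \<noteq> \<kappa> v}"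

definition chrom_Y :: "nat \<Rightarrow> nat set set \<Rightarrow> nc_series" where
  "chrom_Y d E = monomial_sum d (proper_colourings d E)"

lemma monomial_sum_in_NCSym:
  assumes T: "T \<subseteq> {1..d} \<rightarrow>\<^sub>E {0<..}"
    and inv: "\<And>\<sigma> t. \<sigma> permutes {0<..} \<Longrightarrow> t \<in> T \<Longrightarrow> (\<lambda>i\<in>{1..d}. \<sigma> (t i)) \<in> T"
  shows "monomial_sum d T \<in> NCSym d"
proof -
  have supp: "length u = d \<and> set u \<subseteq> {0<..}" if nz: "monomial_sum d T u \<noteq> 0" for u
  proof -
    have "card {t \<in> T. map t [1..<Suc d] = u} \<noteq> 0"
    proof
      assume "card {t \<in> T. map t [1..<Suc d] = u} = 0"
      then have "monomial_sum d T u = 0" unfolding monomial_sum_def by (simp only: of_nat_0)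
      with nz show False by contradiction
    qed
    then have "{t \<in> T. map t [1..<Suc d] = u} \<noteq> {}"
      by (rule contrapos_nn) (simp only: card.empty)
    then obtain t where t: "t \<in> T" "u = map t [1..<Suc d]" by blast
    then have "\<forall>i\<in>{1..d}. 0 < t i" using T by auto
    then show ?thesis by (auto simp: t(2) simp del: upt_Suc)
  qed
  have uniq: "s = t" if st: "s \<in> T" "t \<in> T" "map s [1..<Suc d] = map t [1..<Suc d]" for s t
  proof (rule PiE_ext)
    show "s \<in> {1..d} \<rightarrow>\<^sub>E {0<..}" "t \<in> {1..d} \<rightarrow>\<^sub>E {0<..}" using st T by blast+
    show "s i = t i" if "i \<in> {1..d}" for i
      using st(3) that by (simp add: map_eq_conv del: upt_Suc)
  qed
  have fin: "finite {t \<in> T. map t [1..<Suc d] = u}" (is "finite ?A") for u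
  proof (cases "\<exists>s. s \<in> ?A")
    case True
    then obtain s where "s \<in> ?A" ..
    have "?A \<subseteq> {s}"
    proof
      fix t assume "t \<in> ?A"
      with \<open>s \<in> ?A\<close> have "t = s" by (intro uniq) (simp_all only: mem_Collect_eq)
      then show "t \<in> {s}" by (simp only: singleton_iff)
    qed
    then show ?thesis by (rule finite_subset) (rule finite.insertI[OF finite.emptyI])
  next
    case False
    then have "?A = {}" by blast
    then show ?thesis by (simp only: finite.emptyI)
  qed
  have card_le: "card {t \<in> T. map t [1..<Suc d] = u} \<le> card {t \<in> T. map t [1..<Suc d] = map \<sigma> u}"
    (is "card ?A \<le> card ?B") if \<sigma>: "\<sigma> permutes {0<..}" for \<sigma> u
  proof (rule card_inj_on_le[where f = "\<lambda>t. \<lambda>i\<in>{1..d}. \<sigma> (t i)"])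
    show "inj_on (\<lambda>t. \<lambda>i\<in>{1..d}. \<sigma> (t i)) ?A"
    proof (rule inj_onI)
      fix s t assume "s \<in> ?A" "t \<in> ?A"
      then have "s \<in> T" "t \<in> T" "map s [1..<Suc d] = map t [1..<Suc d]"
        by (simp_all only: mem_Collect_eq)
      then show "s = t" by (rule uniq)
    qed
    show "(\<lambda>t. \<lambda>i\<in>{1..d}. \<sigma> (t i)) ` ?A \<subseteq> ?B"
    proof (rule image_subsetI)
      fix t assume "t \<in> ?A"
      then have "t \<in> T" and u: "u = map t [1..<Suc d]" by blast+
      moreover have "map (\<lambda>i\<in>{1..d}. \<sigma> (t i)) [1..<Suc d] = map \<sigma> u"
        unfolding u by (simp del: upt_Suc)
      ultimately show "(\<lambda>i\<in>{1..d}. \<sigma> (t i)) \<in> ?B" using inv[OF \<sigma>] by blast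
    qed
  qed (rule fin)
  have "monomial_sum d T (map \<sigma> u) = monomial_sum d T u" if \<sigma>: "\<sigma> permutes {0<..}" for \<sigma> u
  proof -
    have inv: "map (inv_into UNIV \<sigma>) (map \<sigma> u) = u"
      unfolding map_map permutes_inv_o(2)[OF \<sigma>] by (rule list.map_id)
    have "card {t \<in> T. map t [1..<Suc d] = map \<sigma> u} = card {t \<in> T. map t [1..<Suc d] = u}"
      using card_le[OF permutes_inv[OF \<sigma>], of "map \<sigma> u"] card_le[OF \<sigma>, of u]
      unfolding inv by (rule antisym)
    then show ?thesis unfolding monomial_sum_def by (rule arg_cong)
  qed
  with supp show ?thesis unfolding NCSym_def by blast
qed

lemma nc_e_in_NCSym: "nc_e d \<pi> \<in> NCSym d"
  unfolding nc_e_def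
  by (rule monomial_sum_in_NCSym) (auto simp: permutes_inj inj_eq dest: permutes_in_image)

lemma chrom_Y_in_NCSym: "chrom_Y d E \<in> NCSym d"
  unfolding chrom_Y_def proper_colourings_def
  by (rule monomial_sum_in_NCSym) (auto simp: permutes_inj inj_eq dest: permutes_in_image)

text \<open>\<open>UBCSym\<close>, the direct sum of the \<open>UBCSym\<^sup>d\<close>, is the free \<open>\<rat>\<close>-vector space on the pairs \<open>(\<lambda>, b)\<close>, with
  the partition \<open>\<lambda>\<close> a multiset of positive integers: \<open>Poly_Mapping.single (\<lambda>, b) c\<close> is \<open>c e\<^bsub>(\<lambda>, b)\<^esub>\<close>
  and \<open>lookup\<close> reads off coefficients. The basis of \<open>UBCSym\<^sup>d\<close> is indexed by \<open>ubc_index d\<close>.\<close>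

type_synonym ubcsym = "(nat multiset \<times> nat) \<Rightarrow>\<^sub>0 rat"

definition ubc_index :: "nat \<Rightarrow> (nat multiset \<times> nat) set" where
  "ubc_index d = {(l, b). 0 \<notin># l \<and> 1 \<le> b \<and> sum_mset l + b = d}"

definition partition_type :: "nat \<Rightarrow> nat set set \<Rightarrow> nat multiset \<times> nat" where
  "partition_type d \<pi> =
     (image_mset card (mset_set (\<pi> - {block \<pi> d})), card (block \<pi> d))"

text \<open>\<open>NC.representation B f v\<close> is the coefficient of the basis vector \<open>v \<in> B\<close> in the expansion of
  \<open>f\<close>. As the \<open>e\<^sub>\<pi>\<close> form a basis of \<open>NCSym d\<close>, \<open>nu d\<close> is there the linear map sending each
  \<open>e\<^sub>\<pi>\<close> to the basis vector indexed by the type of \<open>\<pi>\<close>; it is 0 outside \<open>NCSym d\<close>.\<close>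

definition nc_e_basis :: "nat \<Rightarrow> nc_series set" where
  "nc_e_basis d = nc_e d ` {\<pi>. partition_on {1..d} \<pi>}"

definition nu :: "nat \<Rightarrow> nc_series \<Rightarrow> ubcsym" where
  "nu d f = (\<Sum>\<pi> | partition_on {1..d} \<pi>.
     Poly_Mapping.single (partition_type d \<pi>) (NC.representation (nc_e_basis d) f (nc_e d \<pi>)))"

definition chrom_y :: "nat \<Rightarrow> nat set set \<Rightarrow> ubcsym" where
  "chrom_y d E = nu d (chrom_Y d E)"

definition e_positive :: "nat \<Rightarrow> nat set set \<Rightarrow> bool" where
  "e_positive d E \<longleftrightarrow> (\<forall>p\<in>ubc_index d. 0 \<le> Poly_Mapping.lookup (chrom_y d E) p)"

end

theory Submission
  imports Defs
begin

text \<open>The commutative image of a series in which the variable of the last vertex stays marked loses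
  only what relabellings fixing that vertex change, so it determines \<open>nu\<close>. In it \<open>e\<^sub>\<pi>\<close> becomes, up to
  factorials, a product of elementary symmetric polynomials with \<open>X\<^sub>b = x\<^sub>c e\<^bsub>b-1\<^esub>\<close>, where \<open>x\<^sub>c\<close> is the
  marked variable and \<open>e\<^bsub>b-1\<^esub>\<close> is taken in the other variables. Let \<open>A\<^bsub>i,n\<^esub>\<close> and \<open>L\<^bsub>i,n\<^esub>\<close> be the
  images, divided by \<open>i!\<close>, of the triangular ladder on \<open>n + 1\<close> vertices, marked at its last one, with a \<open>K\<^bsub>i+1\<^esub>\<close> glued to its first vertex, and of \<open>K\<^bsub>i+2\<^esub>\<close> with the remaining \<open>n - 1\<close> vertices of
  the ladder as a tail. Then the image of \<open>WL\<close> is \<open>(m-3)! (k A\<^bsub>m-2,n+1\<^esub> + (m-2-k) L\<^bsub>m-2,n+1\<^esub>)\<close>, and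
  \<open>L\<^bsub>i,n+1\<^esub> = i A\<^bsub>i+1,n\<^esub> + L\<^bsub>i+1,n\<^esub>\<close>, so all that is needed is positivity of \<open>A\<^bsub>i,n\<^esub>\<close> for \<open>i \<ge> 2\<close>.

  Ladders with cliques glued to their first two vertices satisfy a closed recursion. Unrolled, it
  expresses the consecutive differences of the series \<open>\<alpha>\<^sub>i = \<Sum>\<^sub>n A\<^bsub>i,n\<^esub>\<close> through the \<open>\<alpha>\<^sub>j\<close> multiplied by
  elementary symmetric polynomials, with negative terms. An induction on the number of parts of the
  partition shows that these differences are nonnegative, together with bounds
  from both sides on \<open>\<eta> = 2 \<alpha>\<^sub>1 - \<alpha>\<^sub>0\<close>.\<close>

subsection \<open>Ladders with cliques attached\<close>

text \<open>In the unrolled recursion for a difference of consecutive totals with index at least 2,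
  a term without any alpha is an e_r X_b; every other term either carries an e_r with r > 0, so that
  it only sees pairs with one part fewer, or is an alpha_j of larger index at the same pair. Hence
  the induction on the number of parts contains a downward induction on the index. The obstacle is
  alpha_0 and alpha_1 in the negative terms. The identity alpha_0 = sum of t alpha_{t+1} over t >=
  1, plus the sum of all X_b, bounds the alpha_t with t >= 2 by alpha_0, but alpha_1 is missing from
  it and has to be compared with alpha_0 separately. The combination eta suits this because alpha_2,
  the only total that would occur in it without an e_r, cancels. From below only eta >= -X_1 holds;
  the correction by e_{k+1} X_1 inside \<open>gap\<close> pays for that and telescopes away. The
  constants 3 and 6 of the upper bound are what the case K = 3, q = 2 of
  \<open>gap_term_nonneg\<close> can absorb.\<close>

lemma sum_off_diag_swap:
  assumes "finite S"
  shows "(\<Sum>a\<in>S. \<Sum>b\<in>S - {a}. f a b) = (\<Sum>b\<in>S. \<Sum>a\<in>S - {b}. f a b)"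
proof -
  have 1: "{b \<in> S. a \<noteq> b} = S - {a}" "{b. b \<in> S \<and> b \<noteq> a} = S - {a}" for a by auto
  show ?thesis using sum.swap_restrict[OF assms assms, of f "\<lambda>a b. a \<noteq> b"] by (simp add: 1)
qed

locale esym_family =
  fixes x :: "nat \<Rightarrow> 'a :: comm_ring_1" and S :: "nat set"
  assumes finite_S: "finite S"
begin

section \<open>Elementary symmetric polynomials over subsets of the colours\<close>

definition esym :: "nat set \<Rightarrow> nat \<Rightarrow> 'a" where
  "esym A k = (\<Sum>T | T \<subseteq> A \<and> card T = k. \<Prod>i\<in>T. x i)"

lemma esym_0: "finite A \<Longrightarrow> esym A 0 = 1"
proof -
  assume A: "finite A"
  have "{T. T \<subseteq> A \<and> card T = 0} = {{}}" using A by (auto simp: finite_subset)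
  then show ?thesis by (simp add: esym_def)
qed

lemma esym_insert:
  assumes "finite A" "a \<notin> A"
  shows "esym (insert a A) (Suc k) = esym A (Suc k) + x a * esym A k"
proof -
  have eq: "{T. T \<subseteq> insert a A \<and> card T = Suc k} = {T. T \<subseteq> A \<and> card T = Suc k} \<union> insert a ` {T. T \<subseteq> A \<and> card T = k}"
    (is "?L = ?R1 \<union> ?R2")
  proof (intro equalityI subsetI)
    fix T assume T: "T \<in> ?L"
    show "T \<in> ?R1 \<union> ?R2"
    proof (cases "a \<in> T")
      case True
      then have "T = insert a (T - {a})" "card (T - {a}) = k" "T - {a} \<subseteq> A"
        using T by auto
      then show ?thesis by blast
    qed (use T in auto)
  next
    fix T assume "T \<in> ?R1 \<union> ?R2"
    then show "T \<in> ?L" using assms by (auto simp: card_insert_if finite_subset)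
  qed
  have fin: "finite ?R1" "finite {T. T \<subseteq> A \<and> card T = k}" using assms by auto
  have disj: "?R1 \<inter> ?R2 = {}" using assms by auto
  have inj: "inj_on (insert a) {T. T \<subseteq> A \<and> card T = k}"
    using assms(2) by (intro inj_onI) (metis (mono_tags) insert_ident mem_Collect_eq subsetD)
  have "(\<Sum>T\<in>?R2. \<Prod>i\<in>T. x i) = (\<Sum>T | T \<subseteq> A \<and> card T = k. x a * (\<Prod>i\<in>T. x i))"
    unfolding sum.reindex[OF inj] comp_def
    by (rule sum.cong) (use assms in \<open>auto simp: finite_subset subset_iff intro!: prod.insert\<close>)
  then show ?thesis
    unfolding esym_def eq using fin disj by (subst sum.union_disjoint) (auto simp: sum_distrib_left)
qed

lemma esym_remove:
  assumes "finite A" "a \<in> A"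
  shows "esym A (Suc k) = esym (A - {a}) (Suc k) + x a * esym (A - {a}) k"
  using esym_insert[of "A - {a}" a k] assms by (simp add: insert_absorb)

lemma esym_empty: "esym {} (Suc k) = 0"
  by (simp add: esym_def cong: conj_cong)

text \<open>Every (k+1)-subset of A arises once from each of its k+1 elements. Summing out a clique
  vertex rests on this count.\<close>

lemma sum_esym:
  assumes "finite A"
  shows "(\<Sum>a\<in>A. x a * esym (A - {a}) k) = of_nat (Suc k) * esym A (Suc k)"
  using assms
proof (induction A arbitrary: k rule: finite_induct)
  case (insert b A)
  have rm: "insert b A - {a} = insert b (A - {a})" if "a \<in> A" for a using insert.hyps that by auto
  have ib: "insert b A - {b} = A" using insert.hyps by auto
  show ?case
  proof (cases k)
    case 0
    have "(\<Sum>a\<in>A. x a * esym (insert b A - {a}) 0) = (\<Sum>a\<in>A. x a * esym (A - {a}) 0)"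
      by (rule sum.cong) (use insert.hyps in \<open>auto simp: esym_0\<close>)
    then show ?thesis using 0 insert.hyps insert.IH[of 0] by (simp add: ib esym_insert esym_0)
  next
    case (Suc j)
    have "(\<Sum>a\<in>A. x a * esym (insert b A - {a}) k) = (\<Sum>a\<in>A. x a * esym (A - {a}) k + x b * (x a * esym (A - {a}) j))"
      by (rule sum.cong) (use insert.hyps Suc in \<open>auto simp: rm esym_insert algebra_simps\<close>)
    also have "\<dots> = of_nat (Suc k) * esym A (Suc k) + x b * (of_nat (Suc j) * esym A (Suc j))"
      by (simp only: sum.distrib sum_distrib_left[symmetric] insert.IH)
    finally show ?thesis using insert.hyps Suc by (simp add: ib esym_insert algebra_simps)
  qed
qed (simp add: esym_empty)

text \<open>X_{i+1} with mark b: the index counts the unmarked colours only, so it is one less than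
  the block size.\<close>

definition xe :: "nat \<Rightarrow> nat \<Rightarrow> 'a" where
  "xe b i = x b * esym (S - {b}) i"

lemma xe_eq: "b \<in> S \<Longrightarrow> xe b i = esym S (Suc i) - esym (S - {b}) (Suc i)"
  using esym_remove[OF finite_S] by (simp add: xe_def)

text \<open>Because e_{i+1}(S) = e_{i+1}(S-b) + x_b e_i(S-b), the left side equals -x_b^2 e_i(S-b)
  e_j(S-b), which is symmetric in i and j. Exchanging them and regrouping passes from (i+1, j) to
  (i, j+1) and splits off one summand. The purpose is to expand a product of two polynomials in S-b
  into terms e_q(S) times \<open>xe\<close>.\<close>

lemma xe_mult_esym_aux:
  assumes b: "b \<in> S" and "i \<le> j"
  shows "xe b j * esym (S - {b}) (Suc i) - esym S (Suc i) * xe b j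
    = (\<Sum>q\<le>i. esym S q * xe b (Suc (i + j) - q) - esym S (Suc (i + j) - q) * xe b q)"
proof -
  define Q where "Q i j = xe b j * esym (S - {b}) (Suc i) - esym S (Suc i) * xe b j" for i j
  have Q: "Q i j = - (x b * x b * esym (S - {b}) i * esym (S - {b}) j)" for i j
    using esym_remove[OF finite_S b, of i] by (simp add: Q_def xe_def algebra_simps)
  have Q_sym: "Q i j = Q j i" for i j by (simp add: Q)
  have "Q i j = (\<Sum>q\<le>i. esym S q * xe b (Suc (i + j) - q) - esym S (Suc (i + j) - q) * xe b q)"
    using \<open>i \<le> j\<close>
  proof (induction i arbitrary: j)
    case 0
    have "Q 0 j = Q j 0" by (rule Q_sym)
    also have "\<dots> = xe b (Suc j) - esym S (Suc j) * xe b 0"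
      using finite_S by (simp add: Q_def xe_def esym_0)
    finally show ?case using finite_S by (simp add: esym_0)
  next
    case (Suc i)
    have "Q (Suc i) j = Q j (Suc i)" by (rule Q_sym)
    also have "\<dots> = xe b (Suc i) * esym (S - {b}) (Suc j) - esym S (Suc j) * xe b (Suc i)"
      by (simp add: Q_def)
    also have "xe b (Suc i) * esym (S - {b}) (Suc j) = Q i (Suc j) + esym S (Suc i) * xe b (Suc j)"
      by (simp add: Q_def xe_def algebra_simps)
    finally show ?case using Suc.IH[of "Suc j"] Suc.prems by (simp add: algebra_simps)
  qed
  then show ?thesis by (simp add: Q_def)
qed

lemma xe_mult_esym:
  assumes b: "b \<in> S"
  shows "xe b j * esym (S - {b}) (Suc i) = esym S (Suc i) * xe b j
    + (\<Sum>q\<le>min i j. esym S q * xe b (Suc (i + j) - q) - esym S (Suc (i + j) - q) * xe b q)"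
proof (cases "i \<le> j")
  case True
  then show ?thesis using xe_mult_esym_aux[OF b True] by (simp add: min_def algebra_simps)
next
  case False
  have "xe b j * esym (S - {b}) (Suc i) - esym S (Suc i) * xe b j = xe b i * esym (S - {b}) (Suc j) - esym S (Suc j) * xe b i"
    using esym_remove[OF finite_S b, of i] esym_remove[OF finite_S b, of j] by (simp add: xe_def algebra_simps)
  with False xe_mult_esym_aux[OF b, of j i] show ?thesis by (simp add: min_def algebra_simps)
qed

section \<open>The transfer operator of the ladder and the recursions it gives\<close>

definition ladder_step :: "(nat \<Rightarrow> nat \<Rightarrow> 'a) \<Rightarrow> nat \<Rightarrow> nat \<Rightarrow> 'a" where
  "ladder_step \<phi> a b = (\<Sum>d\<in>S - {b} - {a}. x d * \<phi> b d)"

definition psum :: "(nat \<Rightarrow> nat \<Rightarrow> 'a) \<Rightarrow> (nat \<Rightarrow> nat \<Rightarrow> 'a) \<Rightarrow> 'a" where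
  "psum w \<phi> = (\<Sum>a\<in>S. \<Sum>b\<in>S - {a}. x a * x b * w a b * \<phi> a b)"

text \<open>\<open>ladder_step\<close> is a transfer operator: a and b colour consecutive vertices,
  and the next vertex d avoids both. It is moved from the function to the weight by summing out the
  first vertex a, after which (b, d) is the new first pair.\<close>

lemma psum_step:
  assumes "\<And>b d. b \<in> S \<Longrightarrow> d \<in> S - {b} \<Longrightarrow> (\<Sum>a\<in>S - {b} - {d}. x a * w a b) = w' b d"
  shows "psum w (ladder_step \<phi>) = psum w' \<phi>"
proof -
  have "psum w (ladder_step \<phi>) = (\<Sum>a\<in>S. \<Sum>b\<in>S - {a}. \<Sum>d\<in>S - {b} - {a}. x a * w a b * (x b * x d * \<phi> b d))"
    unfolding psum_def ladder_step_def sum_distrib_left by (simp add: mult_ac)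
  also have "\<dots> = (\<Sum>b\<in>S. \<Sum>a\<in>S - {b}. \<Sum>d\<in>S - {b} - {a}. x a * w a b * (x b * x d * \<phi> b d))"
    by (rule sum_off_diag_swap[OF finite_S])
  also have "\<dots> = (\<Sum>b\<in>S. \<Sum>d\<in>S - {b}. \<Sum>a\<in>S - {b} - {d}. x a * w a b * (x b * x d * \<phi> b d))"
    by (intro sum.cong refl sum_off_diag_swap) (use finite_S in auto)
  also have "\<dots> = psum w' \<phi>"
    unfolding psum_def sum_distrib_right[symmetric]
    by (intro sum.cong refl) (use assms in \<open>simp add: mult_ac\<close>)
  finally show ?thesis .
qed

lemma psum_linear:
  "psum (\<lambda>a b. w1 a b + w2 a b) \<phi> = psum w1 \<phi> + psum w2 \<phi>"
  "psum (\<lambda>a b. w1 a b - w2 a b) \<phi> = psum w1 \<phi> - psum w2 \<phi>"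
  "psum (\<lambda>a b. r * w1 a b) \<phi> = r * psum w1 \<phi>"
  by (simp_all add: psum_def sum.distrib sum_subtractf sum_distrib_left algebra_simps)

lemma psum_sum: "psum (\<lambda>a b. \<Sum>i\<in>I. w i a b) \<phi> = (\<Sum>i\<in>I. psum (w i) \<phi>)"
  by (induction I rule: infinite_finite_induct) (simp_all add: psum_linear psum_def)

text \<open>Weighted count of the n vertices that follow a pair coloured a, b; the indicator at the
  start of the iteration tests the mark on the last vertex.\<close>

definition tail :: "nat \<Rightarrow> nat \<Rightarrow> nat \<Rightarrow> nat \<Rightarrow> 'a" where
  "tail c n = (ladder_step ^^ n) (\<lambda>a b. if b = c then 1 else 0)"

text \<open>The values at \<open>n = 0\<close> are not images of graphs when \<open>j > 0\<close>; they are the ones that make the recursions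
  below hold already at the first step.\<close>

definition ladder_poly :: "nat \<Rightarrow> nat \<Rightarrow> nat \<Rightarrow> nat \<Rightarrow> 'a" where
  "ladder_poly c n i j = (case n of 0 \<Rightarrow> esym S j * xe c i
     | Suc n \<Rightarrow> psum (\<lambda>a b. esym (S - {a}) i * esym (S - {b}) j) (tail c n))"

definition lollipop_poly :: "nat \<Rightarrow> nat \<Rightarrow> nat \<Rightarrow> 'a" where
  "lollipop_poly c n i = (case n of 0 \<Rightarrow> xe c i | Suc n \<Rightarrow> psum (\<lambda>a b. esym (S - {a} - {b}) i) (tail c n))"

lemma psum_tail_0:
  assumes "c \<in> S"
  shows "psum w (tail c 0) = x c * (\<Sum>a\<in>S - {c}. x a * w a c)"
proof -
  have "psum w (tail c 0) = (\<Sum>b\<in>S. \<Sum>a\<in>S - {b}. x a * x b * w a b * (if b = c then 1 else 0))"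
    unfolding psum_def tail_def by (subst sum_off_diag_swap[OF finite_S]) simp
  also have "\<dots> = (\<Sum>b\<in>S. if b = c then \<Sum>a\<in>S - {b}. x a * x b * w a b else 0)"
    by (rule sum.cong) auto
  also have "\<dots> = (\<Sum>a\<in>S - {c}. x a * x c * w a c)"
    using assms finite_S by (simp add: sum.delta)
  finally show ?thesis by (simp add: sum_distrib_left mult_ac)
qed

lemma sum_remove1_esym:
  assumes "b \<in> S"
  shows "(\<Sum>a\<in>S - {b}. x a * esym (S - {a}) i) = of_nat (Suc i) * esym S (Suc i) - xe b i"
  using sum_esym[OF finite_S, of i] sum.remove[OF finite_S assms, of "\<lambda>a. x a * esym (S - {a}) i"]
  by (simp add: xe_def algebra_simps)

text \<open>The first ladder vertex is summed out. With b, d the next two colours, its clique leaves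
  e_{i+1}(S), e_{i+1}(S-b) and e_{i+1}(S-d). The last is a larger clique on the vertex coloured d,
  so the clique sizes become (j, i+1). The middle one meets the clique factor e_j(S-b) already
  sitting at b, and \<open>xe_mult_esym\<close> resolves that product.\<close>

lemma ladder_poly_Suc:
  assumes c: "c \<in> S"
  shows "ladder_poly c (Suc n) i j = of_nat i * esym S (Suc i) * ladder_poly c n j 0 + ladder_poly c n j (Suc i)
    + (\<Sum>q\<le>min i j. esym S q * ladder_poly c n (Suc (i + j) - q) 0 - esym S (Suc (i + j) - q) * ladder_poly c n q 0)"
proof (cases n)
  case 0
  have "ladder_poly c (Suc n) i j = x c * (\<Sum>a\<in>S - {c}. x a * (esym (S - {a}) i * esym (S - {c}) j))"
    unfolding ladder_poly_def 0 by (simp add: psum_tail_0[OF c])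
  also have "\<dots> = (\<Sum>a\<in>S - {c}. x a * esym (S - {a}) i) * xe c j"
    by (simp add: sum_distrib_left sum_distrib_right xe_def mult_ac)
  also have "\<dots> = (of_nat i * esym S (Suc i) + esym (S - {c}) (Suc i)) * xe c j"
    unfolding sum_remove1_esym[OF c] xe_eq[OF c, of i] by (simp add: algebra_simps)
  also have "\<dots> = of_nat i * esym S (Suc i) * xe c j + xe c j * esym (S - {c}) (Suc i)"
    by (simp add: algebra_simps)
  also note xe_mult_esym[OF c]
  finally show ?thesis using finite_S by (simp add: ladder_poly_def 0 esym_0)
next
  case (Suc n')
  define w where "w = (\<lambda>i j a b. esym (S - {a}) i * esym (S - {b}) j)"
  have cl: "ladder_poly c n i j = psum (w i j) (tail c n')" for i j
    by (simp add: ladder_poly_def Suc w_def)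
  have "ladder_poly c (Suc n) i j = psum (w i j) (ladder_step (tail c n'))"
    by (simp add: ladder_poly_def Suc w_def tail_def)
  also have "\<dots> = psum (\<lambda>b d. of_nat i * esym S (Suc i) * w j 0 b d + w j (Suc i) b d
      + (\<Sum>q\<le>min i j. esym S q * w (Suc (i + j) - q) 0 b d - esym S (Suc (i + j) - q) * w q 0 b d)) (tail c n')"
    (is "_ = psum ?w _")
  proof -
    have "psum (w i j) (ladder_step (tail c n')) =
        psum (\<lambda>b d. (\<Sum>a\<in>S - {b} - {d}. x a * esym (S - {a}) i) * esym (S - {b}) j) (tail c n')"
      by (rule psum_step) (simp only: w_def sum_distrib_right mult.assoc)
    also have "\<dots> = psum ?w (tail c n')"
      unfolding psum_def
    proof (intro sum.cong refl)
      fix b d assume b: "b \<in> S" and d: "d \<in> S - {b}"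
      have "(\<Sum>a\<in>S - {b} - {d}. x a * esym (S - {a}) i) = of_nat (Suc i) * esym S (Suc i) - xe b i - xe d i"
        using sum_remove1_esym[OF b, of i] sum.remove[of "S - {b}" d "\<lambda>a. x a * esym (S - {a}) i"] d finite_S
        by (simp add: xe_def algebra_simps)
      also have "\<dots> = (of_nat i - 1) * esym S (Suc i) + esym (S - {b}) (Suc i) + esym (S - {d}) (Suc i)"
        unfolding xe_eq[OF b] using d by (simp add: xe_eq algebra_simps)
      finally have s: "(\<Sum>a\<in>S - {b} - {d}. x a * esym (S - {a}) i) = \<dots>" .
      \<comment> \<open>The two weights agree only after multiplication by x_b, since
        \<open>xe_mult_esym\<close> needs this factor. Hence \<open>psum_step\<close> is applied to
        the raw weight first, and the weights are compared inside \<open>psum\<close>.\<close>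
      have "x b * ((\<Sum>a\<in>S - {b} - {d}. x a * esym (S - {a}) i) * esym (S - {b}) j)
          = (of_nat i - 1) * esym S (Suc i) * xe b j + xe b j * esym (S - {b}) (Suc i) + x b * (esym (S - {b}) j * esym (S - {d}) (Suc i))"
        unfolding s by (simp add: xe_def algebra_simps)
      also have "\<dots> = x b * ?w b d"
        unfolding xe_mult_esym[OF b] using finite_S
        by (simp add: w_def esym_0 xe_def sum_distrib_left sum_subtractf algebra_simps)
      finally have u: "x b * ((\<Sum>a\<in>S - {b} - {d}. x a * esym (S - {a}) i) * esym (S - {b}) j) = x b * ?w b d" .
      show "x b * x d * ((\<Sum>a\<in>S - {b} - {d}. x a * esym (S - {a}) i) * esym (S - {b}) j) * tail c n' b d
          = x b * x d * ?w b d * tail c n' b d"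
        using arg_cong[OF u, of "\<lambda>z. x d * tail c n' b d * z"] by (simp only: mult_ac)
    qed
    finally show ?thesis .
  qed
  finally show ?thesis
    by (simp only: cl psum_linear psum_sum)
qed

text \<open>Summing out a leaves an (m+1)-set of colours avoiding b. Trading x_d e_m(S-b-d) for
  e_{m+1}(S-b) - e_{m+1}(S-b-d) separates a clique glued at b alone from one containing both b and
  d.\<close>

lemma lollipop_poly_Suc:
  assumes c: "c \<in> S"
  shows "lollipop_poly c (Suc n) m = of_nat m * ladder_poly c n (Suc m) 0 + lollipop_poly c n (Suc m)"
proof (cases n)
  case 0
  have "(\<Sum>a\<in>S - {c}. x a * esym (S - {a} - {c}) m) = (\<Sum>a\<in>S - {c}. x a * esym (S - {c} - {a}) m)"
    by (rule sum.cong) (auto intro!: arg_cong[where f = "\<lambda>A. _ * esym A m"])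
  also have "\<dots> = of_nat (Suc m) * esym (S - {c}) (Suc m)"
    using finite_S by (intro sum_esym) auto
  finally show ?thesis
    unfolding lollipop_poly_def 0 using finite_S
    by (simp add: psum_tail_0[OF c] ladder_poly_def xe_def esym_0 algebra_simps)
next
  case (Suc n')
  have "lollipop_poly c (Suc n) m = psum (\<lambda>a b. esym (S - {a} - {b}) m) (ladder_step (tail c n'))"
    by (simp add: lollipop_poly_def Suc tail_def)
  also have "\<dots> = psum (\<lambda>b d. of_nat m * (esym (S - {b}) (Suc m) * esym (S - {d}) 0) + esym (S - {b} - {d}) (Suc m)) (tail c n')"
  proof (rule psum_step)
    fix b d assume b: "b \<in> S" and d: "d \<in> S - {b}"
    have "(\<Sum>a\<in>S - {b} - {d}. x a * esym (S - {a} - {b}) m) = (\<Sum>a\<in>S - {b} - {d}. x a * esym (S - {b} - {a}) m)"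
      by (rule sum.cong) (auto intro!: arg_cong[where f = "\<lambda>A. _ * esym A m"])
    also have "\<dots> = (\<Sum>a\<in>S - {b}. x a * esym (S - {b} - {a}) m) - x d * esym (S - {b} - {d}) m"
      using sum.remove[of "S - {b}" d "\<lambda>a. x a * esym (S - {b} - {a}) m"] d finite_S by simp
    also have "(\<Sum>a\<in>S - {b}. x a * esym (S - {b} - {a}) m) = of_nat (Suc m) * esym (S - {b}) (Suc m)"
      using finite_S by (intro sum_esym) auto
    also have "x d * esym (S - {b} - {d}) m = esym (S - {b}) (Suc m) - esym (S - {b} - {d}) (Suc m)"
      using esym_remove[of "S - {b}" d m] d finite_S by simp
    finally show "(\<Sum>a\<in>S - {b} - {d}. x a * esym (S - {a} - {b}) m) =
        of_nat m * (esym (S - {b}) (Suc m) * esym (S - {d}) 0) + esym (S - {b} - {d}) (Suc m)"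
      using finite_S by (simp add: esym_0 algebra_simps)
  qed
  finally show ?thesis
    by (simp add: psum_linear lollipop_poly_def ladder_poly_def Suc)
qed

text \<open>With no additional clique vertices both are the bare ladder. The two recursions treat it
  differently, and comparing them yields \<open>alpha_0\<close>.\<close>

lemma ladder_poly_0_0: "ladder_poly c n 0 0 = lollipop_poly c n 0"
  using finite_S by (cases n) (simp_all add: ladder_poly_def lollipop_poly_def esym_0)

end

section \<open>Colourings of the graph, one vertex at a time\<close>

lemma sum_PiE_insert:
  assumes "i \<notin> B" "finite A" "finite B"
  shows "(\<Sum>t | t \<in> insert i B \<rightarrow>\<^sub>E A \<and> Q t. g t) = (\<Sum>a\<in>A. \<Sum>t | t \<in> B \<rightarrow>\<^sub>E A \<and> Q (t(i := a)). g (t(i := a)))"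
proof -
  have "(\<Sum>a\<in>A. \<Sum>t | t \<in> B \<rightarrow>\<^sub>E A \<and> Q (t(i := a)). g (t(i := a)))
      = (\<Sum>(a,t)\<in>Sigma A (\<lambda>a. {t. t \<in> B \<rightarrow>\<^sub>E A \<and> Q (t(i := a))}). g (t(i := a)))"
    using assms by (subst sum.Sigma) (auto intro!: finite_subset[OF _ finite_PiE[of B "\<lambda>_. A"]])
  also have "\<dots> = (\<Sum>t | t \<in> insert i B \<rightarrow>\<^sub>E A \<and> Q t. g t)"
  proof (rule sum.reindex_bij_witness[of _ "\<lambda>t. (t i, t(i := undefined))" "\<lambda>(a,t). t(i := a)"])
    fix p assume "p \<in> Sigma A (\<lambda>a. {t. t \<in> B \<rightarrow>\<^sub>E A \<and> Q (t(i := a))})"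
    then obtain a t where p: "p = (a, t)" "a \<in> A" "t \<in> B \<rightarrow>\<^sub>E A" "Q (t(i := a))" by auto
    have "t i = undefined" using p(3) assms(1) by (auto simp: PiE_def extensional_def)
    then show "(((case p of (a, t) \<Rightarrow> t(i := a)) i), (case p of (a, t) \<Rightarrow> t(i := a))(i := undefined)) = p"
      by (auto simp: p(1))
    show "(case p of (a, t) \<Rightarrow> t(i := a)) \<in> {t. t \<in> insert i B \<rightarrow>\<^sub>E A \<and> Q t}"
      using p by (auto simp: PiE_def extensional_def)
  next
    fix t assume "t \<in> {t. t \<in> insert i B \<rightarrow>\<^sub>E A \<and> Q t}"
    then show "(t i, t(i := undefined)) \<in> Sigma A (\<lambda>a. {t. t \<in> B \<rightarrow>\<^sub>E A \<and> Q (t(i := a))})"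
      using assms(1) by (auto simp: PiE_def extensional_def)
  qed auto
  finally show ?thesis ..
qed

context esym_family
begin

lemma sum_prod_insert:
  assumes "i \<notin> B" "finite A" "finite B"
  shows "(\<Sum>t | t \<in> insert i B \<rightarrow>\<^sub>E A \<and> Q t. (\<Prod>j\<in>insert i B. x (t j)) * g t)
    = (\<Sum>a\<in>A. \<Sum>t | t \<in> B \<rightarrow>\<^sub>E A \<and> Q (t(i := a)). x a * ((\<Prod>j\<in>B. x (t j)) * g (t(i := a))))"
proof -
  have "(\<Prod>j\<in>insert i B. x ((t(i := a)) j)) = x a * (\<Prod>j\<in>B. x (t j))" for t a
    using assms by (auto simp: prod.insert intro!: prod.cong arg_cong[where f = "\<lambda>z. _ * z"])
  then show ?thesis
    unfolding sum_PiE_insert[OF assms] by (simp add: mult.assoc)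
qed

lemma sum_prod_inj:
  assumes "finite B" "finite A"
  shows "(\<Sum>t | t \<in> B \<rightarrow>\<^sub>E A \<and> inj_on t B. \<Prod>j\<in>B. x (t j)) = of_nat (fact (card B)) * esym A (card B)"
  using assms
proof (induction B arbitrary: A rule: finite_induct)
  case empty
  then show ?case by (simp add: esym_0)
next
  case (insert i B)
  have eq: "{t. t \<in> B \<rightarrow>\<^sub>E A \<and> inj_on (t(i := a)) (insert i B)} = {t. t \<in> B \<rightarrow>\<^sub>E (A - {a}) \<and> inj_on t B}" for a
  proof -
    have "inj_on (t(i := a)) (insert i B) \<longleftrightarrow> inj_on t B \<and> a \<notin> t ` B" for t
      using insert.hyps by (auto simp: inj_on_def)
    then show ?thesis by (auto simp: PiE_def Pi_def)
  qed
  have "(\<Sum>t | t \<in> insert i B \<rightarrow>\<^sub>E A \<and> inj_on t (insert i B). \<Prod>j\<in>insert i B. x (t j))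
      = (\<Sum>a\<in>A. x a * (\<Sum>t | t \<in> B \<rightarrow>\<^sub>E (A - {a}) \<and> inj_on t B. \<Prod>j\<in>B. x (t j)))"
    using sum_prod_insert[where i = i and B = B and A = A and Q = "\<lambda>t. inj_on t (insert i B)" and g = "\<lambda>_. 1", OF insert.hyps(2) insert.prems insert.hyps(1)]
    by (simp only: eq sum_distrib_left mult_1_right)
  also have "\<dots> = of_nat (fact (card B)) * (\<Sum>a\<in>A. x a * esym (A - {a}) (card B))"
    using insert.prems by (simp add: insert.IH sum_distrib_left mult_ac)
  finally show ?case
    using insert.hyps insert.prems by (simp add: sum_esym algebra_simps)
qed

lemma sum_prod_inj_fixed:
  assumes "finite B" "finite A" "j \<in> B" "b \<in> A"
  shows "(\<Sum>t | t \<in> B \<rightarrow>\<^sub>E A \<and> inj_on t B \<and> t j = b. \<Prod>i\<in>B. x (t i))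
    = of_nat (fact (card B - 1)) * (x b * esym (A - {b}) (card B - 1))"
proof -
  define B' where "B' = B - {j}"
  have B: "B = insert j B'" "j \<notin> B'" "finite B'" "card B' = card B - 1"
    using assms by (auto simp: B'_def)
  have eq: "{t. t \<in> B' \<rightarrow>\<^sub>E A \<and> inj_on (t(j := a)) (insert j B') \<and> (t(j := a)) j = b}
      = (if a = b then {t. t \<in> B' \<rightarrow>\<^sub>E (A - {b}) \<and> inj_on t B'} else {})" for a
  proof -
    have "inj_on (t(j := a)) (insert j B') \<longleftrightarrow> inj_on t B' \<and> a \<notin> t ` B'" for t
      using B by (auto simp: inj_on_def)
    then show ?thesis by (auto simp: PiE_def Pi_def)
  qed
  have "(\<Sum>t | t \<in> B \<rightarrow>\<^sub>E A \<and> inj_on t B \<and> t j = b. \<Prod>i\<in>B. x (t i))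
      = (\<Sum>a\<in>A. \<Sum>t\<in>(if a = b then {t. t \<in> B' \<rightarrow>\<^sub>E (A - {b}) \<and> inj_on t B'} else {}). x a * (\<Prod>i\<in>B'. x (t i)))"
    unfolding B(1) using sum_prod_insert[where i = j and B = B' and A = A and Q = "\<lambda>t. inj_on t (insert j B') \<and> t j = b" and g = "\<lambda>_. 1", OF B(2) assms(2) B(3)]
    by (simp only: eq mult_1_right)
  also have "\<dots> = (\<Sum>a\<in>A. if a = b then x b * (\<Sum>t | t \<in> B' \<rightarrow>\<^sub>E (A - {b}) \<and> inj_on t B'. \<Prod>i\<in>B'. x (t i)) else 0)"
    by (rule sum.cong) (auto simp: sum_distrib_left)
  also have "\<dots> = x b * (of_nat (fact (card B')) * esym (A - {b}) (card B'))"
    using assms B by (simp add: sum.delta sum_prod_inj)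
  finally show ?thesis by (simp add: B(4) mult_ac)
qed

definition cols :: "nat \<Rightarrow> (nat \<Rightarrow> nat) \<Rightarrow> (nat \<Rightarrow> nat) set" where
  "cols d w = {t. t \<in> {1..d} \<rightarrow>\<^sub>E S \<and> (\<forall>u v. 1 \<le> u \<and> u < v \<and> v \<le> d \<and> w v \<le> u \<longrightarrow> t u \<noteq> t v)}"

text \<open>Among the earlier vertices, the neighbours of d+1 are exactly the interval from
  \<open>w (Suc d)\<close> to d, so deleting d+1 leaves a colouring of the rest and a colour outside
  the image of that interval. The factor g is arbitrary so that the step can be iterated.\<close>

lemma sum_cols_Suc:
  assumes w: "1 \<le> w (Suc d)"
  shows "(\<Sum>t\<in>cols (Suc d) w. (\<Prod>i=1..Suc d. x (t i)) * g t)
    = (\<Sum>t\<in>cols d w. (\<Prod>i=1..d. x (t i)) * (\<Sum>a\<in>S - t ` {w (Suc d)..d}. x a * g (t(Suc d := a))))"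
proof -
  define P where "P d t \<longleftrightarrow> (\<forall>u v. 1 \<le> u \<and> u < v \<and> v \<le> d \<and> w v \<le> u \<longrightarrow> t u \<noteq> t v)" for d and t :: "nat \<Rightarrow> nat"
  have P: "P (Suc d) (t(Suc d := a)) \<longleftrightarrow> P d t \<and> a \<notin> t ` {w (Suc d)..d}" for t a
  proof -
    have "P (Suc d) t' \<longleftrightarrow> P d t' \<and> (\<forall>u. 1 \<le> u \<and> u \<le> d \<and> w (Suc d) \<le> u \<longrightarrow> t' u \<noteq> t' (Suc d))" for t'
      unfolding P_def le_Suc_eq[of _ d] less_Suc_eq_le[of _ d, symmetric] by blast
    moreover have "P d (t(Suc d := a)) \<longleftrightarrow> P d t" unfolding P_def by simp
    moreover have "(\<forall>u. 1 \<le> u \<and> u \<le> d \<and> w (Suc d) \<le> u \<longrightarrow> (t(Suc d := a)) u \<noteq> (t(Suc d := a)) (Suc d))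
        \<longleftrightarrow> a \<notin> t ` {w (Suc d)..d}"
    proof -
      have "1 \<le> u \<and> u \<le> d \<and> w (Suc d) \<le> u \<longleftrightarrow> u \<in> {w (Suc d)..d}" for u using w by auto
      then show ?thesis by (auto simp del: One_nat_def)
    qed
    ultimately show ?thesis by blast
  qed
  have i: "{1..Suc d} = insert (Suc d) {1..d}" by auto
  have fin: "finite (cols d w)"
    unfolding cols_def by (rule finite_subset[of _ "{1..d} \<rightarrow>\<^sub>E S"]) (auto intro!: finite_PiE finite_S)
  have "(\<Sum>t\<in>cols (Suc d) w. (\<Prod>i=1..Suc d. x (t i)) * g t)
      = (\<Sum>a\<in>S. \<Sum>t | t \<in> {1..d} \<rightarrow>\<^sub>E S \<and> P (Suc d) (t(Suc d := a)). x a * ((\<Prod>i=1..d. x (t i)) * g (t(Suc d := a))))"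
    unfolding cols_def P_def[symmetric] i by (rule sum_prod_insert) (use finite_S in auto)
  also have "\<dots> = (\<Sum>a\<in>S. \<Sum>t | t \<in> cols d w \<and> a \<notin> t ` {w (Suc d)..d}. x a * ((\<Prod>i=1..d. x (t i)) * g (t(Suc d := a))))"
    unfolding cols_def P_def[symmetric] P by (simp add: conj_assoc)
  also have "\<dots> = (\<Sum>t\<in>cols d w. \<Sum>a | a \<in> S \<and> a \<notin> t ` {w (Suc d)..d}. x a * ((\<Prod>i=1..d. x (t i)) * g (t(Suc d := a))))"
    by (rule sum.swap_restrict[OF finite_S fin])
  also have "\<dots> = (\<Sum>t\<in>cols d w. (\<Prod>i=1..d. x (t i)) * (\<Sum>a\<in>S - t ` {w (Suc d)..d}. x a * g (t(Suc d := a))))"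
    unfolding sum_distrib_left by (intro sum.cong) (auto simp: mult_ac)
  finally show ?thesis .
qed

lemma sum_cols_tail:
  assumes m: "2 \<le> m" and w: "\<And>i. m < i \<Longrightarrow> w i = i - 2"
  shows "(\<Sum>t\<in>cols (m + n) w. (\<Prod>i=1..m+n. x (t i)) * \<phi> (t (m + n - 1)) (t (m + n)))
    = (\<Sum>t\<in>cols m w. (\<Prod>i=1..m. x (t i)) * (ladder_step ^^ n) \<phi> (t (m - 1)) (t m))"
proof (induction n arbitrary: \<phi>)
  case (Suc n)
  define d where "d = m + n"
  have wd: "w (Suc d) = d - 1" using w[of "Suc d"] by (simp add: d_def)
  have dd: "{d - 1..d} = {d - 1, d}" using m by (auto simp: d_def)
  have ne: "Suc d \<noteq> d - 1" by simp
  have "(\<Sum>t\<in>cols (Suc d) w. (\<Prod>i=1..Suc d. x (t i)) * \<phi> (t d) (t (Suc d)))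
      = (\<Sum>t\<in>cols d w. (\<Prod>i=1..d. x (t i)) * ladder_step \<phi> (t (d - 1)) (t d))"
  proof -
    have "1 \<le> w (Suc d)" using m unfolding wd by (simp add: d_def)
    note sum_cols_Suc[of w d "\<lambda>t. \<phi> (t d) (t (Suc d))", OF this]
    also have "(\<Sum>t\<in>cols d w. (\<Prod>i=1..d. x (t i)) * (\<Sum>a\<in>S - t ` {w (Suc d)..d}. x a * \<phi> ((t(Suc d := a)) d) ((t(Suc d := a)) (Suc d))))
        = (\<Sum>t\<in>cols d w. (\<Prod>i=1..d. x (t i)) * ladder_step \<phi> (t (d - 1)) (t d))"
    proof (rule sum.cong[OF refl])
      fix t
      have "S - t ` {w (Suc d)..d} = S - {t d} - {t (d - 1)}" unfolding wd dd by auto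
      then show "(\<Prod>i=1..d. x (t i)) * (\<Sum>a\<in>S - t ` {w (Suc d)..d}. x a * \<phi> ((t(Suc d := a)) d) ((t(Suc d := a)) (Suc d)))
        = (\<Prod>i=1..d. x (t i)) * ladder_step \<phi> (t (d - 1)) (t d)"
        by (simp add: ladder_step_def)
    qed
    finally show ?thesis .
  qed
  then show ?case using Suc.IH[of "ladder_step \<phi>"] by (simp add: d_def funpow_Suc_right del: funpow.simps)
qed simp

text \<open>Vertices 1..M form a clique; a colours vertex M+1, which sees all of them, and b colours
  vertex M+2, which sees only k+1..M and M+1. From all injective colourings avoiding a, those that
  use b on k+1..M are removed. Writing x_b e_{M-1}(S-a-b) as e_M(S-a) - e_M(S-a-b) then turns M! and
  (M-k)(M-1)! into the weights k and M-k.\<close>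

lemma sum_cols_head:
  assumes "1 \<le> k" "k \<le> M" "1 \<le> M" and w: "\<And>i. i \<le> Suc M \<Longrightarrow> w i = 1" "w (Suc (Suc M)) = k + 1"
  shows "(\<Sum>t\<in>cols (Suc (Suc M)) w. (\<Prod>i=1..Suc (Suc M). x (t i)) * \<psi> (t (Suc M)) (t (Suc (Suc M))))
    = of_nat (fact (M - 1)) * psum (\<lambda>a b. of_nat k * (esym (S - {a}) M * esym (S - {b}) 0)
        + of_nat (M - k) * esym (S - {a} - {b}) M) \<psi>"
proof -
  define C where "C = cols M w"
  define I where "I a b = (\<Sum>t | t \<in> C \<and> a \<notin> t ` {1..M} \<and> b \<notin> t ` {k+1..M}. \<Prod>i=1..M. x (t i))" for a b
  have fin: "finite C"
    unfolding C_def cols_def by (rule finite_subset[of _ "{1..M} \<rightarrow>\<^sub>E S"]) (auto intro!: finite_PiE finite_S)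
  have C: "C = {t. t \<in> {1..M} \<rightarrow>\<^sub>E S \<and> inj_on t {1..M}}"
  proof -
    have "(\<forall>u v. 1 \<le> u \<and> u < v \<and> v \<le> M \<and> w v \<le> u \<longrightarrow> t u \<noteq> t v) \<longleftrightarrow> inj_on t {1..M}" for t :: "nat \<Rightarrow> nat"
    proof -
      have "1 \<le> u \<and> u < v \<and> v \<le> M \<and> w v \<le> u \<longleftrightarrow> u \<in> {1..M} \<and> v \<in> {1..M} \<and> u < v" for u v
        using w(1)[of v] by auto
      then have "(\<forall>u v. 1 \<le> u \<and> u < v \<and> v \<le> M \<and> w v \<le> u \<longrightarrow> t u \<noteq> t v) \<longleftrightarrow>
          (\<forall>u v. u \<in> {1..M} \<and> v \<in> {1..M} \<and> u < v \<longrightarrow> t u \<noteq> t v)" by (simp only:)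
      also have "\<dots> \<longleftrightarrow> inj_on t {1..M}"
        (is "?L \<longleftrightarrow> _")
      proof
        assume ?L
        then show "inj_on t {1..M}" by (intro linorder_inj_onI) auto
      next
        assume "inj_on t {1..M}"
        then show ?L by (metis inj_onD less_irrefl)
      qed
      finally show ?thesis .
    qed
    then show ?thesis by (simp only: C_def cols_def)
  qed
  have "(\<Sum>t\<in>cols (Suc (Suc M)) w. (\<Prod>i=1..Suc (Suc M). x (t i)) * \<psi> (t (Suc M)) (t (Suc (Suc M))))
      = (\<Sum>t\<in>cols (Suc M) w. (\<Prod>i=1..Suc M. x (t i)) * (\<Sum>b\<in>S - t ` {k+1..Suc M}. x b * \<psi> (t (Suc M)) b))"
    using sum_cols_Suc[of w "Suc M" "\<lambda>t. \<psi> (t (Suc M)) (t (Suc (Suc M)))"] by (simp add: w)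
  also have "\<dots> = (\<Sum>t\<in>C. (\<Prod>i=1..M. x (t i)) * (\<Sum>a\<in>S - t ` {1..M}. x a *
      (\<Sum>b\<in>S - (t(Suc M := a)) ` {k+1..Suc M}. x b * \<psi> a b)))"
    using sum_cols_Suc[of w M "\<lambda>t. \<Sum>b\<in>S - t ` {k+1..Suc M}. x b * \<psi> (t (Suc M)) b"] w(1)[of "Suc M"]
    by (simp add: C_def)
  also have "\<dots> = (\<Sum>t\<in>C. \<Sum>a | a \<in> S \<and> a \<notin> t ` {1..M}. \<Sum>b | b \<in> S - {a} \<and> b \<notin> t ` {k+1..M}.
      x a * x b * \<psi> a b * (\<Prod>i=1..M. x (t i)))"
  proof (rule sum.cong[OF refl])
    fix t
    have "S - (t(Suc M := a)) ` {k+1..Suc M} = {b. b \<in> S - {a} \<and> b \<notin> t ` {k+1..M}}" for a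
    proof -
      have "{k+1..Suc M} = insert (Suc M) {k+1..M}" using assms by auto
      then have "(t(Suc M := a)) ` {k+1..Suc M} = insert a (t ` {k+1..M})" by auto
      then show ?thesis by auto
    qed
    moreover have "S - t ` {1..M} = {a. a \<in> S \<and> a \<notin> t ` {1..M}}" by auto
    ultimately show "(\<Prod>i=1..M. x (t i)) * (\<Sum>a\<in>S - t ` {1..M}. x a *
      (\<Sum>b\<in>S - (t(Suc M := a)) ` {k+1..Suc M}. x b * \<psi> a b)) = (\<Sum>a | a \<in> S \<and> a \<notin> t ` {1..M}. \<Sum>b | b \<in> S - {a} \<and> b \<notin> t ` {k+1..M}.
      x a * x b * \<psi> a b * (\<Prod>i=1..M. x (t i)))"
      by (simp only: sum_distrib_left mult_ac)
  qed
  also have "\<dots> = (\<Sum>a\<in>S. \<Sum>t | t \<in> C \<and> a \<notin> t ` {1..M}. \<Sum>b | b \<in> S - {a} \<and> b \<notin> t ` {k+1..M}.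
      x a * x b * \<psi> a b * (\<Prod>i=1..M. x (t i)))"
    by (rule sum.swap_restrict[OF fin finite_S])
  also have "\<dots> = (\<Sum>a\<in>S. \<Sum>b\<in>S - {a}. \<Sum>t | t \<in> {t. t \<in> C \<and> a \<notin> t ` {1..M}} \<and> b \<notin> t ` {k+1..M}.
      x a * x b * \<psi> a b * (\<Prod>i=1..M. x (t i)))"
    by (intro sum.cong refl sum.swap_restrict) (use fin finite_S in auto)
  also have "\<dots> = (\<Sum>a\<in>S. \<Sum>b\<in>S - {a}. x a * x b * I a b * \<psi> a b)"
    unfolding I_def by (intro sum.cong refl) (simp add: sum_distrib_left conj_assoc mult_ac)
  also have "\<dots> = (\<Sum>a\<in>S. \<Sum>b\<in>S - {a}. x a * x b * (of_nat (fact (M - 1)) * (of_nat k * (esym (S - {a}) M * esym (S - {b}) 0)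
        + of_nat (M - k) * esym (S - {a} - {b}) M)) * \<psi> a b)"
  proof (intro sum.cong refl)
    fix a b assume a: "a \<in> S" and b: "b \<in> S - {a}"
    define T where "T = {t. t \<in> {1..M} \<rightarrow>\<^sub>E (S - {a}) \<and> inj_on t {1..M}}"
    have finT: "finite T"
      unfolding T_def by (rule finite_subset[of _ "{1..M} \<rightarrow>\<^sub>E (S - {a})"]) (auto intro!: finite_PiE simp: finite_S)
    have T: "{t. t \<in> C \<and> a \<notin> t ` {1..M} \<and> b \<notin> t ` {k+1..M}} = T - (\<Union>j\<in>{k+1..M}. {t \<in> T. t j = b})"
      unfolding C T_def by (auto simp: PiE_def Pi_def)
    have 1: "(\<Sum>t\<in>T. \<Prod>i=1..M. x (t i)) = of_nat (fact M) * esym (S - {a}) M"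
      using sum_prod_inj[of "{1..M}" "S - {a}"] finite_S by (simp add: T_def)
    \<comment> \<open>By injectivity b is used at most once, so the sets for different j are
      disjoint and contribute equally.\<close>
    have 2: "(\<Sum>t\<in>(\<Union>j\<in>{k+1..M}. {t \<in> T. t j = b}). \<Prod>i=1..M. x (t i))
        = of_nat (M - k) * (of_nat (fact (M - 1)) * (x b * esym (S - {a} - {b}) (M - 1)))"
    proof -
      have "(\<Sum>t\<in>(\<Union>j\<in>{k+1..M}. {t \<in> T. t j = b}). \<Prod>i=1..M. x (t i))
          = (\<Sum>j\<in>{k+1..M}. \<Sum>t | t \<in> T \<and> t j = b. \<Prod>i=1..M. x (t i))"
      proof (rule sum.UNION_disjoint)
        show "\<forall>i\<in>{k+1..M}. \<forall>j\<in>{k+1..M}. i \<noteq> j \<longrightarrow> {t \<in> T. t i = b} \<inter> {t \<in> T. t j = b} = {}"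
        proof (intro ballI impI, rule equals0I)
          fix i j t assume ij: "i \<in> {k+1..M}" "j \<in> {k+1..M}" "i \<noteq> j" and t: "t \<in> {t \<in> T. t i = b} \<inter> {t \<in> T. t j = b}"
          then have "inj_on t {1..M}" "t i = t j" by (auto simp: T_def)
          then show False using ij by (auto dest: inj_onD)
        qed
      qed (use finT in auto)
      also have "\<dots> = (\<Sum>j\<in>{k+1..M}. of_nat (fact (M - 1)) * (x b * esym (S - {a} - {b}) (M - 1)))"
      proof (rule sum.cong[OF refl])
        fix j assume "j \<in> {k+1..M}"
        then show "(\<Sum>t | t \<in> T \<and> t j = b. \<Prod>i=1..M. x (t i)) = of_nat (fact (M - 1)) * (x b * esym (S - {a} - {b}) (M - 1))"
          using sum_prod_inj_fixed[of "{1..M}" "S - {a}" j b] b finite_S by (simp add: T_def conj_assoc)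
      qed
      finally show ?thesis using assms by simp
    qed
    have "I a b = of_nat (fact M) * esym (S - {a}) M - of_nat (M - k) * (of_nat (fact (M - 1)) * (x b * esym (S - {a} - {b}) (M - 1)))"
      unfolding I_def T 1[symmetric] 2[symmetric] using finT by (intro sum_diff) auto
    also have "x b * esym (S - {a} - {b}) (M - 1) = esym (S - {a}) M - esym (S - {a} - {b}) M"
      using esym_remove[of "S - {a}" b "M - 1"] b finite_S assms by simp
    also have "(fact M :: nat) = M * fact (M - 1)" using assms by (subst fact_reduce) auto
    also have "of_nat (M * fact (M - 1)) = (of_nat k + of_nat (M - k)) * (of_nat (fact (M - 1)) :: 'a)"
      using assms by (simp flip: of_nat_add)
    finally show "x a * x b * I a b * \<psi> a b = x a * x b * (of_nat (fact (M - 1)) * (of_nat k * (esym (S - {a}) M * esym (S - {b}) 0)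
        + of_nat (M - k) * esym (S - {a} - {b}) M)) * \<psi> a b"
      using finite_S by (simp add: esym_0 algebra_simps)
  qed
  finally show ?thesis
    by (simp add: psum_def sum_distrib_left mult_ac)
qed

lemma sum_cols_WL:
  assumes "4 \<le> m" "1 \<le> k" "k \<le> m - 2"
  shows "(\<Sum>t | t \<in> cols (m + n) (WL_seq m k) \<and> t (m + n) = c. \<Prod>i=1..m+n. x (t i))
    = of_nat (fact (m - 3)) * (of_nat k * ladder_poly c (Suc n) (m - 2) 0 + of_nat (m - 2 - k) * lollipop_poly c (Suc n) (m - 2))"
proof -
  define \<phi> :: "nat \<Rightarrow> nat \<Rightarrow> 'a" where "\<phi> a b = (if b = c then 1 else 0)" for a b
  define M where "M = m - 2"
  have m: "m = Suc (Suc M)" "m - 2 = M" "m - 3 = M - 1" using assms by (auto simp: M_def)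
  have fin: "finite (cols (m + n) (WL_seq m k))"
    unfolding cols_def by (rule finite_subset[of _ "{1..m + n} \<rightarrow>\<^sub>E S"]) (auto intro!: finite_PiE finite_S)
  have "(\<Sum>t | t \<in> cols (m + n) (WL_seq m k) \<and> t (m + n) = c. \<Prod>i=1..m+n. x (t i))
      = (\<Sum>t\<in>cols (m + n) (WL_seq m k). (\<Prod>i=1..m+n. x (t i)) * \<phi> (t (m + n - 1)) (t (m + n)))"
    by (rule sum.mono_neutral_cong_left) (use fin in \<open>auto simp: \<phi>_def\<close>)
  also have "\<dots> = (\<Sum>t\<in>cols m (WL_seq m k). (\<Prod>i=1..m. x (t i)) * (ladder_step ^^ n) \<phi> (t (m - 1)) (t m))"
    by (rule sum_cols_tail) (use assms in \<open>auto simp: WL_seq_def\<close>)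
  also have "\<dots> = of_nat (fact (M - 1)) * psum (\<lambda>a b. of_nat k * (esym (S - {a}) M * esym (S - {b}) 0)
        + of_nat (M - k) * esym (S - {a} - {b}) M) ((ladder_step ^^ n) \<phi>)"
    using sum_cols_head[of k M "WL_seq m k" "(ladder_step ^^ n) \<phi>"] assms unfolding m by (simp add: WL_seq_def)
  also have "(ladder_step ^^ n) \<phi> = tail c n"
    by (simp add: tail_def \<phi>_def[abs_def])
  finally show ?thesis
    by (simp add: psum_linear ladder_poly_def lollipop_poly_def m)
qed

end

subsection \<open>The basis of elementary symmetric functions in noncommuting variables\<close>

definition word_fun :: "nat \<Rightarrow> nat list \<Rightarrow> nat \<Rightarrow> nat" where
  "word_fun d u = (\<lambda>i\<in>{1..d}. u ! (i - 1))"

text \<open>All series in use are indicators of a condition on the colouring read off a word, so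
  identities between them can be checked for one colouring at a time.\<close>

definition nc_ind :: "nat \<Rightarrow> ((nat \<Rightarrow> nat) \<Rightarrow> bool) \<Rightarrow> nc_series" where
  "nc_ind d Q = (\<lambda>u. if length u = d \<and> set u \<subseteq> {0<..} \<and> Q (word_fun d u) then 1 else 0)"

lemma map_word_fun: "length u = d \<Longrightarrow> map (word_fun d u) [1..<Suc d] = u"
  by (auto simp: word_fun_def intro!: nth_equalityI simp del: upt_Suc)

lemma word_fun_map:
  assumes "t \<in> {1..d} \<rightarrow>\<^sub>E A"
  shows "word_fun d (map t [1..<Suc d]) = t"
proof
  fix i show "word_fun d (map t [1..<Suc d]) i = t i"
  proof (cases "i \<in> {1..d}")
    case True
    then have "i - 1 < d" "Suc (i - 1) = i" by auto
    then show ?thesis using True by (simp add: word_fun_def del: upt_Suc)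
  next
    case False
    then show ?thesis by (simp only: word_fun_def restrict_apply if_False PiE_arb[OF assms False])
  qed
qed

lemma word_fun_PiE:
  assumes "length u = d" "set u \<subseteq> A"
  shows "word_fun d u \<in> {1..d} \<rightarrow>\<^sub>E A"
proof -
  have "u ! (i - 1) \<in> A" if "i \<in> {1..d}" for i
    using that assms nth_mem[of "i - 1" u] by auto
  then show ?thesis by (auto simp: word_fun_def)
qed

lemma monomial_sum_eq_nc_ind: "monomial_sum d {t \<in> {1..d} \<rightarrow>\<^sub>E {0<..}. Q t} = nc_ind d Q"
proof
  fix u
  show "monomial_sum d {t \<in> {1..d} \<rightarrow>\<^sub>E {0<..}. Q t} u = nc_ind d Q u"
  proof (cases "length u = d \<and> set u \<subseteq> {0<..} \<and> Q (word_fun d u)")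
    case True
    have "t = word_fun d u" if "t \<in> {1..d} \<rightarrow>\<^sub>E {0<..}" "map t [1..<Suc d] = u" for t
      using word_fun_map[OF that(1)] that(2) by simp
    moreover have "word_fun d u \<in> {t \<in> {1..d} \<rightarrow>\<^sub>E {0<..}. Q t}" "map (word_fun d u) [1..<Suc d] = u"
      using True map_word_fun[of u d] word_fun_PiE[of u d "{0<..}"] by auto
    ultimately have "{t \<in> {t \<in> {1..d} \<rightarrow>\<^sub>E {0<..}. Q t}. map t [1..<Suc d] = u} = {word_fun d u}"
      by blast
    then show ?thesis using True unfolding monomial_sum_def nc_ind_def by (simp del: upt_Suc)
  next
    case False
    have "length u = d \<and> set u \<subseteq> {0<..} \<and> Q (word_fun d u)"
      if t: "t \<in> {1..d} \<rightarrow>\<^sub>E {0<..}" "Q t" "map t [1..<Suc d] = u" for t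
    proof -
      have "word_fun d u = t" using word_fun_map[OF t(1)] t(3) by simp
      moreover have "length u = d" unfolding t(3)[symmetric] by (simp del: upt_Suc)
      moreover have "set u \<subseteq> {0<..}" unfolding t(3)[symmetric] using t(1) by (auto simp del: upt_Suc)
      ultimately show ?thesis using t(2) by simp
    qed
    then have e: "{t \<in> {t \<in> {1..d} \<rightarrow>\<^sub>E {0<..}. Q t}. map t [1..<Suc d] = u} = {}"
      using False by blast
    show ?thesis using False unfolding monomial_sum_def nc_ind_def e by simp
  qed
qed

lemma nc_ind_cong: "(\<And>t. t \<in> {1..d} \<rightarrow>\<^sub>E {0<..} \<Longrightarrow> Q t = R t) \<Longrightarrow> nc_ind d Q = nc_ind d R"
  using word_fun_PiE[of _ d "{0<..}"] by (auto simp: nc_ind_def fun_eq_iff)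

lemma block_eq_iff:
  assumes "partition_on A \<pi>" "B \<in> \<pi>" "i \<in> B"
  shows "block \<pi> i = B"
proof -
  have "C = B" if "C \<in> \<pi>" "i \<in> C" for C
    using assms(2,3) that disjointD[OF partition_onD2[OF assms(1)], of C B] by blast
  then show ?thesis using assms(2,3) unfolding block_def by (intro the_equality conjI) blast+
qed

lemma block_in:
  assumes "partition_on A \<pi>" "i \<in> A"
  shows "block \<pi> i \<in> \<pi>" "i \<in> block \<pi> i"
proof -
  obtain B where "B \<in> \<pi>" "i \<in> B" using assms(2) partition_onD1[OF assms(1)] by blast
  then show "block \<pi> i \<in> \<pi>" "i \<in> block \<pi> i" using block_eq_iff[OF assms(1)] by simp_all
qed

lemma nc_sum_apply: "(\<Sum>i\<in>I. f i) u = (\<Sum>i\<in>I. f i u)" for f :: "'i \<Rightarrow> nc_series"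
  by (induction I rule: infinite_finite_induct) auto

lemma nc_e_eq_nc_ind:
  assumes \<pi>: "partition_on {1..d} \<pi>"
  shows "nc_e d \<pi> = nc_ind d (\<lambda>t. \<forall>B\<in>\<pi>. inj_on t B)"
proof -
  have "(\<forall>j\<in>{1..d}. \<forall>k\<in>{1..d}. j \<noteq> k \<and> block \<pi> j = block \<pi> k \<longrightarrow> t j \<noteq> t k) \<longleftrightarrow> (\<forall>B\<in>\<pi>. inj_on t B)"
    (is "?L \<longleftrightarrow> ?R") for t :: "nat \<Rightarrow> nat"
  proof
    assume ?L
    show ?R
    proof (intro ballI inj_onI, rule ccontr)
      fix B i j assume B: "B \<in> \<pi>" "i \<in> B" "j \<in> B" and t: "t i = t j" "i \<noteq> j"
      then have "i \<in> {1..d}" "j \<in> {1..d}" using partition_onD1[OF \<pi>] by auto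
      moreover have "block \<pi> i = block \<pi> j" using block_eq_iff[OF \<pi>] B by simp
      ultimately show False using \<open>?L\<close> t by blast
    qed
  next
    assume ?R
    show ?L
    proof (intro ballI impI)
      fix j k assume jk: "j \<in> {1..d}" "k \<in> {1..d}" "j \<noteq> k \<and> block \<pi> j = block \<pi> k"
      have "block \<pi> j \<in> \<pi>" "j \<in> block \<pi> j" "k \<in> block \<pi> j"
        using block_in[OF \<pi> jk(1)] block_in[OF \<pi> jk(2)] jk(3) by auto
      then show "t j \<noteq> t k" using \<open>?R\<close> jk(3) by (auto dest: inj_onD)
    qed
  qed
  then show ?thesis
    unfolding nc_e_def monomial_sum_eq_nc_ind by (simp only:)
qed

text \<open>Partitions are compared through their equivalence relations: coarsening becomes
  inclusion, and the kernel of a colouring is a relation of the same kind.\<close>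

definition eqr :: "nat set set \<Rightarrow> (nat \<times> nat) set" where
  "eqr \<sigma> = {(x, y). \<exists>B\<in>\<sigma>. x \<in> B \<and> y \<in> B}"

definition krel :: "nat \<Rightarrow> (nat \<Rightarrow> nat) \<Rightarrow> (nat \<times> nat) set" where
  "krel d t = {(i, j). i \<in> {1..d} \<and> j \<in> {1..d} \<and> t i = t j}"

lemma eqr_inj:
  assumes "partition_on A \<sigma>" "partition_on A \<tau>" "eqr \<sigma> = eqr \<tau>"
  shows "\<sigma> = \<tau>"
proof -
  have "\<sigma> = A // eqr \<sigma>"
    unfolding eqr_def by (rule partition_on_eq_quotient[OF assms(1), symmetric])
  also have "\<dots> = A // eqr \<tau>" unfolding assms(3) ..
  also have "\<dots> = \<tau>"
    unfolding eqr_def by (rule partition_on_eq_quotient[OF assms(2)])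
  finally show ?thesis .
qed

lemma krel_eqr: obtains \<sigma> where "partition_on {1..d} \<sigma>" "eqr \<sigma> = krel d t"
proof
  have e: "equiv {1..d} (krel d t)"
    by (auto simp: krel_def equiv_def refl_on_def sym_def trans_def)
  show p: "partition_on {1..d} ({1..d} // krel d t)" by (rule partition_on_quotient[OF e])
  show "eqr ({1..d} // krel d t) = krel d t"
  proof (intro equalityI subsetI)
    fix p assume "p \<in> eqr ({1..d} // krel d t)"
    then show "p \<in> krel d t" by (auto simp: eqr_def quotient_def krel_def)
  next
    fix p assume p: "p \<in> krel d t"
    then obtain i j where "p = (i, j)" "i \<in> {1..d}" "(i, j) \<in> krel d t" "(i, i) \<in> krel d t"
      by (auto simp: krel_def)
    then show "p \<in> eqr ({1..d} // krel d t)" unfolding eqr_def quotient_def by blast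
  qed
qed

abbreviation set_partitions :: "nat \<Rightarrow> nat set set set" where
  "set_partitions d \<equiv> {\<pi>. partition_on {1..d} \<pi>}"

lemma finite_set_partitions: "finite (set_partitions d)"
  by (rule finitely_many_partition_on) simp

text \<open>The monomial symmetric function in noncommuting variables: colourings whose kernel is
  exactly the given partition.\<close>

definition nc_m :: "nat \<Rightarrow> nat set set \<Rightarrow> nc_series" where
  "nc_m d \<sigma> = nc_ind d (\<lambda>t. krel d t = eqr \<sigma>)"

lemma nc_ind_krel: "nc_ind d (\<lambda>t. R (krel d t)) = (\<Sum>\<sigma> | \<sigma> \<in> set_partitions d \<and> R (eqr \<sigma>). nc_m d \<sigma>)"
proof
  fix u
  obtain \<sigma> where \<sigma>: "partition_on {1..d} \<sigma>" "eqr \<sigma> = krel d (word_fun d u)" by (rule krel_eqr)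
  have fin: "finite {\<tau>. \<tau> \<in> set_partitions d \<and> R (eqr \<tau>)}"
    using finite_set_partitions by (rule rev_finite_subset) auto
  have "(\<Sum>\<tau> | \<tau> \<in> set_partitions d \<and> R (eqr \<tau>). nc_m d \<tau> u)
      = (\<Sum>\<tau> | \<tau> \<in> set_partitions d \<and> R (eqr \<tau>). if \<tau> = \<sigma> then nc_m d \<sigma> u else 0)"
  proof (rule sum.cong)
    fix \<tau> assume "\<tau> \<in> {\<tau>. \<tau> \<in> set_partitions d \<and> R (eqr \<tau>)}"
    then have "eqr \<tau> \<noteq> eqr \<sigma>" if "\<tau> \<noteq> \<sigma>" using eqr_inj[of "{1..d}" \<tau> \<sigma>] \<sigma> that by auto
    then show "nc_m d \<tau> u = (if \<tau> = \<sigma> then nc_m d \<sigma> u else 0)"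
      using \<sigma> by (auto simp: nc_m_def nc_ind_def)
  qed simp
  also have "\<dots> = nc_ind d (\<lambda>t. R (krel d t)) u"
    using \<sigma> fin by (simp add: sum.delta nc_m_def nc_ind_def)
  finally show "nc_ind d (\<lambda>t. R (krel d t)) u = (\<Sum>\<sigma> | \<sigma> \<in> set_partitions d \<and> R (eqr \<sigma>). nc_m d \<sigma>) u"
    unfolding nc_sum_apply by (rule sym)
qed

lemma nc_m_independent:
  "inj_on (nc_m d) (set_partitions d)" "NC.independent (nc_m d ` set_partitions d)"
proof -
  \<comment> \<open>A word with kernel \<sigma>: each label receives the minimum of its block, and
    \<open>Suc\<close> makes the letters visibly positive. Evaluation at these words gives an
    identity matrix on the monomials.\<close>
  define w where "w \<sigma> = map (\<lambda>i. Suc (Min (block \<sigma> i))) [1..<Suc d]" for \<sigma>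
  have w: "nc_m d \<tau> (w \<sigma>) = (if \<tau> = \<sigma> then 1 else 0)"
    if \<sigma>: "partition_on {1..d} \<sigma>" and \<tau>: "partition_on {1..d} \<tau>" for \<sigma> \<tau>
  proof -
    have wf: "word_fun d (w \<sigma>) i = Suc (Min (block \<sigma> i))" if "i \<in> {1..d}" for i
    proof -
      have "i - 1 < d" "Suc (i - 1) = i" using that by auto
      then show ?thesis using that by (simp add: word_fun_def w_def del: upt_Suc)
    qed
    have min: "Min (block \<sigma> i) \<in> block \<sigma> i" "block \<sigma> i \<in> \<sigma>" "i \<in> block \<sigma> i" if "i \<in> {1..d}" for i
    proof -
      show b: "block \<sigma> i \<in> \<sigma>" "i \<in> block \<sigma> i" by (rule block_in[OF \<sigma> that])+
      then have "block \<sigma> i \<subseteq> {1..d}" using partition_onD1[OF \<sigma>] by blast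
      then have "finite (block \<sigma> i)" by (rule finite_subset) simp
      then show "Min (block \<sigma> i) \<in> block \<sigma> i" using b by (intro Min_in) auto
    qed
    have "krel d (word_fun d (w \<sigma>)) = eqr \<sigma>"
    proof (intro equalityI subsetI)
      fix p assume "p \<in> krel d (word_fun d (w \<sigma>))"
      then obtain i j where p: "p = (i, j)" "i \<in> {1..d}" "j \<in> {1..d}" "Min (block \<sigma> i) = Min (block \<sigma> j)"
        using wf by (auto simp: krel_def)
      have "block \<sigma> (Min (block \<sigma> i)) = block \<sigma> i"
        by (rule block_eq_iff[OF \<sigma>]) (use min p(2) in auto)
      moreover have "block \<sigma> (Min (block \<sigma> i)) = block \<sigma> j"
        unfolding p(4) by (rule block_eq_iff[OF \<sigma>]) (use min p(3) in auto)
      ultimately have "j \<in> block \<sigma> i" using min(3)[OF p(3)] by simp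
      then show "p \<in> eqr \<sigma>" using p(1) min(2,3)[OF p(2)] by (auto simp: eqr_def)
    next
      fix p assume "p \<in> eqr \<sigma>"
      then obtain B i j where p: "p = (i, j)" "B \<in> \<sigma>" "i \<in> B" "j \<in> B" by (auto simp: eqr_def)
      then have "i \<in> {1..d}" "j \<in> {1..d}" using partition_onD1[OF \<sigma>] by auto
      moreover have "block \<sigma> i = B" "block \<sigma> j = B" using p block_eq_iff[OF \<sigma>] by auto
      ultimately have "word_fun d (w \<sigma>) i = word_fun d (w \<sigma>) j" by (simp only: wf)
      then show "p \<in> krel d (word_fun d (w \<sigma>))"
        unfolding p(1) krel_def using \<open>i \<in> {1..d}\<close> \<open>j \<in> {1..d}\<close> by blast
    qed
    moreover have "length (w \<sigma>) = d" "set (w \<sigma>) \<subseteq> {0<..}" by (auto simp: w_def simp del: upt_Suc)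
    moreover have "eqr \<sigma> = eqr \<tau> \<longleftrightarrow> \<tau> = \<sigma>" using eqr_inj[OF \<sigma> \<tau>] by blast
    ultimately show ?thesis by (simp add: nc_m_def nc_ind_def)
  qed
  show inj: "inj_on (nc_m d) (set_partitions d)"
  proof (rule inj_onI)
    fix \<sigma> \<tau> assume \<sigma>: "\<sigma> \<in> set_partitions d" and \<tau>: "\<tau> \<in> set_partitions d" and eq: "nc_m d \<sigma> = nc_m d \<tau>"
    have "1 = nc_m d \<sigma> (w \<sigma>)" using w[of \<sigma> \<sigma>] \<sigma> by simp
    also have "\<dots> = (if \<tau> = \<sigma> then 1 else 0)" unfolding eq using w[of \<sigma> \<tau>] \<sigma> \<tau> by simp
    finally show "\<sigma> = \<tau>" by (simp split: if_splits)
  qed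
  have fin: "finite (nc_m d ` set_partitions d)" using finite_set_partitions by simp
  show "NC.independent (nc_m d ` set_partitions d)"
    unfolding NC.dependent_finite[OF fin]
  proof (clarify)
    fix c \<sigma> assume s: "(\<Sum>v\<in>nc_m d ` set_partitions d. nc_scale (c v) v) = 0" and \<sigma>: "partition_on {1..d} \<sigma>"
      and nz: "c (nc_m d \<sigma>) \<noteq> 0"
    have "(\<Sum>v\<in>nc_m d ` set_partitions d. nc_scale (c v) v) (w \<sigma>) = (\<Sum>\<tau>\<in>set_partitions d. c (nc_m d \<tau>) * nc_m d \<tau> (w \<sigma>))"
      by (simp only: nc_sum_apply sum.reindex[OF inj] comp_def nc_scale_def)
    also have "\<dots> = (\<Sum>\<tau>\<in>set_partitions d. if \<tau> = \<sigma> then c (nc_m d \<sigma>) else 0)"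
      by (rule sum.cong) (use w[OF \<sigma>] in auto)
    also have "\<dots> = c (nc_m d \<sigma>)" using \<sigma> finite_set_partitions by (simp add: sum.delta)
    finally show False using s nz by simp
  qed
qed

section \<open>Newton's identities and spanning by the e's\<close>

definition const_on :: "(nat \<Rightarrow> nat) \<Rightarrow> nat set \<Rightarrow> bool" where
  "const_on t A \<longleftrightarrow> (\<forall>i\<in>A. \<forall>j\<in>A. t i = t j)"

definition one_rest :: "(nat \<Rightarrow> nat) \<Rightarrow> nat set \<Rightarrow> nat \<Rightarrow> nat set set" where
  "one_rest t A a = {B. B \<subseteq> A \<and> card B = a \<and> const_on t B \<and> inj_on t (A - B)}"

definition one_rest_disj :: "(nat \<Rightarrow> nat) \<Rightarrow> nat set \<Rightarrow> nat \<Rightarrow> nat set set" where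
  "one_rest_disj t A a = {B \<in> one_rest t A a. t ` B \<inter> t ` (A - B) = {}}"

text \<open>Newton's identity \<open>p\<^sub>a e\<^bsub>n-a\<^esub> = m\<^bsub>(a,1,\<dots>)\<^esub> + m\<^bsub>(a+1,1,\<dots>)\<^esub>\<close>, for one colouring \<open>t\<close> at a time: a set
  that is not separated from its complement grows by exactly one element.\<close>

lemma card_one_rest:
  assumes A: "finite A" and a: "1 \<le> a"
  shows "card (one_rest t A a) = card (one_rest_disj t A a) + (a + 1) * card (one_rest_disj t A (a + 1))"
proof -
  define N where "N = {B \<in> one_rest t A a. t ` B \<inter> t ` (A - B) \<noteq> {}}"
  define D where "D = one_rest_disj t A (a + 1)"
  have fin: "finite (one_rest t A a)" "finite D"
    unfolding one_rest_def D_def one_rest_disj_def using A by auto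
  have card_D: "finite B" "card B = a + 1" "B \<subseteq> A" "const_on t B" "inj_on t (A - B)" "t ` B \<inter> t ` (A - B) = {}"
    if "B \<in> D" for B
    using that A by (auto simp: D_def one_rest_disj_def one_rest_def finite_subset)
  have "bij_betw (\<lambda>(B, x). B - {x}) (Sigma D (\<lambda>B. B)) N"
  proof (rule bij_betwI')
    fix p q assume "p \<in> Sigma D (\<lambda>B. B)" "q \<in> Sigma D (\<lambda>B. B)"
    then obtain B x C y where p: "p = (B, x)" "B \<in> D" "x \<in> B" and q: "q = (C, y)" "C \<in> D" "y \<in> C" by auto
    show "((case p of (B, x) \<Rightarrow> B - {x}) = (case q of (B, x) \<Rightarrow> B - {x})) = (p = q)"
    proof
      assume "(case p of (B, x) \<Rightarrow> B - {x}) = (case q of (B, x) \<Rightarrow> B - {x})"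
      then have eq: "B - {x} = C - {y}" using p q by simp
      have "card (B - {x}) = a" using card_D[OF p(2)] p(3) by simp
      then obtain z where z: "z \<in> B - {x}" using a by (metis card.empty ex_in_conv not_one_le_zero)
      have "x = y"
      proof (rule ccontr)
        assume "x \<noteq> y"
        then have "y \<notin> B" using eq by blast
        moreover have "y \<in> A" using card_D(3)[OF q(2)] q(3) by auto
        moreover have "t y = t z" using card_D(4)[OF q(2)] q(3) z eq unfolding const_on_def by blast
        ultimately show False using card_D(6)[OF p(2)] z by blast
      qed
      then have "B = C" using eq p(3) q(3) by blast
      then show "p = q" using \<open>x = y\<close> p(1) q(1) by simp
    qed simp
  next
    fix p assume "p \<in> Sigma D (\<lambda>B. B)"
    then obtain B x where p: "p = (B, x)" "B \<in> D" "x \<in> B" by auto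
    note B = card_D[OF p(2)]
    have c: "card (B - {x}) = a" using B p(3) by simp
    then obtain z where z: "z \<in> B - {x}" using a by (metis card.empty ex_in_conv not_one_le_zero)
    have "inj_on t (A - (B - {x}))"
    proof -
      have "A - (B - {x}) = insert x (A - B)" using p(3) B(3) by auto
      then show ?thesis using B(5,6) p(3) by auto
    qed
    moreover have "t z = t x" using B(4) z p(3) unfolding const_on_def by blast
    then have "t ` (B - {x}) \<inter> t ` (A - (B - {x})) \<noteq> {}" using z p(3) B(3) by blast
    moreover have "const_on t (B - {x})" using B(4) unfolding const_on_def by blast
    ultimately show "(case p of (B, x) \<Rightarrow> B - {x}) \<in> N"
      using p(1) c B(3) unfolding N_def one_rest_def by auto
  next
    fix C assume "C \<in> N"
    then have C: "C \<subseteq> A" "card C = a" "const_on t C" "inj_on t (A - C)" "t ` C \<inter> t ` (A - C) \<noteq> {}"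
      by (auto simp: N_def one_rest_def)
    then obtain z x where zx: "z \<in> C" "x \<in> A - C" "t z = t x" by auto
    have finC: "finite C" using C(1) A by (rule finite_subset)
    have "const_on t (insert x C)" using C(3) zx unfolding const_on_def by (metis insert_iff)
    moreover have "inj_on t (A - insert x C)" using C(4) by (rule inj_on_subset) auto
    moreover have "t ` insert x C \<inter> t ` (A - insert x C) = {}"
    proof (rule equals0I)
      fix v assume v: "v \<in> t ` insert x C \<inter> t ` (A - insert x C)"
      from v[THEN IntD1] obtain y' where y': "v = t y'" "y' \<in> insert x C" by (rule imageE)
      from v[THEN IntD2] obtain w where y: "v = t w" "w \<in> A - insert x C" by (rule imageE)
      have "t y' = t x" using \<open>const_on t (insert x C)\<close> y'(2) unfolding const_on_def by blast
      then have "t w = t x" using y(1) y'(1) by simp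
      then have "w = x" using C(4) zx(2) y(2) by (auto dest: inj_onD)
      then show False using y(2) by simp
    qed
    moreover have "card (insert x C) = a + 1" using zx finC C(2) by simp
    ultimately have "insert x C \<in> D" using C(1) zx by (auto simp: D_def one_rest_disj_def one_rest_def)
    then have "(insert x C, x) \<in> Sigma D (\<lambda>B. B)" by simp
    moreover have "C = (case (insert x C, x) of (B, x) \<Rightarrow> B - {x})" using zx by auto
    ultimately show "\<exists>p\<in>Sigma D (\<lambda>B. B). C = (case p of (B, x) \<Rightarrow> B - {x})" by blast
  qed
  then have "card N = card (Sigma D (\<lambda>B. B))" by (simp add: bij_betw_same_card)
  also have "\<dots> = (\<Sum>B\<in>D. card B)" using fin card_D(1) by (intro card_SigmaI) auto
  also have "\<dots> = (a + 1) * card D" using card_D(2) by simp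
  finally have "card N = (a + 1) * card D" .
  moreover have "one_rest t A a = one_rest_disj t A a \<union> N" "one_rest_disj t A a \<inter> N = {}"
    by (auto simp: one_rest_disj_def N_def)
  moreover have "finite N" "finite (one_rest_disj t A a)" using fin by (auto simp: N_def one_rest_disj_def)
  ultimately show ?thesis by (simp add: card_Un_disjoint D_def)
qed

lemma nc_sum_card:
  assumes "finite I"
  shows "(\<Sum>B\<in>I. nc_ind d (\<lambda>t. Q t B)) u = of_nat (card {B \<in> I. Q (word_fun d u) B}) * nc_ind d (\<lambda>_. True) u"
proof -
  have "(\<Sum>B\<in>I. nc_ind d (\<lambda>t. Q t B)) u = (\<Sum>B\<in>I. if Q (word_fun d u) B then nc_ind d (\<lambda>_. True) u else 0)"
    unfolding nc_sum_apply by (rule sum.cong) (auto simp: nc_ind_def)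
  also have "\<dots> = (\<Sum>B\<in>{B \<in> I. Q (word_fun d u) B}. nc_ind d (\<lambda>_. True) u)"
    using assms by (simp add: sum.If_cases Int_def)
  finally show ?thesis by simp
qed

text \<open>Newton's identity solved for the part with the larger constant set. Summing over all B
  of a given size symmetrises it inside A, while R carries the conditions on the other blocks along
  unchanged.\<close>

lemma nc_newton:
  fixes R :: "(nat \<Rightarrow> nat) \<Rightarrow> bool" and d :: nat
  assumes A: "finite A" and a: "1 \<le> a"
  defines "g \<equiv> \<lambda>a. \<Sum>B | B \<subseteq> A \<and> card B = a. nc_ind d (\<lambda>t. const_on t B \<and> inj_on t (A - B) \<and> R t)"
  defines "f \<equiv> \<lambda>a. \<Sum>B | B \<subseteq> A \<and> card B = a. nc_ind d (\<lambda>t. const_on t B \<and> inj_on t (A - B) \<and> t ` B \<inter> t ` (A - B) = {} \<and> R t)"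
  shows "f (a + 1) = nc_scale (1 / (of_nat a + 1)) (g a - f a)"
proof
  fix u
  define t where "t = word_fun d u"
  define I where "I = nc_ind d (\<lambda>_. True) u"
  have fin: "finite {B. B \<subseteq> A \<and> card B = b}" for b using A by auto
  have g: "g b u = (if R t then of_nat (card (one_rest t A b)) * I else 0)" for b
  proof -
    have "g b u = of_nat (card {B \<in> {B. B \<subseteq> A \<and> card B = b}. const_on t B \<and> inj_on t (A - B) \<and> R t}) * I"
      unfolding g_def t_def I_def by (rule nc_sum_card[OF fin])
    moreover have "{B \<in> {B. B \<subseteq> A \<and> card B = b}. const_on t B \<and> inj_on t (A - B) \<and> R t} = (if R t then one_rest t A b else {})"
      by (auto simp: one_rest_def)
    ultimately show ?thesis by simp
  qed
  have f: "f b u = (if R t then of_nat (card (one_rest_disj t A b)) * I else 0)" for b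
  proof -
    have "f b u = of_nat (card {B \<in> {B. B \<subseteq> A \<and> card B = b}. const_on t B \<and> inj_on t (A - B) \<and> t ` B \<inter> t ` (A - B) = {} \<and> R t}) * I"
      unfolding f_def t_def I_def by (rule nc_sum_card[OF fin])
    moreover have "{B \<in> {B. B \<subseteq> A \<and> card B = b}. const_on t B \<and> inj_on t (A - B) \<and> t ` B \<inter> t ` (A - B) = {} \<and> R t}
        = (if R t then one_rest_disj t A b else {})"
      by (auto simp: one_rest_disj_def one_rest_def)
    ultimately show ?thesis by simp
  qed
  have "of_nat (card (one_rest t A a)) = (of_nat (card (one_rest_disj t A a)) + (of_nat a + 1) * of_nat (card (one_rest_disj t A (a + 1))) :: rat)"
    unfolding card_one_rest[OF A a] by (simp add: algebra_simps)
  then have "(of_nat a + 1) * f (a + 1) u = g a u - f a u"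
    unfolding f g by (simp add: algebra_simps)
  then show "f (a + 1) u = nc_scale (1 / (of_nat a + 1)) (g a - f a) u"
    by (simp add: nc_scale_def field_simps add_nonneg_eq_0_iff)
qed

text \<open>Blocks in \<P> are of power-sum type, the others elementary. Newton's identity climbs
  from f 1, where A has become elementary, to f (card A), the wanted series. Each correction g a
  splits A into a smaller power-sum block B and an elementary block A - B, so the total size of the
  power-sum blocks drops.\<close>

lemma nc_p_e_in_span:
  assumes "partition_on {1..d} \<sigma>" "\<P> \<subseteq> \<sigma>"
  shows "nc_ind d (\<lambda>t. (\<forall>A\<in>\<P>. const_on t A) \<and> (\<forall>A\<in>\<sigma> - \<P>. inj_on t A)) \<in> NC.span (nc_e_basis d)"
  using assms
proof (induction "\<Sum>A\<in>\<P>. card A" arbitrary: \<sigma> \<P> rule: less_induct)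
  case less
  note \<sigma> = less.prems(1)
  have finU: "finite B" if "B \<in> \<sigma>" for B
    using that partition_onD1[OF \<sigma>] by (metis Sup_upper finite_atLeastAtMost finite_subset)
  have fin\<sigma>: "finite \<sigma>" by (rule finite_elements[OF _ \<sigma>]) simp
  show ?case
  proof (cases "\<P> = {}")
    case True
    have "nc_e d \<sigma> \<in> NC.span (nc_e_basis d)" using \<sigma> by (intro NC.span_base) (simp add: nc_e_basis_def)
    then show ?thesis using True by (simp add: nc_e_eq_nc_ind[OF \<sigma>])
  next
    case False
    then obtain A where A: "A \<in> \<P>" by blast
    then have A\<sigma>: "A \<in> \<sigma>" using less.prems(2) by blast
    define \<P>' where "\<P>' = \<P> - {A}"
    have fin: "finite A" "A \<noteq> {}" using finU[OF A\<sigma>] partition_onD3[OF \<sigma>] A\<sigma> by auto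
    have finP: "finite \<P>" using less.prems(2) fin\<sigma> by (rule finite_subset)
    have card: "(\<Sum>B\<in>\<P>. card B) = card A + (\<Sum>B\<in>\<P>'. card B)"
      unfolding \<P>'_def by (rule sum.remove[OF finP A])
    define R where "R t \<longleftrightarrow> (\<forall>B\<in>\<P>'. const_on t B) \<and> (\<forall>B\<in>\<sigma> - \<P>. inj_on t B)" for t
    define g where "g a = (\<Sum>B | B \<subseteq> A \<and> card B = a. nc_ind d (\<lambda>t. const_on t B \<and> inj_on t (A - B) \<and> R t))" for a
    define f where "f a = (\<Sum>B | B \<subseteq> A \<and> card B = a. nc_ind d (\<lambda>t. const_on t B \<and> inj_on t (A - B) \<and> t ` B \<inter> t ` (A - B) = {} \<and> R t))" for a
    have newton: "f (a + 1) = nc_scale (1 / (of_nat a + 1)) (g a - f a)" if "1 \<le> a" for a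
      unfolding f_def g_def by (rule nc_newton[OF fin(1) that])
    \<comment> \<open>A singleton separated from an injectively coloured rest says just that all of
      A is coloured injectively.\<close>
    have f1: "f 1 \<in> NC.span (nc_e_basis d)"
      unfolding f_def
    proof (rule NC.span_sum)
      fix B assume "B \<in> {B. B \<subseteq> A \<and> card B = 1}"
      then obtain x where x: "B = {x}" "x \<in> A" by (auto simp: card_1_singleton_iff)
      have ins: "A = insert x (A - {x})" using x by auto
      have "inj_on t A \<longleftrightarrow> inj_on t (A - {x}) \<and> t x \<notin> t ` (A - {x})" for t
        using inj_on_insert[of t x "A - {x}"] unfolding ins[symmetric] by simp
      then have "(const_on t B \<and> inj_on t (A - B) \<and> t ` B \<inter> t ` (A - B) = {} \<and> R t)
          \<longleftrightarrow> (\<forall>B\<in>\<P>'. const_on t B) \<and> (\<forall>B\<in>\<sigma> - \<P>'. inj_on t B)" for t :: "nat \<Rightarrow> nat"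
      proof -
        have "\<sigma> - \<P>' = insert A (\<sigma> - \<P>)" using A A\<sigma> by (auto simp: \<P>'_def)
        then show ?thesis
          using \<open>inj_on t A \<longleftrightarrow> inj_on t (A - {x}) \<and> t x \<notin> t ` (A - {x})\<close>
          unfolding x(1) R_def by (auto simp: const_on_def)
      qed
      then have "nc_ind d (\<lambda>t. const_on t B \<and> inj_on t (A - B) \<and> t ` B \<inter> t ` (A - B) = {} \<and> R t)
          = nc_ind d (\<lambda>t. (\<forall>B\<in>\<P>'. const_on t B) \<and> (\<forall>B\<in>\<sigma> - \<P>'. inj_on t B))"
        by (intro nc_ind_cong)
      also have "\<dots> \<in> NC.span (nc_e_basis d)"
      proof (rule less.hyps[OF _ \<sigma>])
        have "0 < card A" using fin by (simp add: card_gt_0_iff)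
        then show "(\<Sum>A\<in>\<P>'. card A) < (\<Sum>A\<in>\<P>. card A)" unfolding card by simp
        show "\<P>' \<subseteq> \<sigma>" using less.prems(2) by (auto simp: \<P>'_def)
      qed
      finally show "nc_ind d (\<lambda>t. const_on t B \<and> inj_on t (A - B) \<and> t ` B \<inter> t ` (A - B) = {} \<and> R t) \<in> NC.span (nc_e_basis d)" .
    qed
    have g_span: "g a \<in> NC.span (nc_e_basis d)" if a: "1 \<le> a" "a < card A" for a
      unfolding g_def
    proof (rule NC.span_sum)
      fix B assume "B \<in> {B. B \<subseteq> A \<and> card B = a}"
      then have B: "B \<subseteq> A" "card B = a" by auto
      have ne: "B \<noteq> {}" "A - B \<noteq> {}" "finite B" using B a fin finite_subset[OF B(1)] by auto
      define \<sigma>' where "\<sigma>' = insert B (insert (A - B) (\<sigma> - {A}))"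
      have dis: "A \<inter> C = {}" if "C \<in> \<sigma>" "C \<noteq> A" for C
        using disjointD[OF partition_onD2[OF \<sigma>] A\<sigma> that(1)] that(2) by blast
      have notin: "C \<notin> \<sigma> - {A}" if "C \<subseteq> A" "C \<noteq> {}" for C using dis that by blast
      have \<sigma>': "partition_on {1..d} \<sigma>'"
      proof -
        have 1: "partition_on ({1..d} - A) (\<sigma> - {A})"
        proof -
          have "insert A (\<sigma> - {A}) = \<sigma>" using A\<sigma> by blast
          moreover have "disjnt A (\<Union>(\<sigma> - {A}))" using dis by (auto simp: disjnt_def)
          ultimately show ?thesis using partition_on_insert[of A "\<sigma> - {A}" "{1..d}"] \<sigma> by simp
        qed
        have A_sub: "A \<subseteq> {1..d}" using partition_onD1[OF \<sigma>] A\<sigma> by blast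
        have 2: "partition_on ({1..d} - B) (insert (A - B) (\<sigma> - {A}))"
        proof -
          have "disjnt (A - B) (\<Union>(\<sigma> - {A}))" using dis by (auto simp: disjnt_def)
          moreover have "{1..d} - B - (A - B) = {1..d} - A" using B by auto
          ultimately show ?thesis
            using partition_on_insert[of "A - B" "\<sigma> - {A}" "{1..d} - B"] 1 A_sub ne by auto
        qed
        have "disjnt B (\<Union>(insert (A - B) (\<sigma> - {A})))" using dis B(1) by (auto simp: disjnt_def)
        then show ?thesis unfolding \<sigma>'_def
          using partition_on_insert[of B "insert (A - B) (\<sigma> - {A})" "{1..d}"] 2 A_sub B(1) ne by auto
      qed
      have eq: "(const_on t B \<and> inj_on t (A - B) \<and> R t)
          \<longleftrightarrow> (\<forall>B\<in>insert B \<P>'. const_on t B) \<and> (\<forall>B\<in>\<sigma>' - insert B \<P>'. inj_on t B)" for t :: "nat \<Rightarrow> nat"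
      proof -
        have "\<sigma>' - insert B \<P>' = insert (A - B) (\<sigma> - \<P>)"
          unfolding \<sigma>'_def \<P>'_def using notin[of "A - B"] notin[of B] ne B less.prems(2) A by blast
        then show ?thesis unfolding R_def by auto
      qed
      have "nc_ind d (\<lambda>t. const_on t B \<and> inj_on t (A - B) \<and> R t)
          = nc_ind d (\<lambda>t. (\<forall>B\<in>insert B \<P>'. const_on t B) \<and> (\<forall>B\<in>\<sigma>' - insert B \<P>'. inj_on t B))"
        by (intro nc_ind_cong eq)
      also have "\<dots> \<in> NC.span (nc_e_basis d)"
      proof (rule less.hyps[OF _ \<sigma>'])
        have "(\<Sum>A\<in>insert B \<P>'. card A) = card B + (\<Sum>A\<in>\<P>'. card A)"
          using notin[OF B(1) ne(1)] less.prems(2) finP by (intro sum.insert) (auto simp: \<P>'_def)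
        then show "(\<Sum>A\<in>insert B \<P>'. card A) < (\<Sum>A\<in>\<P>. card A)" unfolding card using B(2) a by simp
        show "insert B \<P>' \<subseteq> \<sigma>'" using less.prems(2) by (auto simp: \<P>'_def \<sigma>'_def)
      qed
      finally show "nc_ind d (\<lambda>t. const_on t B \<and> inj_on t (A - B) \<and> R t) \<in> NC.span (nc_e_basis d)" .
    qed
    have f_span: "f a \<in> NC.span (nc_e_basis d)" if "1 \<le> a" "a \<le> card A" for a
      using that
    proof (induction a rule: nat_induct_at_least)
      case base
      then show ?case using f1 by simp
    next
      case (Suc a)
      have "nc_scale (1 / (of_nat a + 1)) (g a - f a) \<in> NC.span (nc_e_basis d)"
        using Suc g_span[of a] by (intro NC.span_scale NC.span_diff) auto
      then show ?case using newton[of a] Suc.hyps by simp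
    qed
    have "{B. B \<subseteq> A \<and> card B = card A} = {A}" using fin card_subset_eq by blast
    then have "f (card A) = nc_ind d (\<lambda>t. const_on t A \<and> R t)" by (simp add: f_def)
    moreover have "(const_on t A \<and> R t) \<longleftrightarrow> (\<forall>A\<in>\<P>. const_on t A) \<and> (\<forall>A\<in>\<sigma> - \<P>. inj_on t A)" for t :: "nat \<Rightarrow> nat"
      using A unfolding R_def \<P>'_def by blast
    moreover have "1 \<le> card A" using fin by (simp add: Suc_le_eq card_gt_0_iff)
    ultimately show ?thesis using f_span[of "card A"] by simp
  qed
qed

lemma const_on_iff_eqr:
  assumes "partition_on {1..d} \<sigma>"
  shows "(\<forall>A\<in>\<sigma>. const_on t A) \<longleftrightarrow> eqr \<sigma> \<subseteq> krel d t"
proof -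
  have "B \<subseteq> {1..d}" if "B \<in> \<sigma>" for B using that partition_onD1[OF assms] by blast
  then show ?thesis unfolding const_on_def eqr_def krel_def by blast
qed

text \<open>The power sum of \<sigma> is the sum of the monomials of all coarser partitions. This
  unitriangular system is solved from the coarsest partition downwards, using that the power sums
  are already in the span.\<close>

lemma nc_m_in_span:
  assumes "partition_on {1..d} \<sigma>"
  shows "nc_m d \<sigma> \<in> NC.span (nc_e_basis d)"
  using assms
proof (induction "card ({1..d} \<times> {1..d}) - card (eqr \<sigma>)" arbitrary: \<sigma> rule: less_induct)
  case less
  have sub: "eqr \<tau> \<subseteq> {1..d} \<times> {1..d}" if "partition_on {1..d} \<tau>" for \<tau>
    using partition_onD1[OF that] unfolding eqr_def by blast
  define T where "T = {\<tau>. \<tau> \<in> set_partitions d \<and> eqr \<sigma> \<subseteq> eqr \<tau>}"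
  have fin: "finite T" using finite_set_partitions unfolding T_def by (rule rev_finite_subset) blast
  have "nc_ind d (\<lambda>t. \<forall>A\<in>\<sigma>. const_on t A) = nc_ind d (\<lambda>t. eqr \<sigma> \<subseteq> krel d t)"
    unfolding const_on_iff_eqr[OF less.prems] ..
  also have "\<dots> = (\<Sum>\<tau>\<in>T. nc_m d \<tau>)" unfolding T_def by (rule nc_ind_krel)
  also have "\<dots> = nc_m d \<sigma> + (\<Sum>\<tau>\<in>T - {\<sigma>}. nc_m d \<tau>)"
    using less.prems by (intro sum.remove[OF fin]) (simp add: T_def)
  finally have "nc_m d \<sigma> = nc_ind d (\<lambda>t. \<forall>A\<in>\<sigma>. const_on t A) - (\<Sum>\<tau>\<in>T - {\<sigma>}. nc_m d \<tau>)"
    by (simp add: algebra_simps)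
  moreover have "nc_ind d (\<lambda>t. \<forall>A\<in>\<sigma>. const_on t A) \<in> NC.span (nc_e_basis d)"
    using nc_p_e_in_span[OF less.prems order_refl] by simp
  moreover have "(\<Sum>\<tau>\<in>T - {\<sigma>}. nc_m d \<tau>) \<in> NC.span (nc_e_basis d)"
  proof (rule NC.span_sum)
    fix \<tau> assume \<tau>: "\<tau> \<in> T - {\<sigma>}"
    then have p: "partition_on {1..d} \<tau>" by (simp add: T_def)
    have "eqr \<sigma> \<subset> eqr \<tau>" using \<tau> eqr_inj[OF less.prems p] by (auto simp: T_def)
    then have "card (eqr \<sigma>) < card (eqr \<tau>)"
      using sub[OF p] by (intro psubset_card_mono) (auto intro: finite_subset)
    moreover have "card (eqr \<tau>) \<le> card ({1..d} \<times> {1..d})" by (rule card_mono[OF _ sub[OF p]]) simp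
    ultimately show "nc_m d \<tau> \<in> NC.span (nc_e_basis d)" by (intro less.hyps p) simp
  qed
  ultimately show ?case by (simp only: NC.span_diff)
qed

lemma nc_ind_in_span: "nc_ind d (\<lambda>t. R (krel d t)) \<in> NC.span (nc_e_basis d)"
  unfolding nc_ind_krel by (rule NC.span_sum) (simp add: nc_m_in_span)

lemma finite_nc_e_basis: "finite (nc_e_basis d)"
  unfolding nc_e_basis_def using finite_set_partitions by simp

text \<open>A count replaces a triangularity argument: the span contains as many independent
  monomials as there are set partitions, so no spanning set is smaller. A dependence or a
  coincidence among the e's would produce a smaller one.\<close>

lemma nc_e_basis_independent:
  "NC.independent (nc_e_basis d)" "inj_on (nc_e d) (set_partitions d)"
proof -
  have le: "card (nc_e_basis d) \<le> card (set_partitions d)"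
    unfolding nc_e_basis_def using finite_set_partitions by (rule card_image_le)
  have ge: "card (set_partitions d) \<le> card B" if "finite B" "nc_e_basis d \<subseteq> NC.span B" for B
  proof -
    have "nc_m d ` set_partitions d \<subseteq> NC.span (nc_e_basis d)" using nc_m_in_span by auto
    also have "\<dots> \<subseteq> NC.span B" using that(2) NC.span_minimal NC.subspace_span by blast
    finally have "card (nc_m d ` set_partitions d) \<le> card B"
      using NC.independent_span_bound[OF that(1) nc_m_independent(2)] by blast
    then show ?thesis using card_image[OF nc_m_independent(1)] by simp
  qed
  show "NC.independent (nc_e_basis d)"
  proof
    assume "NC.dependent (nc_e_basis d)"
    then obtain b where b: "b \<in> nc_e_basis d" "b \<in> NC.span (nc_e_basis d - {b})"
      unfolding NC.dependent_def by blast
    have "nc_e_basis d \<subseteq> NC.span (nc_e_basis d - {b})"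
      using b(2) NC.span_superset[of "nc_e_basis d - {b}"] by blast
    then have "card (set_partitions d) \<le> card (nc_e_basis d - {b})"
      using finite_nc_e_basis by (intro ge) auto
    also have "\<dots> < card (nc_e_basis d)" using b(1) finite_nc_e_basis by (intro card_Diff1_less)
    finally show False using le by simp
  qed
  have "card (set_partitions d) \<le> card (nc_e_basis d)"
    by (rule ge[OF finite_nc_e_basis NC.span_superset])
  then have "card (nc_e d ` set_partitions d) = card (set_partitions d)"
    using le unfolding nc_e_basis_def by simp
  then show "inj_on (nc_e d) (set_partitions d)"
    using finite_set_partitions by (rule eq_card_imp_inj_on[rotated])
qed

subsection \<open>The marked commutative image\<close>

lemma single_sum: "Poly_Mapping.single k (\<Sum>i\<in>I. f i) = (\<Sum>i\<in>I. Poly_Mapping.single k (f i))"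
  by (induction I rule: infinite_finite_induct) (simp_all add: single_add)

text \<open>The family of partitions may contain repetitions, as the averaged sum in
  \<open>nu_eq_0\<close> does.\<close>

lemma nu_nc_e_sum:
  assumes "finite I" and \<pi>: "\<And>i. i \<in> I \<Longrightarrow> partition_on {1..d} (\<pi> i)"
  shows "nu d (\<Sum>i\<in>I. nc_scale (a i) (nc_e d (\<pi> i))) = (\<Sum>i\<in>I. Poly_Mapping.single (partition_type d (\<pi> i)) (a i))"
proof -
  have mem: "nc_e d (\<pi> i) \<in> nc_e_basis d" if "i \<in> I" for i using \<pi>[OF that] by (simp add: nc_e_basis_def)
  have rep: "NC.representation (nc_e_basis d) (\<Sum>i\<in>I. nc_scale (a i) (nc_e d (\<pi> i))) (nc_e d \<tau>) = (\<Sum>i\<in>I. if \<tau> = \<pi> i then a i else 0)"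
    if \<tau>: "partition_on {1..d} \<tau>" for \<tau>
  proof -
    have "NC.representation (nc_e_basis d) (\<Sum>i\<in>I. nc_scale (a i) (nc_e d (\<pi> i)))
        = (\<lambda>b. \<Sum>i\<in>I. NC.representation (nc_e_basis d) (nc_scale (a i) (nc_e d (\<pi> i))) b)"
      using mem by (intro NC.representation_sum nc_e_basis_independent NC.span_scale NC.span_base)
    moreover have "NC.representation (nc_e_basis d) (nc_scale (a i) (nc_e d (\<pi> i))) (nc_e d \<tau>) = (if \<tau> = \<pi> i then a i else 0)"
      if i: "i \<in> I" for i
    proof -
      have "NC.representation (nc_e_basis d) (nc_scale (a i) (nc_e d (\<pi> i))) (nc_e d \<tau>)
          = a i * (if nc_e d \<tau> = nc_e d (\<pi> i) then 1 else 0)"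
        using NC.representation_scale[OF nc_e_basis_independent(1) NC.span_base[OF mem[OF i]], of "a i"]
          NC.representation_basis[OF nc_e_basis_independent(1) mem[OF i]] by simp
      moreover have "nc_e d \<tau> = nc_e d (\<pi> i) \<longleftrightarrow> \<tau> = \<pi> i"
        using inj_on_eq_iff[OF nc_e_basis_independent(2)] \<tau> \<pi>[OF i] by blast
      ultimately show ?thesis by simp
    qed
    ultimately show ?thesis by simp
  qed
  have "nu d (\<Sum>i\<in>I. nc_scale (a i) (nc_e d (\<pi> i)))
      = (\<Sum>\<tau>\<in>set_partitions d. \<Sum>i\<in>I. Poly_Mapping.single (partition_type d \<tau>) (if \<tau> = \<pi> i then a i else 0))"
    unfolding nu_def by (rule sum.cong) (simp_all add: rep single_sum)
  also have "\<dots> = (\<Sum>i\<in>I. \<Sum>\<tau>\<in>set_partitions d. Poly_Mapping.single (partition_type d \<tau>) (if \<tau> = \<pi> i then a i else 0))"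
    by (rule sum.swap)
  also have "\<dots> = (\<Sum>i\<in>I. Poly_Mapping.single (partition_type d (\<pi> i)) (a i))"
  proof (rule sum.cong[OF refl])
    fix i assume i: "i \<in> I"
    have "(\<Sum>\<tau>\<in>set_partitions d. Poly_Mapping.single (partition_type d \<tau>) (if \<tau> = \<pi> i then a i else 0))
        = (\<Sum>\<tau>\<in>set_partitions d. if \<tau> = \<pi> i then Poly_Mapping.single (partition_type d (\<pi> i)) (a i) else 0)"
      by (rule sum.cong) auto
    also have "\<dots> = Poly_Mapping.single (partition_type d (\<pi> i)) (a i)"
      using finite_set_partitions \<pi>[OF i] by (simp add: sum.delta)
    finally show "(\<Sum>\<tau>\<in>set_partitions d. Poly_Mapping.single (partition_type d \<tau>) (if \<tau> = \<pi> i then a i else 0))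
        = Poly_Mapping.single (partition_type d (\<pi> i)) (a i)" .
  qed
  finally show ?thesis .
qed

lemma span_nc_e_expand:
  assumes "f \<in> NC.span (nc_e_basis d)"
  obtains a where "f = (\<Sum>\<pi>\<in>set_partitions d. nc_scale (a \<pi>) (nc_e d \<pi>))"
proof
  have "f = (\<Sum>b\<in>nc_e_basis d. nc_scale (NC.representation (nc_e_basis d) f b) b)"
    by (rule NC.sum_representation_eq[symmetric]) (use assms nc_e_basis_independent finite_nc_e_basis in auto)
  then show "f = (\<Sum>\<pi>\<in>set_partitions d. nc_scale (NC.representation (nc_e_basis d) f (nc_e d \<pi>)) (nc_e d \<pi>))"
    unfolding nc_e_basis_def by (subst (asm) sum.reindex[OF nc_e_basis_independent(2)]) simp
qed

text \<open>Permutations of lists act on positions from 0, partitions have labels from 1; this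
  conjugates by the shift. A permutation of the positions below d-1 therefore fixes the label
  d.\<close>

definition relab :: "(nat \<Rightarrow> nat) \<Rightarrow> nat \<Rightarrow> nat" where
  "relab p i = Suc (p (i - 1))"

lemma relab:
  assumes p: "p permutes {..<d - 1}" and d: "1 \<le> d"
  shows "bij_betw (relab p) {1..d} {1..d}" "relab p d = d"
proof -
  have p': "p permutes {..<d}" by (rule permutes_subset[OF p]) auto
  have "bij_betw Suc {..<d} {1..d}" by (rule bij_betwI[where g = "\<lambda>i. i - 1"]) auto
  moreover have "bij_betw (\<lambda>i. i - 1) {1..d} {..<d}" by (rule bij_betwI[where g = Suc]) auto
  ultimately have "bij_betw (Suc \<circ> (p \<circ> (\<lambda>i. i - 1))) {1..d} {1..d}"
    using permutes_imp_bij[OF p'] by (intro bij_betw_trans)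
  then show "bij_betw (relab p) {1..d} {1..d}" by (simp add: relab_def[abs_def] comp_def)
  have "p (d - 1) = d - 1" using permutes_not_in[OF p] by simp
  then show "relab p d = d" using d by (simp add: relab_def)
qed

lemma word_fun_permute:
  assumes p: "p permutes {..<d}" and u: "length u = d" and i: "i \<in> {1..d}"
  shows "word_fun d (permute_list p u) i = word_fun d u (relab p i)"
proof -
  have "i - 1 < length u" using u i by auto
  then have "permute_list p u ! (i - 1) = u ! p (i - 1)" using p u by (simp add: permute_list_nth)
  moreover have "p (i - 1) < d" using permutes_in_image[OF p, of "i - 1"] i by auto
  ultimately show ?thesis using i by (simp add: word_fun_def relab_def)
qed

lemma relab_partition:
  assumes p: "p permutes {..<d - 1}" and d: "1 \<le> d" and \<pi>: "partition_on {1..d} \<pi>"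
  shows "partition_on {1..d} ((`) (relab p) ` \<pi>)" (is "partition_on _ ?\<pi>")
    and "partition_type d ((`) (relab p) ` \<pi>) = partition_type d \<pi>"
    and "length u = d \<Longrightarrow> nc_e d \<pi> (permute_list p u) = nc_e d ((`) (relab p) ` \<pi>) u"
proof -
  note r = relab[OF p d]
  have inj: "inj_on (relab p) {1..d}" using r(1) by (rule bij_betw_imp_inj_on)
  have img: "relab p ` {1..d} = {1..d}" using r(1) by (rule bij_betw_imp_surj_on)
  have sub: "B \<subseteq> {1..d}" if "B \<in> \<pi>" for B using that partition_onD1[OF \<pi>] by blast
  have injB: "inj_on (relab p) B" if "B \<in> \<pi>" for B using inj_on_subset[OF inj sub[OF that]] .
  show part: "partition_on {1..d} ?\<pi>"
  proof (rule partition_onI)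
    show "\<Union> ?\<pi> = {1..d}" unfolding image_Union[symmetric] partition_onD1[OF \<pi>, symmetric] by (rule img)
    show "{} \<notin> ?\<pi>" using partition_onD3[OF \<pi>] by auto
    fix P Q assume "P \<in> ?\<pi>" "Q \<in> ?\<pi>" "P \<noteq> Q"
    then obtain B C where BC: "B \<in> \<pi>" "C \<in> \<pi>" "P = relab p ` B" "Q = relab p ` C" "B \<noteq> C" by blast
    then have "B \<inter> C = {}" using disjointD[OF partition_onD2[OF \<pi>]] by blast
    then have "relab p ` B \<inter> relab p ` C = {}"
      using inj_on_image_Int[OF inj sub[OF BC(1)] sub[OF BC(2)]] by simp
    then show "disjnt P Q" using BC by (simp add: disjnt_def)
  qed
  have dmem: "d \<in> {1..d}" using d by simp
  have blk: "block ?\<pi> d = relab p ` block \<pi> d"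
  proof (rule block_eq_iff[OF part])
    show "relab p ` block \<pi> d \<in> ?\<pi>" using block_in[OF \<pi> dmem] by blast
    show "d \<in> relab p ` block \<pi> d" using block_in(2)[OF \<pi> dmem] r(2) by (metis imageI)
  qed
  have inj2: "inj_on ((`) (relab p)) \<pi>"
    using inj_on_image_eq_iff[OF inj] sub by (intro inj_onI) blast
  have card: "card (relab p ` B) = card B" if "B \<in> \<pi>" for B using card_image[OF injB[OF that]] .
  have "?\<pi> - {block ?\<pi> d} = (`) (relab p) ` (\<pi> - {block \<pi> d})"
    unfolding blk using inj2 block_in(1)[OF \<pi> dmem] by (auto simp: inj_on_def)
  then have "image_mset card (mset_set (?\<pi> - {block ?\<pi> d})) = image_mset card (image_mset ((`) (relab p)) (mset_set (\<pi> - {block \<pi> d})))"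
    using image_mset_mset_set[OF inj_on_subset[OF inj2]] by (metis Diff_subset)
  also have "\<dots> = image_mset card (mset_set (\<pi> - {block \<pi> d}))"
    unfolding image_mset.compositionality comp_def
    by (rule image_mset_cong) (use card finite_elements[OF _ \<pi>] in auto)
  finally show "partition_type d ?\<pi> = partition_type d \<pi>"
    unfolding partition_type_def blk using card[OF block_in(1)[OF \<pi> dmem]] by (simp add: blk)
  show "nc_e d \<pi> (permute_list p u) = nc_e d ?\<pi> u" if u: "length u = d"
  proof -
    have p': "p permutes {..<d}" by (rule permutes_subset[OF p]) auto
    have "inj_on (word_fun d (permute_list p u)) B \<longleftrightarrow> inj_on (word_fun d u) (relab p ` B)" if B: "B \<in> \<pi>" for B
    proof -
      have "inj_on (word_fun d (permute_list p u)) B \<longleftrightarrow> inj_on (word_fun d u \<circ> relab p) B"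
        using sub[OF B] word_fun_permute[OF p' u] by (intro inj_on_cong) auto
      also have "\<dots> \<longleftrightarrow> inj_on (word_fun d u) (relab p ` B)"
        using comp_inj_on_iff[OF injB[OF B]] by blast
      finally show ?thesis .
    qed
    then show ?thesis
      unfolding nc_e_eq_nc_ind[OF \<pi>] nc_e_eq_nc_ind[OF part] nc_ind_def using u p' by simp
  qed
qed

text \<open>Averaging over the relabellings that fix the last label, which do not change types, shows that
  \<open>nu\<close> only sees the commutative image in which the last variable stays marked.\<close>

lemma nu_eq_0:
  assumes f: "f \<in> NC.span (nc_e_basis d)" and d: "1 \<le> d"
    and zero: "\<And>u. length u = d \<Longrightarrow> (\<Sum>v | mset v = mset u \<and> last v = last u. f v) = 0"
  shows "nu d f = 0"
proof -
  obtain a where a: "f = (\<Sum>\<pi>\<in>set_partitions d. nc_scale (a \<pi>) (nc_e d \<pi>))"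
    by (rule span_nc_e_expand[OF f])
  define G where "G = {p. p permutes {..<d - 1}}"
  have finG: "finite G" unfolding G_def by (rule finite_permutations) simp
  have p': "p permutes {..<d}" if "p \<in> G" for p
    using that unfolding G_def by (auto intro: permutes_subset)
  have last: "last (permute_list p v) = last v" if "p \<in> G" "length v = d" for p v
  proof -
    have "v \<noteq> []" using that(2) d by auto
    moreover have "permute_list p v \<noteq> []"
      using length_permute_list[of p v] that(2) d by (metis length_0_conv not_one_le_zero)
    moreover have "p (d - 1) = d - 1" using that(1) permutes_not_in[of p "{..<d - 1}" "d - 1"] by (simp add: G_def)
    ultimately show ?thesis using that p'[OF that(1)] d by (simp add: last_conv_nth permute_list_nth)
  qed
  have avg: "(\<Sum>p\<in>G. f (permute_list p u)) = 0" if u: "length u = d" for u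
  proof -
    define Ob where "Ob = {v. mset v = mset u \<and> last v = last u}"
    have len: "length v = d" if "v \<in> Ob" for v using that u by (auto simp: Ob_def dest: mset_eq_length)
    have "Ob \<subseteq> {v. set v \<subseteq> set u \<and> length v = d}"
    proof
      fix v assume v: "v \<in> Ob"
      then have "set v = set u" by (intro mset_eq_setD) (simp add: Ob_def)
      then show "v \<in> {v. set v \<subseteq> set u \<and> length v = d}" using len[OF v] by simp
    qed
    then have finO: "finite Ob" by (rule finite_subset) (simp add: finite_lists_length_eq)
    have orbit: "bij_betw (permute_list p) Ob Ob" if p: "p \<in> G" for p
    proof -
      have "permute_list p ` Ob \<subseteq> Ob"
      proof (rule image_subsetI)
        fix v assume v: "v \<in> Ob"
        have "mset (permute_list p v) = mset v" using p'[OF p] len[OF v] by simp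
        then show "permute_list p v \<in> Ob" using v last[OF p len[OF v]] by (simp add: Ob_def)
      qed
      moreover have "inj_on (permute_list p) Ob"
      proof (rule inj_onI)
        fix v w assume vw: "v \<in> Ob" "w \<in> Ob" "permute_list p v = permute_list p w"
        show "v = w"
        proof (rule nth_equalityI)
          show "length v = length w" using len vw by simp
          fix i assume "i < length v"
          then have i: "i < d" using len vw by simp
          then obtain j where "j < d" "p j = i"
            using permutes_image[OF p'[OF p]] by (metis imageE lessThan_iff)
          then show "v ! i = w ! i"
            using vw len p'[OF p] permute_list_nth[of p v j] permute_list_nth[of p w j] by auto
        qed
      qed
      ultimately show ?thesis using finO by (simp add: bij_betw_def endo_inj_surj)
    qed
    \<comment> \<open>G acts transitively on the rearrangements of u with the same last letter: q
      rearranges \<open>butlast u\<close> into \<open>butlast v\<close>, and composing with q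
      permutes G.\<close>
    have inv: "(\<Sum>p\<in>G. f (permute_list p v)) = (\<Sum>p\<in>G. f (permute_list p u))" if v: "v \<in> Ob" for v
    proof -
      have "mset (butlast v) = mset (butlast u)"
      proof -
        have "v \<noteq> []" "u \<noteq> []" using len[OF v] u d by auto
        then have e: "mset v = mset (butlast v) + {#last v#}" "mset u = mset (butlast u) + {#last u#}"
          by (metis append_butlast_last_id mset.simps mset_append add_mset_add_single empty_neutral(1))+
        have m: "mset v = mset u" and l: "last v = last u" using v by (simp_all add: Ob_def)
        have "mset (butlast v) + {#last v#} = mset (butlast u) + {#last u#}"
          by (simp only: e[symmetric] m)
        then show ?thesis using l by simp
      qed
      then obtain q where q: "q permutes {..<length (butlast u)}" "permute_list q (butlast u) = butlast v"
        by (rule mset_eq_permutation)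
      then have qG: "q \<in> G" using u by (simp add: G_def)
      have "permute_list q u = v"
      proof (rule nth_equalityI)
        show "length (permute_list q u) = length v" using u len[OF v] by simp
        fix i assume "i < length (permute_list q u)"
        then have i: "i < d" using u by simp
        show "permute_list q u ! i = v ! i"
        proof (cases "i < d - 1")
          case True
          then have "q i < d - 1" using q(1) u permutes_in_image[OF q(1), of i] by simp
          then have "permute_list q u ! i = butlast u ! q i"
            using i u p'[OF qG] by (simp add: permute_list_nth nth_butlast)
          also have "\<dots> = butlast v ! i"
            using True q u by (metis length_butlast permute_list_nth)
          also have "\<dots> = v ! i" using True len[OF v] by (simp add: nth_butlast)
          finally show ?thesis .
        next
          case False
          then have "i = d - 1" using i by simp
          moreover have "last (permute_list q u) = last v" using last[OF qG u] v by (simp add: Ob_def)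
          ultimately show ?thesis using u len[OF v] d by (simp add: last_conv_nth[of v] last_conv_nth[of "permute_list q u"] flip: length_0_conv)
        qed
      qed
      then have "(\<Sum>p\<in>G. f (permute_list p v)) = (\<Sum>p\<in>G. f (permute_list (q \<circ> p) u))"
        using u p' by (intro sum.cong) (auto simp: permute_list_compose)
      also have "\<dots> = (\<Sum>p\<in>G. f (permute_list p u))"
      proof (rule sum.reindex_bij_betw)
        show "bij_betw ((\<circ>) q) G G"
        proof (rule bij_betwI[where g = "(\<circ>) (inv q)"])
          have q': "q permutes {..<d - 1}" using qG by (simp add: G_def)
          show "(\<circ>) q \<in> G \<rightarrow> G" using permutes_compose[OF _ q'] by (auto simp: G_def)
          show "(\<circ>) (inv q) \<in> G \<rightarrow> G" using permutes_compose[OF _ permutes_inv[OF q']] by (auto simp: G_def)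
          show "inv q \<circ> (q \<circ> p) = p" "q \<circ> (inv q \<circ> p) = p" for p
            unfolding o_assoc permutes_inv_o[OF q'] by simp_all
        qed
      qed
      finally show ?thesis .
    qed
    \<comment> \<open>By \<open>inv\<close> all summands over the orbit agree. After exchanging the
      sums, each p merely permutes the orbit, so the inner sum is the one assumed to vanish.\<close>
    have "of_nat (card Ob) * (\<Sum>p\<in>G. f (permute_list p u)) = (\<Sum>v\<in>Ob. \<Sum>p\<in>G. f (permute_list p v))"
      using inv by simp
    also have "\<dots> = (\<Sum>p\<in>G. \<Sum>v\<in>Ob. f (permute_list p v))" by (rule sum.swap)
    also have "\<dots> = (\<Sum>p\<in>G. \<Sum>v\<in>Ob. f v)"
      by (intro sum.cong refl sum.reindex_bij_betw orbit)
    also have "\<dots> = 0" using zero[OF u] by (simp add: Ob_def)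
    finally have "card Ob = 0 \<or> (\<Sum>p\<in>G. f (permute_list p u)) = 0" by simp
    moreover have "u \<in> Ob" by (simp add: Ob_def)
    ultimately show ?thesis using finO by auto
  qed
  \<comment> \<open>The average of f over G vanishes as a series, although f itself need not.
    Relabelling preserves types, so \<open>nu\<close> sends this average to card G copies of
    \<open>nu d f\<close>.\<close>
  have "(\<Sum>(p, \<pi>)\<in>G \<times> set_partitions d. nc_scale (a \<pi>) (nc_e d ((`) (relab p) ` \<pi>))) = 0"
  proof
    fix u
    have "(\<Sum>(p, \<pi>)\<in>G \<times> set_partitions d. nc_scale (a \<pi>) (nc_e d ((`) (relab p) ` \<pi>))) u
        = (\<Sum>p\<in>G. \<Sum>\<pi>\<in>set_partitions d. a \<pi> * nc_e d ((`) (relab p) ` \<pi>) u)"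
      by (simp add: nc_sum_apply sum.cartesian_product nc_scale_def split_def)
    also have "\<dots> = 0"
    proof (cases "length u = d")
      case True
      have "(\<Sum>p\<in>G. \<Sum>\<pi>\<in>set_partitions d. a \<pi> * nc_e d ((`) (relab p) ` \<pi>) u) = (\<Sum>p\<in>G. f (permute_list p u))"
        unfolding a nc_sum_apply nc_scale_def
        by (intro sum.cong refl) (use relab_partition(3)[OF _ d _ True] in \<open>simp add: G_def\<close>)
      then show ?thesis using avg[OF True] by simp
    next
      case False
      have "nc_e d ((`) (relab p) ` \<pi>) u = 0" if "p \<in> G" "\<pi> \<in> set_partitions d" for p \<pi>
        using nc_e_eq_nc_ind[OF relab_partition(1)[OF _ d]] that False by (simp add: G_def nc_ind_def)
      then show ?thesis by simp
    qed
    finally show "(\<Sum>(p, \<pi>)\<in>G \<times> set_partitions d. nc_scale (a \<pi>) (nc_e d ((`) (relab p) ` \<pi>))) u = 0 u" by simp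
  qed
  then have "nu d (\<Sum>i\<in>G \<times> set_partitions d. nc_scale (a (snd i)) (nc_e d ((`) (relab (fst i)) ` snd i))) = nu d 0"
    by (simp add: split_def)
  also have "nu d 0 = 0" using nu_nc_e_sum[of "{}" d] by simp
  also have "nu d (\<Sum>i\<in>G \<times> set_partitions d. nc_scale (a (snd i)) (nc_e d ((`) (relab (fst i)) ` snd i)))
      = (\<Sum>i\<in>G \<times> set_partitions d. Poly_Mapping.single (partition_type d ((`) (relab (fst i)) ` snd i)) (a (snd i)))"
    using finG finite_set_partitions relab_partition(1)[OF _ d] by (intro nu_nc_e_sum) (auto simp: G_def)
  also have "\<dots> = (\<Sum>p\<in>G. \<Sum>\<pi>\<in>set_partitions d. Poly_Mapping.single (partition_type d \<pi>) (a \<pi>))"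
    unfolding sum.cartesian_product by (rule sum.cong) (use relab_partition(2)[OF _ d] in \<open>auto simp: G_def\<close>)
  also have "(\<Sum>\<pi>\<in>set_partitions d. Poly_Mapping.single (partition_type d \<pi>) (a \<pi>)) = nu d f"
    unfolding a by (rule nu_nc_e_sum[symmetric]) (use finite_set_partitions in auto)
  finally have z: "(\<Sum>p\<in>G. nu d f) = 0" .
  have "of_nat (card G) * Poly_Mapping.lookup (nu d f) k = 0" for k
    using arg_cong[OF z, of "\<lambda>z. Poly_Mapping.lookup z k"] by (simp only: lookup_sum lookup_zero sum_constant)
  moreover have "card G \<noteq> 0" using finG by (auto simp: G_def intro: permutes_id)
  ultimately show ?thesis by (intro poly_mapping_eqI) simp
qed

section \<open>Polynomial images of series\<close>

definition var :: "nat \<Rightarrow> nat multiset \<Rightarrow>\<^sub>0 rat" where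
  "var i = Poly_Mapping.single {#i#} 1"

interpretation ep: esym_family var "{0<..N}" for N
  by unfold_locales simp

text \<open>Only N variables are kept, so that the image is a polynomial. The mark is encoded by
  fixing the last letter to be c and letting c vary, instead of using an additional
  variable.\<close>

definition marked_poly :: "nat \<Rightarrow> nat \<Rightarrow> nat \<Rightarrow> nc_series \<Rightarrow> nat multiset \<Rightarrow>\<^sub>0 rat" where
  "marked_poly N c d f = (\<Sum>u | length u = d \<and> set u \<subseteq> {0<..N} \<and> last u = c. Poly_Mapping.single (mset u) (f u))"

lemma finite_words: "finite {u. length u = d \<and> set u \<subseteq> {0<..N::nat} \<and> last u = c}"
proof (rule finite_subset)
  show "{u. length u = d \<and> set u \<subseteq> {0<..N} \<and> last u = c} \<subseteq> {u. set u \<subseteq> {0<..N} \<and> length u = d}" by auto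
qed (simp add: finite_lists_length_eq)

lemma marked_poly_sum:
  "marked_poly N c d (\<Sum>i\<in>I. nc_scale (a i) (g i)) = (\<Sum>i\<in>I. Poly_Mapping.single 0 (a i) * marked_poly N c d (g i))"
proof -
  have "marked_poly N c d (\<Sum>i\<in>I. nc_scale (a i) (g i))
      = (\<Sum>u | length u = d \<and> set u \<subseteq> {0<..N} \<and> last u = c. \<Sum>i\<in>I. Poly_Mapping.single 0 (a i) * Poly_Mapping.single (mset u) (g i u))"
    unfolding marked_poly_def nc_sum_apply by (simp add: single_sum nc_scale_def mult_single)
  also have "\<dots> = (\<Sum>i\<in>I. \<Sum>u | length u = d \<and> set u \<subseteq> {0<..N} \<and> last u = c. Poly_Mapping.single 0 (a i) * Poly_Mapping.single (mset u) (g i u))"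
    by (rule sum.swap)
  finally show ?thesis by (simp only: marked_poly_def sum_distrib_left)
qed

lemma single_mset_eq_prod:
  assumes "distinct xs"
  shows "Poly_Mapping.single (mset (map t xs)) 1 = (\<Prod>i\<in>set xs. var (t i))"
  using assms
proof (induction xs)
  case (Cons a xs)
  have "Poly_Mapping.single (mset (map t (a # xs))) (1::rat) = var (t a) * Poly_Mapping.single (mset (map t xs)) 1"
    by (simp add: var_def mult_single)
  then show ?case using Cons by simp
qed simp

lemma marked_poly_nc_ind:
  assumes d: "1 \<le> d"
  shows "marked_poly N c d (nc_ind d Q)
    = (\<Sum>t | t \<in> {1..d} \<rightarrow>\<^sub>E {0<..N} \<and> Q t \<and> t d = c. \<Prod>i=1..d. var (t i))"
proof -
  define W where "W = {u. length u = d \<and> set u \<subseteq> {0<..N} \<and> last u = c}"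
  have finW: "finite W" unfolding W_def by (rule finite_words)
  have "marked_poly N c d (nc_ind d Q) = (\<Sum>u\<in>W. if Q (word_fun d u) then Poly_Mapping.single (mset u) 1 else 0)"
    unfolding marked_poly_def W_def[symmetric] by (rule sum.cong) (auto simp: nc_ind_def W_def)
  also have "\<dots> = (\<Sum>u\<in>{u \<in> W. Q (word_fun d u)}. Poly_Mapping.single (mset u) 1)"
    by (rule sum.inter_filter[OF finW, symmetric])
  also have "\<dots> = (\<Sum>t | t \<in> {1..d} \<rightarrow>\<^sub>E {0<..N} \<and> Q t \<and> t d = c. \<Prod>i=1..d. var (t i))"
  proof (rule sum.reindex_bij_witness[of _ "\<lambda>t. map t [1..<Suc d]" "word_fun d"])
    fix u assume u: "u \<in> {u \<in> W. Q (word_fun d u)}"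
    then have l: "length u = d" "set u \<subseteq> {0<..N}" "last u = c" "Q (word_fun d u)" by (auto simp: W_def)
    show m: "map (word_fun d u) [1..<Suc d] = u" by (rule map_word_fun[OF l(1)])
    have "u \<noteq> []" using l(1) d by auto
    then have "word_fun d u d = c" using l d by (simp add: word_fun_def last_conv_nth)
    then show "word_fun d u \<in> {t. t \<in> {1..d} \<rightarrow>\<^sub>E {0<..N} \<and> Q t \<and> t d = c}"
      using word_fun_PiE[OF l(1,2)] l(4) by simp
    have "(\<Prod>i=1..d. var (word_fun d u i)) = Poly_Mapping.single (mset (map (word_fun d u) [1..<Suc d])) 1"
      by (subst single_mset_eq_prod) (simp_all add: atLeastLessThanSuc_atLeastAtMost del: upt_Suc)
    then show "(\<Prod>i=1..d. var (word_fun d u i)) = Poly_Mapping.single (mset u) 1" unfolding m .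
  next
    fix t assume t: "t \<in> {t. t \<in> {1..d} \<rightarrow>\<^sub>E {0<..N} \<and> Q t \<and> t d = c}"
    then have tE: "t \<in> {1..d} \<rightarrow>\<^sub>E {0<..N}" "Q t" "t d = c" by auto
    show w: "word_fun d (map t [1..<Suc d]) = t" by (rule word_fun_map[OF tE(1)])
    have "set (map t [1..<Suc d]) = t ` {1..d}" by (simp only: set_map set_upt atLeastLessThanSuc_atLeastAtMost)
    moreover have "t ` {1..d} \<subseteq> {0<..N}" using tE(1) by (auto simp: PiE_def Pi_def)
    moreover have "last (map t [1..<Suc d]) = c" using d tE(3) by simp
    ultimately show "map t [1..<Suc d] \<in> {u \<in> W. Q (word_fun d u)}"
      using tE(2) w by (simp add: W_def del: upt_Suc)
  qed
  finally show ?thesis .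
qed

text \<open>Disjoint blocks are coloured independently; the last assumption says that P B looks only
  at the colours inside B.\<close>

lemma sum_PiE_Union:
  fixes v :: "'k \<Rightarrow> 'r :: comm_ring_1"
  assumes "finite \<B>" "\<And>B. B \<in> \<B> \<Longrightarrow> finite B" "finite S" "disjoint \<B>"
    and P: "\<And>B t t'. B \<in> \<B> \<Longrightarrow> (\<And>i. i \<in> B \<Longrightarrow> t i = t' i) \<Longrightarrow> P B t = P B t'"
  shows "(\<Sum>t | t \<in> \<Union>\<B> \<rightarrow>\<^sub>E S \<and> (\<forall>B\<in>\<B>. P B t). \<Prod>i\<in>\<Union>\<B>. v (t i))
    = (\<Prod>B\<in>\<B>. \<Sum>t | t \<in> B \<rightarrow>\<^sub>E S \<and> P B t. \<Prod>i\<in>B. v (t i))"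
  using assms
proof (induction \<B> rule: finite_induct)
  case empty
  have "{t. t \<in> {} \<rightarrow>\<^sub>E S} = {\<lambda>_. undefined}" by auto
  then show ?case by simp
next
  case (insert B \<B>)
  have dis: "B \<inter> \<Union>\<B> = {}"
  proof (rule equals0I)
    fix i assume "i \<in> B \<inter> \<Union>\<B>"
    then obtain C where "C \<in> \<B>" "i \<in> B" "i \<in> C" by blast
    then show False using disjointD[OF insert.prems(3), of B C] insert.hyps(2) by blast
  qed
  have dj: "disjoint \<B>" using insert.prems(3) by (auto simp: disjoint_def)
  have fin: "finite B" "finite (\<Union>\<B>)"
  proof -
    show "finite B" using insert.prems(1) by blast
    show "finite (\<Union>\<B>)" by (rule finite_Union[OF insert.hyps(1)]) (use insert.prems(1) in blast)
  qed
  define T1 where "T1 = {t. t \<in> B \<rightarrow>\<^sub>E S \<and> P B t}"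
  define T2 where "T2 = {t. t \<in> \<Union>\<B> \<rightarrow>\<^sub>E S \<and> (\<forall>C\<in>\<B>. P C t)}"
  have finT: "finite T1" "finite T2"
    proof -
    show "finite T1" unfolding T1_def
      by (rule finite_subset[of _ "B \<rightarrow>\<^sub>E S"]) (use finite_PiE[OF fin(1), of "\<lambda>_. S"] insert.prems(2) in auto)
    show "finite T2" unfolding T2_def
      by (rule finite_subset[of _ "\<Union>\<B> \<rightarrow>\<^sub>E S"]) (use finite_PiE[OF fin(2), of "\<lambda>_. S"] insert.prems(2) in auto)
  qed
  have IH: "(\<Sum>t\<in>T2. \<Prod>i\<in>\<Union>\<B>. v (t i)) = (\<Prod>B\<in>\<B>. \<Sum>t | t \<in> B \<rightarrow>\<^sub>E S \<and> P B t. \<Prod>i\<in>B. v (t i))"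
    unfolding T2_def
  proof (rule insert.IH[OF _ insert.prems(2) dj])
    show "finite C" if "C \<in> \<B>" for C using insert.prems(1) that by blast
    show "P C t = P C t'" if "C \<in> \<B>" "\<And>i. i \<in> C \<Longrightarrow> t i = t' i" for C t t'
      using insert.prems(4)[of C t t'] that by blast
  qed
  have "(\<Sum>t | t \<in> \<Union>(insert B \<B>) \<rightarrow>\<^sub>E S \<and> (\<forall>C\<in>insert B \<B>. P C t). \<Prod>i\<in>\<Union>(insert B \<B>). v (t i))
      = (\<Sum>(t1, t2)\<in>T1 \<times> T2. (\<Prod>i\<in>B. v (t1 i)) * (\<Prod>i\<in>\<Union>\<B>. v (t2 i)))"
  proof (rule sum.reindex_bij_witness[of _ "\<lambda>(t1, t2) i. if i \<in> B then t1 i else t2 i" "\<lambda>t. (restrict t B, restrict t (\<Union>\<B>))"])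
    fix t assume "t \<in> {t. t \<in> \<Union>(insert B \<B>) \<rightarrow>\<^sub>E S \<and> (\<forall>C\<in>insert B \<B>. P C t)}"
    then have t: "t \<in> (B \<union> \<Union>\<B>) \<rightarrow>\<^sub>E S" "P B t" "\<And>C. C \<in> \<B> \<Longrightarrow> P C t" by auto
    show "(case (restrict t B, restrict t (\<Union>\<B>)) of (t1, t2) \<Rightarrow> \<lambda>i. if i \<in> B then t1 i else t2 i) = t"
    proof
      fix i show "(case (restrict t B, restrict t (\<Union>\<B>)) of (t1, t2) \<Rightarrow> \<lambda>i. if i \<in> B then t1 i else t2 i) i = t i"
        using PiE_arb[OF t(1), of i] by (auto simp: restrict_def)
    qed
    have "P B t = P B (restrict t B)" by (rule insert.prems(4)) auto
    then have "P B (restrict t B)" using t(2) by simp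
    moreover have "P C (restrict t (\<Union>\<B>))" if C: "C \<in> \<B>" for C
    proof -
      have "P C t = P C (restrict t (\<Union>\<B>))" by (rule insert.prems(4)) (use C in auto)
      then show ?thesis using t(3)[OF C] by simp
    qed
    moreover have "restrict t B \<in> B \<rightarrow>\<^sub>E S" "restrict t (\<Union>\<B>) \<in> \<Union>\<B> \<rightarrow>\<^sub>E S" using t(1) by (auto simp: PiE_def Pi_def)
    ultimately show "(restrict t B, restrict t (\<Union>\<B>)) \<in> T1 \<times> T2" by (simp add: T1_def T2_def)
    have "(\<Prod>i\<in>B \<union> \<Union>\<B>. v (t i)) = (\<Prod>i\<in>B. v (t i)) * (\<Prod>i\<in>\<Union>\<B>. v (t i))"
      by (rule prod.union_disjoint[OF fin dis])
    then show "(case (restrict t B, restrict t (\<Union>\<B>)) of (t1, t2) \<Rightarrow> (\<Prod>i\<in>B. v (t1 i)) * (\<Prod>i\<in>\<Union>\<B>. v (t2 i))) = (\<Prod>i\<in>\<Union>(insert B \<B>). v (t i))"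
      by simp
  next
    fix p assume "p \<in> T1 \<times> T2"
    then obtain t1 t2 where p: "p = (t1, t2)" and t1: "t1 \<in> B \<rightarrow>\<^sub>E S" "P B t1" and t2: "t2 \<in> \<Union>\<B> \<rightarrow>\<^sub>E S" "\<And>C. C \<in> \<B> \<Longrightarrow> P C t2"
      by (auto simp: T1_def T2_def)
    define t where "t = (\<lambda>i. if i \<in> B then t1 i else t2 i)"
    have eq: "(case p of (t1, t2) \<Rightarrow> \<lambda>i. if i \<in> B then t1 i else t2 i) = t" by (simp add: p t_def)
    have "restrict t B = t1" using PiE_arb[OF t1(1)] by (auto simp: t_def restrict_def)
    moreover have "restrict t (\<Union>\<B>) = t2"
    proof
      fix i show "restrict t (\<Union>\<B>) i = t2 i"
        using PiE_arb[OF t2(1), of i] dis by (cases "i \<in> \<Union>\<B>") (auto simp: t_def restrict_def)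
    qed
    ultimately show "(restrict (case p of (t1, t2) \<Rightarrow> \<lambda>i. if i \<in> B then t1 i else t2 i) B,
        restrict (case p of (t1, t2) \<Rightarrow> \<lambda>i. if i \<in> B then t1 i else t2 i) (\<Union>\<B>)) = p"
      unfolding eq by (simp add: p)
    have "P B t = P B t1" by (rule insert.prems(4)) (auto simp: t_def)
    moreover have "P C t" if C: "C \<in> \<B>" for C
    proof -
      have "P C t = P C t2" by (rule insert.prems(4)) (use C dis in \<open>auto simp: t_def\<close>)
      then show ?thesis using t2(2)[OF C] by simp
    qed
    moreover have "t \<in> B \<union> \<Union>\<B> \<rightarrow>\<^sub>E S"
      using t1(1) t2(1) unfolding t_def PiE_def Pi_def extensional_def by simp
    ultimately show "(case p of (t1, t2) \<Rightarrow> \<lambda>i. if i \<in> B then t1 i else t2 i) \<in> {t. t \<in> \<Union>(insert B \<B>) \<rightarrow>\<^sub>E S \<and> (\<forall>C\<in>insert B \<B>. P C t)}"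
      unfolding eq using t1(2) by simp
  qed
  also have "\<dots> = (\<Sum>t\<in>T1. \<Prod>i\<in>B. v (t i)) * (\<Sum>t\<in>T2. \<Prod>i\<in>\<Union>\<B>. v (t i))"
    by (simp add: sum_product sum.cartesian_product)
  finally show ?case using insert.hyps by (simp add: IH T1_def)
qed

text \<open>Counts how the chosen colour sets can be distributed inside the blocks. In the last
  block the colour of d is fixed, whence b - 1.\<close>

definition type_fact :: "nat multiset \<times> nat \<Rightarrow> nat" where
  "type_fact p = (\<Prod>l\<in>#fst p. fact l) * fact (snd p - 1)"

definition type_poly :: "nat \<Rightarrow> nat \<Rightarrow> nat multiset \<times> nat \<Rightarrow> nat multiset \<Rightarrow>\<^sub>0 rat" where
  "type_poly N c p = (\<Prod>l\<in>#fst p. ep.esym {0<..N} l) * ep.xe N c (snd p - 1)"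

lemma marked_poly_nc_e:
  assumes \<pi>: "partition_on {1..d} \<pi>" and d: "1 \<le> d" and c: "c \<in> {0<..N}"
  shows "marked_poly N c d (nc_e d \<pi>) = of_nat (type_fact (partition_type d \<pi>)) * type_poly N c (partition_type d \<pi>)"
proof -
  define D where "D = block \<pi> d"
  have D: "D \<in> \<pi>" "d \<in> D" unfolding D_def by (rule block_in[OF \<pi>], use d in simp)+
  have fin: "finite \<pi>" by (rule finite_elements[OF _ \<pi>]) simp
  have finB: "finite B" if "B \<in> \<pi>" for B using that partition_onD1[OF \<pi>] by (metis Sup_upper finite_atLeastAtMost finite_subset)
  have notD: "d \<notin> B" if "B \<in> \<pi>" "B \<noteq> D" for B using that block_eq_iff[OF \<pi>] D_def by blast
  define P where "P B t \<longleftrightarrow> inj_on t B \<and> (d \<in> B \<longrightarrow> t d = c)" for B and t :: "nat \<Rightarrow> nat"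
  have "marked_poly N c d (nc_e d \<pi>)
      = (\<Sum>t | t \<in> {1..d} \<rightarrow>\<^sub>E {0<..N} \<and> (\<forall>B\<in>\<pi>. inj_on t B) \<and> t d = c. \<Prod>i=1..d. var (t i))"
    unfolding nc_e_eq_nc_ind[OF \<pi>] by (rule marked_poly_nc_ind[OF d])
  also have "\<dots> = (\<Sum>t | t \<in> \<Union>\<pi> \<rightarrow>\<^sub>E {0<..N} \<and> (\<forall>B\<in>\<pi>. P B t). \<Prod>i\<in>\<Union>\<pi>. var (t i))"
  proof -
    have "(\<forall>B\<in>\<pi>. inj_on t B) \<and> t d = c \<longleftrightarrow> (\<forall>B\<in>\<pi>. P B t)" for t using D unfolding P_def by blast
    then show ?thesis unfolding partition_onD1[OF \<pi>, symmetric] by simp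
  qed
  also have "\<dots> = (\<Prod>B\<in>\<pi>. \<Sum>t | t \<in> B \<rightarrow>\<^sub>E {0<..N} \<and> P B t. \<Prod>i\<in>B. var (t i))"
  proof (rule sum_PiE_Union[OF fin finB _ partition_onD2[OF \<pi>]])
    fix B and t t' :: "nat \<Rightarrow> nat" assume "\<And>i. i \<in> B \<Longrightarrow> t i = t' i"
    then show "P B t = P B t'" unfolding P_def by (metis inj_on_cong)
  qed auto
  also have "\<dots> = (\<Sum>t | t \<in> D \<rightarrow>\<^sub>E {0<..N} \<and> P D t. \<Prod>i\<in>D. var (t i)) *
      (\<Prod>B\<in>\<pi> - {D}. \<Sum>t | t \<in> B \<rightarrow>\<^sub>E {0<..N} \<and> P B t. \<Prod>i\<in>B. var (t i))"
    by (rule prod.remove[OF fin D(1)])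
  also have "(\<Sum>t | t \<in> D \<rightarrow>\<^sub>E {0<..N} \<and> P D t. \<Prod>i\<in>D. var (t i)) = of_nat (fact (card D - 1)) * ep.xe N c (card D - 1)"
    using ep.sum_prod_inj_fixed[of D "{0<..N}" d c] D finB c unfolding ep.xe_def by (simp add: P_def)
  also have "(\<Prod>B\<in>\<pi> - {D}. \<Sum>t | t \<in> B \<rightarrow>\<^sub>E {0<..N} \<and> P B t. \<Prod>i\<in>B. var (t i))
      = (\<Prod>B\<in>\<pi> - {D}. of_nat (fact (card B)) * ep.esym {0<..N} (card B))"
    by (rule prod.cong) (use ep.sum_prod_inj[of _ "{0<..N}"] finB notD in \<open>auto simp: P_def\<close>)
  also have "\<dots> = of_nat (\<Prod>B\<in>\<pi> - {D}. fact (card B)) * (\<Prod>B\<in>\<pi> - {D}. ep.esym {0<..N} (card B))"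
    by (simp only: prod.distrib of_nat_prod)
  finally show ?thesis
    by (simp add: type_fact_def type_poly_def partition_type_def D_def prod_unfold_prod_mset image_mset.compositionality comp_def mult_ac)
qed

subsection \<open>The recursion on coefficients\<close>

text \<open>Multiplication by e_r on coefficient functions: the coefficient at p of the product is
  that of f at p with one part r deleted. As e_0 = 1 and 0 is never a part of a valid index, r = 0
  is the identity.\<close>

definition e_mult :: "nat \<Rightarrow> (nat multiset \<times> nat \<Rightarrow> rat) \<Rightarrow> nat multiset \<times> nat \<Rightarrow> rat" where
  "e_mult r f p = (if r = 0 then f p else if r \<in># fst p then f (fst p - {#r#}, snd p) else 0)"

definition marked_e :: "nat \<Rightarrow> nat multiset \<times> nat \<Rightarrow> rat" where
  "marked_e i p = (if p = ({#}, Suc i) then 1 else 0)"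

definition deg :: "nat multiset \<times> nat \<Rightarrow> nat" where
  "deg p = sum_mset (fst p) + snd p"

lemma e_mult_0 [simp]: "e_mult 0 f = f"
  by (auto simp: e_mult_def)

lemma e_mult_add: "e_mult r (\<lambda>p. f p + g p) p = e_mult r f p + e_mult r g p"
  and e_mult_diff: "e_mult r (\<lambda>p. f p - g p) p = e_mult r f p - e_mult r g p"
  and e_mult_minus: "e_mult r (\<lambda>p. - f p) p = - e_mult r f p"
  and e_mult_scale: "e_mult r (\<lambda>p. c * f p) p = c * e_mult r f p"
  and e_mult_zero: "e_mult r (\<lambda>p. 0) p = 0"
  by (auto simp: e_mult_def)

lemma e_mult_sum: "e_mult r (\<lambda>p. \<Sum>i\<in>A. f i p) p = (\<Sum>i\<in>A. e_mult r (f i) p)"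
  by (auto simp: e_mult_def)

lemmas e_mult_linear = e_mult_add e_mult_diff e_mult_minus e_mult_scale e_mult_zero e_mult_sum

lemma e_mult_commute: "e_mult r (e_mult s f) p = e_mult s (e_mult r f) p"
proof (cases "r = s")
  case False
  then show ?thesis
    by (auto simp: e_mult_def in_diff_count diff_right_commute[of "fst p" "{#s#}" "{#r#}"]
      simp del: diff_diff_add_mset)
qed simp

text \<open>A factor e_r with r > 0 reads its argument only at pairs with fewer parts. This makes
  the number of parts a usable induction measure.\<close>

lemma e_mult_mono:
  assumes "0 < r" "\<And>p'. size (fst p') < size (fst p) \<Longrightarrow> snd p' = snd p \<Longrightarrow> f p' \<le> g p'"
  shows "e_mult r f p \<le> e_mult r g p"
proof (cases "r \<in># fst p")
  case True
  then have "size (fst p - {#r#}) < size (fst p)" by (rule size_Diff1_less)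
  then show ?thesis using assms(1) assms(2)[of "(fst p - {#r#}, snd p)"] by (simp add: e_mult_def)
qed (use assms in \<open>simp add: e_mult_def\<close>)

lemma deg_diff: "r \<in># fst p \<Longrightarrow> deg (fst p - {#r#}, snd p) = deg p - r"
  and le_deg: "r \<in># fst p \<Longrightarrow> r \<le> deg p"
  by (auto simp: deg_def sum_mset_diff dest!: multi_member_split)

lemma e_mult_eq_0: "deg p < r \<Longrightarrow> e_mult r f p = 0"
  using le_deg[of r p] by (auto simp: e_mult_def)

lemma marked_e_eq_0: "deg p \<noteq> Suc i \<Longrightarrow> marked_e i p = 0"
  by (auto simp: marked_e_def deg_def)

lemma e_mult_marked_e_eq_0: "deg p \<noteq> r + Suc i \<Longrightarrow> e_mult r (marked_e i) p = 0"
  using le_deg[of r p] marked_e_eq_0[of p i] marked_e_eq_0[of "(fst p - {#r#}, snd p)" i]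
  by (auto simp: e_mult_def deg_diff)

text \<open>A pair \<open>(l, b)\<close> stands for \<open>e\<^sub>l X\<^sub>b\<close>. The recursions are those of \<open>ladder_poly\<close> and \<open>lollipop_poly\<close>.\<close>

primrec ladder :: "nat \<Rightarrow> nat \<Rightarrow> nat \<Rightarrow> nat multiset \<times> nat \<Rightarrow> rat" where
  "ladder 0 = (\<lambda>i j. e_mult j (marked_e i))"
| "ladder (Suc n) = (\<lambda>i j p. of_nat i * e_mult (Suc i) (ladder n j 0) p + ladder n j (Suc i) p +
     (\<Sum>q\<le>min i j. e_mult q (ladder n (Suc (i + j) - q) 0) p - e_mult (Suc (i + j) - q) (ladder n q 0) p))"

primrec lollipop :: "nat \<Rightarrow> nat \<Rightarrow> nat multiset \<times> nat \<Rightarrow> rat" where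
  "lollipop 0 = marked_e"
| "lollipop (Suc n) = (\<lambda>m p. of_nat m * ladder n (Suc m) 0 p + lollipop n (Suc m) p)"

text \<open>The sum of \<open>ladder n i j\<close> over all \<open>n\<close>: the degree of \<open>p\<close> singles out one of them.\<close>

definition ladder_total :: "nat \<Rightarrow> nat \<Rightarrow> nat multiset \<times> nat \<Rightarrow> rat" where
  "ladder_total i j p = (if i + j < deg p then ladder (deg p - Suc (i + j)) i j p else 0)"

abbreviation alpha :: "nat \<Rightarrow> nat multiset \<times> nat \<Rightarrow> rat" where
  "alpha i \<equiv> ladder_total i 0"

lemma e_mult_alpha: "e_mult r (alpha q) p = (if r + q < deg p then e_mult r (ladder (deg p - Suc (r + q)) q 0) p else 0)"
  using le_deg[of r p] by (auto simp: e_mult_def ladder_total_def deg_diff)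

lemma e_mult_alpha_eq_0: "deg p \<le> r + q \<Longrightarrow> e_mult r (alpha q) p = 0"
  by (simp add: e_mult_alpha)

lemma alpha_eq_0: "deg p \<le> q \<Longrightarrow> alpha q p = 0"
  by (simp add: ladder_total_def)

text \<open>The degree of p fixes the ladder length, so length 0 appears as the boundary term e_j
  X_{i+1}, and all greater lengths obey a single recursion without n.\<close>

lemma ladder_total_rec: "ladder_total i j p = e_mult j (marked_e i) p + ladder_total j (Suc i) p + of_nat i * e_mult (Suc i) (alpha j) p +
    (\<Sum>q\<le>min i j. e_mult q (alpha (Suc (i + j) - q)) p - e_mult (Suc (i + j) - q) (alpha q) p)"
proof -
  have s: "(\<Sum>q\<le>min i j. e_mult q (alpha (Suc (i + j) - q)) p - e_mult (Suc (i + j) - q) (alpha q) p) =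
      (if Suc (i + j) < deg p then \<Sum>q\<le>min i j. e_mult q (ladder (deg p - Suc (Suc (i + j))) (Suc (i + j) - q) 0) p
        - e_mult (Suc (i + j) - q) (ladder (deg p - Suc (Suc (i + j))) q 0) p else 0)"
    by (simp add: e_mult_alpha)
  consider "deg p \<le> i + j" | "deg p = Suc (i + j)" | "Suc (i + j) < deg p" by linarith
  then show ?thesis
  proof cases
    case 1
    then show ?thesis unfolding s by (simp add: ladder_total_def e_mult_alpha e_mult_marked_e_eq_0)
  next
    case 2
    then show ?thesis unfolding s by (simp add: ladder_total_def e_mult_alpha)
  next
    case 3
    then have n: "deg p - Suc (i + j) = Suc (deg p - Suc (Suc (i + j)))" by simp
    show ?thesis unfolding s using 3
      by (simp add: ladder_total_def n e_mult_alpha e_mult_marked_e_eq_0 add.commute del: diff_Suc_Suc)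
  qed
qed

lemma sum_pairs: "(\<Sum>s<M. h (2 * s + 1) + h (2 * s + 2)) = (\<Sum>m=1..2*M. h m)" for h :: "nat \<Rightarrow> rat"
  by (induction M) (auto simp: algebra_simps)

lemma sum_antidiagonal:
  fixes F :: "nat \<Rightarrow> nat \<Rightarrow> rat"
  assumes "\<And>r q. M < r + q \<Longrightarrow> F r q = 0"
  shows "(\<Sum>m=1..2*M. \<Sum>r\<le>m div 2. F r (m - r)) = (\<Sum>q=1..M. \<Sum>r\<le>q. F r q)"
proof -
  have "(\<Sum>m=1..2*M. \<Sum>r\<le>m div 2. F r (m - r)) = (\<Sum>(m,r)\<in>Sigma {1..2*M} (\<lambda>m. {..m div 2}). F r (m - r))"
    by (simp add: sum.Sigma)
  also have "\<dots> = (\<Sum>(q,r)\<in>{(q,r). 1 \<le> q \<and> r \<le> q \<and> q + r \<le> 2 * M}. F r q)"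
    by (rule sum.reindex_bij_witness[of _ "\<lambda>(q,r). (q + r, r)" "\<lambda>(m,r). (m - r, r)"]) auto
  also have "\<dots> = (\<Sum>(q,r)\<in>Sigma {1..M} (\<lambda>q. {..q}). F r q)"
  proof (rule sum.mono_neutral_right)
    show "finite {(q,r). 1 \<le> q \<and> r \<le> q \<and> q + r \<le> 2 * M}"
      by (rule finite_subset[of _ "{..2*M} \<times> {..2*M}"]) auto
  qed (auto intro!: assms)
  finally show ?thesis by (simp add: sum.Sigma)
qed

text \<open>Two uses of the recursion lead from (s, k+s) through (k+s, s+1) to (s+1, k+s+1). Their
  correction sums are the antidiagonals 2s+1 and 2s+2, which together fill the region r \<le> q; k
  >= 1 makes s+1 the upper limit of the second one. High degree cuts the process off.\<close>

lemma ladder_total_0_expand: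
  assumes k: "1 \<le> k" and M: "deg p \<le> M"
  shows "ladder_total 0 k p = (\<Sum>s<M. e_mult (k + s) (marked_e s) p + e_mult (Suc s) (marked_e (k + s)) p
      + of_nat s * e_mult (Suc s) (alpha (k + s)) p + of_nat (k + s) * e_mult (Suc (k + s)) (alpha (Suc s)) p)
    + (\<Sum>q=1..M. \<Sum>r\<le>q. e_mult r (alpha (k + q)) p - e_mult (k + q) (alpha r) p)"
proof -
  define f where "f r s = e_mult r (alpha s) p - e_mult s (alpha r) p" for r s
  define c where "c s = e_mult (k + s) (marked_e s) p + e_mult (Suc s) (marked_e (k + s)) p
      + of_nat s * e_mult (Suc s) (alpha (k + s)) p + of_nat (k + s) * e_mult (Suc (k + s)) (alpha (Suc s)) p" for s
  define h where "h m = (\<Sum>r\<le>m div 2. f r (k + (m - r)))" for m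
  have step: "ladder_total s (k + s) p = c s + (h (2 * s + 1) + h (2 * s + 2)) + ladder_total (Suc s) (k + Suc s) p" for s
  proof -
    have 1: "(\<Sum>q\<le>min s (k + s). e_mult q (alpha (Suc (s + (k + s)) - q)) p - e_mult (Suc (s + (k + s)) - q) (alpha q) p) = h (2 * s + 1)"
      unfolding h_def f_def proof (rule sum.cong)
      fix q assume "q \<in> {..(2 * s + 1) div 2}"
      then have "Suc (s + (k + s)) - q = k + (2 * s + 1 - q)" by auto
      then show "e_mult q (alpha (Suc (s + (k + s)) - q)) p - e_mult (Suc (s + (k + s)) - q) (alpha q) p =
          e_mult q (alpha (k + (2 * s + 1 - q))) p - e_mult (k + (2 * s + 1 - q)) (alpha q) p" by (simp only:)
    qed auto
    have m: "min (k + s) (Suc s) = Suc s" using k by simp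
    have 2: "(\<Sum>q\<le>min (k + s) (Suc s). e_mult q (alpha (Suc (k + s + Suc s) - q)) p - e_mult (Suc (k + s + Suc s) - q) (alpha q) p) = h (2 * s + 2)"
      unfolding h_def f_def m proof (rule sum.cong)
      fix q assume "q \<in> {..(2 * s + 2) div 2}"
      then have "Suc (k + s + Suc s) - q = k + (2 * s + 2 - q)" by auto
      then show "e_mult q (alpha (Suc (k + s + Suc s) - q)) p - e_mult (Suc (k + s + Suc s) - q) (alpha q) p =
          e_mult q (alpha (k + (2 * s + 2 - q))) p - e_mult (k + (2 * s + 2 - q)) (alpha q) p" by (simp only:)
    qed auto
    show ?thesis
      using ladder_total_rec[of s "k + s" p] ladder_total_rec[of "k + s" "Suc s" p] 1 2 unfolding c_def by simp
  qed
  have "ladder_total 0 k p = (\<Sum>s<N. c s + (h (2 * s + 1) + h (2 * s + 2))) + ladder_total N (k + N) p" for N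
  proof (induction N)
    case (Suc N)
    then show ?case using step[of N] by simp
  qed simp
  from this[of M] have "ladder_total 0 k p = (\<Sum>s<M. c s) + (\<Sum>s<M. h (2 * s + 1) + h (2 * s + 2))"
    using M by (simp add: ladder_total_def sum.distrib)
  then have "ladder_total 0 k p = (\<Sum>s<M. c s) + (\<Sum>m=1..2*M. h m)"
    unfolding sum_pairs .
  also have "(\<Sum>m=1..2*M. h m) = (\<Sum>q=1..M. \<Sum>r\<le>q. f r (k + q))"
    unfolding h_def by (rule sum_antidiagonal) (use M in \<open>auto simp: f_def e_mult_alpha_eq_0\<close>)
  finally show ?thesis unfolding c_def f_def .
qed

section \<open>From polynomial images back to coefficients\<close>

lemma exists_partition_of_type:
  assumes "finite A" "d \<in> A" "0 \<notin># l" "1 \<le> b" "sum_mset l + b = card A"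
  shows "\<exists>\<pi>. partition_on A \<pi> \<and> (\<exists>B\<in>\<pi>. d \<in> B \<and> card B = b \<and> image_mset card (mset_set (\<pi> - {B})) = l)"
  using assms
proof (induction l arbitrary: A)
  case empty
  then have "partition_on A {A}" by (intro partition_on_space) auto
  then show ?case using empty by (intro exI[of _ "{A}"]) auto
next
  case (add r l)
  have r: "0 < r" using add.prems(3) by (simp add: gr0I)
  have "card (A - {d}) = card A - 1" using add.prems by simp
  then have "r \<le> card (A - {d})" using add.prems by simp
  then obtain C where C: "C \<subseteq> A - {d}" "card C = r" "finite C" by (rule obtain_subset_with_card_n)
  have cardAC: "card (A - C) = card A - r" using C by (subst card_Diff_subset) auto
  have "\<exists>\<pi>. partition_on (A - C) \<pi> \<and> (\<exists>B\<in>\<pi>. d \<in> B \<and> card B = b \<and> image_mset card (mset_set (\<pi> - {B})) = l)"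
    by (rule add.IH) (use add.prems C cardAC in auto)
  then obtain \<pi> B where \<pi>: "partition_on (A - C) \<pi>" and B: "B \<in> \<pi>" "d \<in> B" "card B = b" "image_mset card (mset_set (\<pi> - {B})) = l"
    by blast
  have ne: "C \<noteq> {}" using C r by auto
  have U: "\<Union>\<pi> = A - C" using partition_onD1[OF \<pi>] by simp
  have "partition_on A (insert C \<pi>)"
    using partition_on_insert[of C \<pi> A] \<pi> C ne U by (auto simp: disjnt_def)
  moreover have "B \<in> insert C \<pi>" using B by simp
  moreover have "image_mset card (mset_set (insert C \<pi> - {B})) = add_mset r l"
  proof -
    have "C \<noteq> B" "C \<notin> \<pi>" using B C ne U by blast+
    then have "insert C \<pi> - {B} = insert C (\<pi> - {B})" "C \<notin> \<pi> - {B}" by blast+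
    moreover have "finite \<pi>" using finite_elements[OF _ \<pi>] add.prems(1) by simp
    ultimately show ?thesis using B C by simp
  qed
  ultimately show ?case using B by blast
qed

lemma ubc_index_type:
  assumes "p \<in> ubc_index d"
  obtains \<pi> where "partition_on {1..d} \<pi>" "partition_type d \<pi> = p"
proof -
  obtain l b where p: "p = (l, b)" "0 \<notin># l" "1 \<le> b" "sum_mset l + b = d"
    using assms by (auto simp: ubc_index_def)
  then obtain \<pi> B where \<pi>: "partition_on {1..d} \<pi>" and B: "B \<in> \<pi>" "d \<in> B" "card B = b" "image_mset card (mset_set (\<pi> - {B})) = l"
    using exists_partition_of_type[of "{1..d}" d l b] by auto
  then have "block \<pi> d = B" by (intro block_eq_iff)
  then have "partition_type d \<pi> = p" using B p by (simp add: partition_type_def)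
  then show ?thesis using that \<pi> by blast
qed

lemma finite_ubc_index: "finite (ubc_index d)"
proof (rule finite_subset)
  show "ubc_index d \<subseteq> partition_type d ` set_partitions d"
  proof
    fix p assume "p \<in> ubc_index d"
    then obtain \<pi> where "partition_on {1..d} \<pi>" "partition_type d \<pi> = p" by (rule ubc_index_type)
    then show "p \<in> partition_type d ` set_partitions d" by blast
  qed
qed (use finite_set_partitions in blast)

lemma nu_diff:
  assumes "f \<in> NC.span (nc_e_basis d)" "g \<in> NC.span (nc_e_basis d)"
  shows "nu d (f - g) = nu d f - nu d g"
  unfolding nu_def NC.representation_diff[OF nc_e_basis_independent(1) assms(2,1)]
  by (simp add: single_diff sum_subtractf)

lemma span_nc_e_supp:
  assumes "f \<in> NC.span (nc_e_basis d)" "\<not> set u \<subseteq> {0<..}"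
  shows "f u = 0"
proof -
  obtain a where "f = (\<Sum>\<pi>\<in>set_partitions d. nc_scale (a \<pi>) (nc_e d \<pi>))" by (rule span_nc_e_expand[OF assms(1)])
  then have "f u = (\<Sum>\<pi>\<in>set_partitions d. a \<pi> * nc_e d \<pi> u)" by (simp add: nc_sum_apply nc_scale_def)
  also have "\<dots> = 0"
    by (rule sum.neutral) (use assms(2) nc_e_eq_nc_ind in \<open>auto simp: nc_ind_def\<close>)
  finally show ?thesis .
qed

lemma nu_eq_0_marked_poly:
  assumes f: "f \<in> NC.span (nc_e_basis d)" and d: "1 \<le> d"
    and zero: "\<And>N c. c \<in> {0<..N} \<Longrightarrow> marked_poly N c d f = 0"
  shows "nu d f = 0"
proof (rule nu_eq_0[OF f d])
  fix u :: "nat list" assume u: "length u = d"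
  show "(\<Sum>v | mset v = mset u \<and> last v = last u. f v) = 0"
  proof (cases "set u \<subseteq> {0<..}")
    case False
    have "f v = 0" if "mset v = mset u" for v
      using span_nc_e_supp[OF f] mset_eq_setD[OF that] False by simp
    then show ?thesis by simp
  next
    case True
    define N where "N = Max (set u)"
    define W where "W = {v. length v = d \<and> set v \<subseteq> {0<..N} \<and> last v = last u}"
    have "u \<noteq> []" using u d by auto
    have uN: "set u \<subseteq> {0<..N}" using True by (auto simp: N_def)
    have lN: "last u \<in> {0<..N}" using last_in_set[OF \<open>u \<noteq> []\<close>] uN by blast
    have "0 = Poly_Mapping.lookup (marked_poly N (last u) d f) (mset u)" using zero[OF lN] by simp
    also have "\<dots> = (\<Sum>v\<in>W. if mset v = mset u then f v else 0)"
      unfolding marked_poly_def W_def lookup_sum lookup_single by (rule sum.cong) (auto simp: when_def)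
    also have "\<dots> = (\<Sum>v\<in>{v \<in> W. mset v = mset u}. f v)"
      unfolding W_def by (rule sum.inter_filter[OF finite_words, symmetric])
    also have "{v \<in> W. mset v = mset u} = {v. mset v = mset u \<and> last v = last u}"
    proof -
      have "length v = d" "set v \<subseteq> {0<..N}" if "mset v = mset u" for v
        using mset_eq_length[OF that] mset_eq_setD[OF that] u uN by simp_all
      then show ?thesis unfolding W_def by blast
    qed
    finally show ?thesis by simp
  qed
qed

lemma type_fact_nonzero: "type_fact p \<noteq> 0"
proof -
  have "(\<Prod>l\<in>#M. fact l :: nat) \<noteq> 0" for M by (induction M) auto
  then show ?thesis by (simp add: type_fact_def)
qed

text \<open>The expansion is realised by a series g with one representative partition per type,
  divided by the factorials that the image of each e creates. Then f - g has vanishing images for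
  all N and c, so \<open>nu\<close> kills it.\<close>

lemma lookup_nu:
  assumes f: "f \<in> NC.span (nc_e_basis d)" and d: "1 \<le> d"
    and eq: "\<And>N c. c \<in> {0<..N} \<Longrightarrow> marked_poly N c d f = (\<Sum>p\<in>ubc_index d. Poly_Mapping.single 0 (h p) * type_poly N c p)"
    and p: "p \<in> ubc_index d"
  shows "Poly_Mapping.lookup (nu d f) p = h p / of_nat (type_fact p)"
proof -
  define \<pi> where "\<pi> p = (SOME \<pi>. partition_on {1..d} \<pi> \<and> partition_type d \<pi> = p)" for p
  have \<pi>: "partition_on {1..d} (\<pi> p)" "partition_type d (\<pi> p) = p" if "p \<in> ubc_index d" for p
  proof -
    have "\<exists>\<pi>. partition_on {1..d} \<pi> \<and> partition_type d \<pi> = p" by (rule ubc_index_type[OF that]) blast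
    then have "partition_on {1..d} (\<pi> p) \<and> partition_type d (\<pi> p) = p" unfolding \<pi>_def by (rule someI_ex)
    then show "partition_on {1..d} (\<pi> p)" "partition_type d (\<pi> p) = p" by auto
  qed
  define a where "a p = h p / of_nat (type_fact p)" for p
  define g where "g = (\<Sum>p\<in>ubc_index d. nc_scale (a p) (nc_e d (\<pi> p)))"
  note nz = type_fact_nonzero
  have g: "g \<in> NC.span (nc_e_basis d)"
    unfolding g_def using \<pi> by (intro NC.span_sum NC.span_scale NC.span_base) (simp add: nc_e_basis_def)
  have mp: "marked_poly N c d g = marked_poly N c d f" if c: "c \<in> {0<..N}" for N c
  proof -
    have "marked_poly N c d g = (\<Sum>p\<in>ubc_index d. Poly_Mapping.single 0 (a p) * (of_nat (type_fact p) * type_poly N c p))"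
      unfolding g_def marked_poly_sum using \<pi> marked_poly_nc_e[OF _ d c] by simp
    also have "\<dots> = (\<Sum>p\<in>ubc_index d. Poly_Mapping.single 0 (h p) * type_poly N c p)"
    proof (rule sum.cong[OF refl])
      fix q
      have "Poly_Mapping.single 0 (a q) * of_nat (type_fact q) = Poly_Mapping.single (0 :: nat multiset) (a q) * Poly_Mapping.single 0 (of_nat (type_fact q))"
        by (simp only: single_of_nat)
      also have "\<dots> = Poly_Mapping.single 0 (h q)" using nz[of q] by (simp add: mult_single a_def del: single_of_nat)
      finally show "Poly_Mapping.single 0 (a q) * (of_nat (type_fact q) * type_poly N c q) = Poly_Mapping.single 0 (h q) * type_poly N c q"
        by (simp only: mult.assoc[symmetric])
    qed
    finally show ?thesis unfolding eq[OF c] .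
  qed
  have "nu d (f - g) = 0"
  proof (rule nu_eq_0_marked_poly[OF NC.span_diff[OF f g] d])
    fix N c :: nat assume c: "c \<in> {0<..N}"
    have "marked_poly N c d (f - g) = marked_poly N c d f - marked_poly N c d g"
      unfolding marked_poly_def by (simp add: single_diff sum_subtractf)
    then show "marked_poly N c d (f - g) = 0" using mp[OF c] by simp
  qed
  then have "nu d f = nu d g" using nu_diff[OF f g] by simp
  also have "nu d g = (\<Sum>p\<in>ubc_index d. Poly_Mapping.single (partition_type d (\<pi> p)) (a p))"
    unfolding g_def by (rule nu_nc_e_sum[OF finite_ubc_index \<pi>(1)])
  also have "\<dots> = (\<Sum>p\<in>ubc_index d. Poly_Mapping.single p (a p))"
    by (rule sum.cong) (simp_all add: \<pi>)
  also have "Poly_Mapping.lookup \<dots> p = (\<Sum>q\<in>ubc_index d. if q = p then a p else 0)"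
    unfolding lookup_sum lookup_single by (rule sum.cong) (auto simp: when_def)
  also have "\<dots> = a p" using finite_ubc_index p by (simp add: sum.delta)
  finally show ?thesis by (simp add: a_def)
qed

definition ubc_eval :: "nat \<Rightarrow> nat \<Rightarrow> nat \<Rightarrow> (nat multiset \<times> nat \<Rightarrow> rat) \<Rightarrow> nat multiset \<Rightarrow>\<^sub>0 rat" where
  "ubc_eval N c d h = (\<Sum>p\<in>ubc_index d. Poly_Mapping.single 0 (h p) * type_poly N c p)"

lemma ubc_eval_linear:
  "ubc_eval N c d (\<lambda>p. h p + h' p) = ubc_eval N c d h + ubc_eval N c d h'"
  "ubc_eval N c d (\<lambda>p. h p - h' p) = ubc_eval N c d h - ubc_eval N c d h'"
  "ubc_eval N c d (\<lambda>p. of_nat r * h p) = of_nat r * ubc_eval N c d h"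
proof -
  show "ubc_eval N c d (\<lambda>p. of_nat r * h p) = of_nat r * ubc_eval N c d h"
  proof -
    have "Poly_Mapping.single (0::nat multiset) (of_nat r * x) = of_nat r * Poly_Mapping.single 0 x" for x :: rat
      by (simp add: mult_single flip: single_of_nat)
    then show ?thesis by (simp add: ubc_eval_def sum_distrib_left mult.assoc)
  qed
qed (simp_all add: ubc_eval_def single_add single_diff sum.distrib sum_subtractf algebra_simps)

lemma ubc_eval_sum: "ubc_eval N c d (\<lambda>p. \<Sum>i\<in>I. h i p) = (\<Sum>i\<in>I. ubc_eval N c d (h i))"
proof -
  have "ubc_eval N c d (\<lambda>p. \<Sum>i\<in>I. h i p) = (\<Sum>p\<in>ubc_index d. \<Sum>i\<in>I. Poly_Mapping.single 0 (h i p) * type_poly N c p)"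
    by (simp add: ubc_eval_def single_sum sum_distrib_right)
  also have "\<dots> = (\<Sum>i\<in>I. ubc_eval N c d (h i))" unfolding ubc_eval_def by (rule sum.swap)
  finally show ?thesis .
qed

lemma ubc_eval_e_mult: "ubc_eval N c (r + d) (e_mult r h) = ep.esym {0<..N} r * ubc_eval N c d h"
proof (cases "r = 0")
  case False
  define f where "f = (\<lambda>(l, b :: nat). (add_mset r l, b))"
  have inj: "inj_on f (ubc_index d)" by (auto simp: inj_on_def f_def)
  have img: "f ` ubc_index d = {p \<in> ubc_index (r + d). r \<in># fst p}"
  proof (intro equalityI subsetI)
    fix p assume "p \<in> f ` ubc_index d"
    then show "p \<in> {p \<in> ubc_index (r + d). r \<in># fst p}" using False by (auto simp: f_def ubc_index_def)
  next
    fix p assume "p \<in> {p \<in> ubc_index (r + d). r \<in># fst p}"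
    then obtain l b where p: "p = (add_mset r l, b)" "p \<in> ubc_index (r + d)"
      by (metis (mono_tags, lifting) mem_Collect_eq multi_member_split prod.collapse)
    then have "(l, b) \<in> ubc_index d" by (auto simp: ubc_index_def)
    then show "p \<in> f ` ubc_index d" using p(1) by (force simp: f_def)
  qed
  have "ubc_eval N c (r + d) (e_mult r h) = (\<Sum>p\<in>{p \<in> ubc_index (r + d). r \<in># fst p}. Poly_Mapping.single 0 (e_mult r h p) * type_poly N c p)"
    unfolding ubc_eval_def by (rule sum.mono_neutral_right[OF finite_ubc_index]) (use False in \<open>auto simp: e_mult_def\<close>)
  also have "\<dots> = (\<Sum>p\<in>ubc_index d. Poly_Mapping.single 0 (e_mult r h (f p)) * type_poly N c (f p))"
    unfolding img[symmetric] sum.reindex[OF inj] by (simp add: comp_def)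
  also have "\<dots> = (\<Sum>p\<in>ubc_index d. ep.esym {0<..N} r * (Poly_Mapping.single 0 (h p) * type_poly N c p))"
    by (rule sum.cong) (use False in \<open>auto simp: f_def e_mult_def type_poly_def mult_ac\<close>)
  finally show ?thesis by (simp only: ubc_eval_def sum_distrib_left)
qed (simp add: ep.esym_0)

lemma ubc_eval_marked_e: "ubc_eval N c (Suc i) (marked_e i) = ep.xe N c i"
proof -
  have "({#}, Suc i) \<in> ubc_index (Suc i)" by (simp add: ubc_index_def)
  moreover have "ubc_eval N c (Suc i) (marked_e i) = (\<Sum>p\<in>ubc_index (Suc i). if p = ({#}, Suc i) then type_poly N c p else 0)"
    unfolding ubc_eval_def by (rule sum.cong) (auto simp: marked_e_def)
  ultimately show ?thesis using finite_ubc_index by (simp add: sum.delta type_poly_def)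
qed

lemma ubc_eval_ladder:
  assumes c: "c \<in> {0<..N}"
  shows "ubc_eval N c (n + i + j + 1) (ladder n i j) = ep.ladder_poly N c n i j"
proof (induction n arbitrary: i j)
  case 0
  have "ubc_eval N c (j + Suc i) (e_mult j (marked_e i)) = ep.esym {0<..N} j * ep.xe N c i"
    unfolding ubc_eval_e_mult ubc_eval_marked_e ..
  then show ?case by (simp add: ep.ladder_poly_def add.commute)
next
  case (Suc n)
  have e: "ubc_eval N c (Suc n + i + j + 1) (e_mult r (ladder n s 0)) = ep.esym {0<..N} r * ep.ladder_poly N c n s 0"
    if "r + s = Suc (i + j)" for r s
  proof -
    have "Suc n + i + j + 1 = r + (n + s + 0 + 1)" using that by simp
    then show ?thesis by (simp only: ubc_eval_e_mult Suc.IH)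
  qed
  have 1: "ubc_eval N c (Suc n + i + j + 1) (ladder n j (Suc i)) = ep.ladder_poly N c n j (Suc i)"
    using Suc.IH[of j "Suc i"] by (simp add: ac_simps)
  have 2: "ubc_eval N c (Suc n + i + j + 1) (\<lambda>p. e_mult q (ladder n (Suc (i + j) - q) 0) p - e_mult (Suc (i + j) - q) (ladder n q 0) p)
      = ep.esym {0<..N} q * ep.ladder_poly N c n (Suc (i + j) - q) 0 - ep.esym {0<..N} (Suc (i + j) - q) * ep.ladder_poly N c n q 0"
    if "q \<le> min i j" for q
    unfolding ubc_eval_linear using that by (simp only: e[of q "Suc (i + j) - q"] e[of "Suc (i + j) - q" q])
  have 3: "ubc_eval N c (Suc n + i + j + 1) (\<lambda>p. \<Sum>q\<le>min i j. e_mult q (ladder n (Suc (i + j) - q) 0) p - e_mult (Suc (i + j) - q) (ladder n q 0) p)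
      = (\<Sum>q\<le>min i j. ep.esym {0<..N} q * ep.ladder_poly N c n (Suc (i + j) - q) 0 - ep.esym {0<..N} (Suc (i + j) - q) * ep.ladder_poly N c n q 0)"
    unfolding ubc_eval_sum by (rule sum.cong) (use 2 in auto)
  have 4: "ubc_eval N c (Suc n + i + j + 1) (e_mult (Suc i) (ladder n j 0)) = ep.esym {0<..N} (Suc i) * ep.ladder_poly N c n j 0"
    by (rule e) simp
  show ?case
    unfolding ladder.simps ubc_eval_linear(1) ubc_eval_linear(3) 1 3 4 ep.ladder_poly_Suc[OF c] by (simp only: mult.assoc)
qed

lemma ubc_eval_lollipop:
  assumes c: "c \<in> {0<..N}"
  shows "ubc_eval N c (n + m + 1) (lollipop n m) = ep.lollipop_poly N c n m"
proof (induction n arbitrary: m)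
  case 0
  then show ?case using ubc_eval_marked_e[of N c m] by (simp add: ep.lollipop_poly_def)
next
  case (Suc n)
  have "ubc_eval N c (Suc n + m + 1) (ladder n (Suc m) 0) = ep.ladder_poly N c n (Suc m) 0"
    using ubc_eval_ladder[OF c, of n "Suc m" 0] by simp
  moreover have "ubc_eval N c (Suc n + m + 1) (lollipop n (Suc m)) = ep.lollipop_poly N c n (Suc m)"
    using Suc.IH[of "Suc m"] by simp
  ultimately show ?case
    unfolding lollipop.simps ubc_eval_linear ep.lollipop_poly_Suc[OF c] by simp
qed

text \<open>The products \<open>type_poly\<close> are independent when all N and c are taken
  together: apply \<open>lookup_nu\<close> to the zero series.\<close>

lemma ubc_eval_inj:
  assumes eq: "\<And>N c. c \<in> {0<..N} \<Longrightarrow> ubc_eval N c d h = ubc_eval N c d h'" and p: "p \<in> ubc_index d"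
  shows "h p = h' p"
proof -
  have d: "1 \<le> d" using p by (auto simp: ubc_index_def)
  have "Poly_Mapping.lookup (nu d 0) p = (h p - h' p) / of_nat (type_fact p)"
  proof (rule lookup_nu[OF NC.span_zero d _ p])
    fix N c :: nat assume "c \<in> {0<..N}"
    then show "marked_poly N c d 0 = (\<Sum>p\<in>ubc_index d. Poly_Mapping.single 0 (h p - h' p) * type_poly N c p)"
      using eq ubc_eval_linear(2)[of N c d h h'] by (simp add: ubc_eval_def marked_poly_def)
  qed
  moreover have "nu d 0 = 0" using nu_nc_e_sum[of "{}" d] by simp
  moreover note type_fact_nonzero[of p]
  ultimately show ?thesis by simp
qed

text \<open>Pairs that index no basis vector carry coefficient 0, so identities proved on
  \<open>ubc_index\<close> extend to every pair of the right degree.\<close>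

lemma ladder_lollipop_invalid:
  assumes "0 \<in># fst p \<or> snd p = 0"
  shows "ladder n i j p = 0" "lollipop n i p = 0"
proof -
  have m: "marked_e i p = 0" if "0 \<in># fst p \<or> snd p = 0" for i p
    using that by (auto simp: marked_e_def)
  have e: "e_mult r f p = 0" if f: "\<And>p. 0 \<in># fst p \<or> snd p = 0 \<Longrightarrow> f p = 0" and p: "0 \<in># fst p \<or> snd p = 0" for r f p
  proof (cases "r = 0")
    case False
    have "0 \<in># fst p - {#r#} \<longleftrightarrow> 0 \<in># fst p" using False by (simp add: in_diff_count flip: count_greater_zero_iff)
    then show ?thesis using False p f[of "(fst p - {#r#}, snd p)"] by (simp add: e_mult_def)
  qed (use f p in simp)
  have ladder: "ladder n i j p = 0" if "0 \<in># fst p \<or> snd p = 0" for n i j p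
    using that
  proof (induction n arbitrary: i j p)
    case (Suc n)
    have "e_mult r (ladder n s 0) p = 0" for r s using e[OF Suc.IH Suc.prems] .
    then show ?case using Suc by simp
  qed (simp add: e m)
  show "ladder n i j p = 0" by (rule ladder[OF assms])
  show "lollipop n i p = 0" by (induction n arbitrary: i) (simp_all add: m[OF assms] ladder[OF assms])
qed

text \<open>The two recursions do not visibly agree; their polynomials do, being both the bare
  ladder, and coefficients are unique.\<close>

lemma ladder_0_0: "deg p = n + 1 \<Longrightarrow> ladder n 0 0 p = lollipop n 0 p"
proof (cases "0 \<in># fst p \<or> snd p = 0")
  case False
  assume "deg p = n + 1"
  then have p: "p \<in> ubc_index (n + 1)" using False by (cases p) (auto simp: ubc_index_def deg_def)
  show ?thesis
  proof (rule ubc_eval_inj[OF _ p])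
    fix N c :: nat assume "c \<in> {0<..N}"
    then show "ubc_eval N c (n + 1) (ladder n 0 0) = ubc_eval N c (n + 1) (lollipop n 0)"
      using ubc_eval_ladder[of c N n 0 0] ubc_eval_lollipop[of c N n 0] by (simp add: ep.ladder_poly_0_0)
  qed
qed (simp add: ladder_lollipop_invalid)

text \<open>The lollipop recursion is unrolled from clique index 0, where it is the bare ladder. It
  expresses alpha 0 with nonnegative coefficients in the totals of index at least 2.\<close>

lemma alpha_0:
  assumes "deg p \<le> M"
  shows "alpha 0 p = (\<Sum>t=1..M. of_nat t * alpha (Suc t) p) + (\<Sum>i<M. marked_e i p)"
proof -
  define L where "L m = (if m < deg p then lollipop (deg p - Suc m) m p else 0)" for m
  have step: "L m = marked_e m p + of_nat m * alpha (Suc m) p + L (Suc m)" for m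
  proof -
    consider "deg p \<le> m" | "deg p = Suc m" | "Suc m < deg p" by linarith
    then show ?thesis
    proof cases
      case 3
      then have "deg p - Suc m = Suc (deg p - Suc (Suc m))" by simp
      then show ?thesis using 3 by (simp add: L_def ladder_total_def marked_e_eq_0)
    qed (simp_all add: L_def ladder_total_def marked_e_eq_0)
  qed
  have "L 0 = (\<Sum>m<N. marked_e m p + of_nat m * alpha (Suc m) p) + L N" for N
  proof (induction N)
    case (Suc N)
    then show ?case using step[of N] by simp
  qed simp
  from this[of "Suc M"] have "L 0 = (\<Sum>m\<le>M. marked_e m p) + (\<Sum>m\<le>M. of_nat m * alpha (Suc m) p)"
    using assms by (simp add: L_def sum.distrib lessThan_Suc_atMost)
  moreover have "(\<Sum>m\<le>M. marked_e m p) = (\<Sum>m<M. marked_e m p)"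
    using assms by (simp add: lessThan_Suc_atMost[symmetric] marked_e_eq_0)
  moreover have "(\<Sum>m\<le>M. of_nat m * alpha (Suc m) p) = (\<Sum>m=1..M. of_nat m * alpha (Suc m) p)"
    by (rule sum.mono_neutral_right) auto
  moreover have "alpha 0 p = L 0"
    using ladder_0_0[of p "deg p - 1"] by (simp add: L_def ladder_total_def)
  ultimately show ?thesis by simp
qed

subsection \<open>Positivity\<close>

text \<open>The sum in the recursion at (k, 0) has only q = 0, which supplies alpha (k+1) and lowers
  the factor k of e_{k+1} alpha 0 to k - 1.\<close>

lemma alpha_diff:
  "alpha k p - alpha (Suc k) p = marked_e k p + (of_nat k - 1) * e_mult (Suc k) (alpha 0) p + ladder_total 0 (Suc k) p"
  using ladder_total_rec[of k 0 p] by (simp add: algebra_simps)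

lemma sum_shift: "(\<Sum>s<M. F (Suc s)) = (\<Sum>s<M. F s) - F 0 + F M" for F :: "nat \<Rightarrow> rat"
  by (induction M) auto

text \<open>The difference of the expansions of \<open>ladder_total 0 1\<close> and
  \<open>ladder_total 0 2\<close>, stated formally with x r i for e_r alpha_i and y r i for e_r
  X_{i+1}. The double sums are shifts of each other, so only boundary terms survive.\<close>

lemma eta_aux:
  fixes x y :: "nat \<Rightarrow> nat \<Rightarrow> rat"
  assumes x: "\<And>r i. M \<le> r + i \<Longrightarrow> x r i = 0" and y: "\<And>r i. M \<le> r + i \<Longrightarrow> y r i = 0"
  shows "((\<Sum>s<M. y (1 + s) s + y (Suc s) (1 + s) + of_nat s * x (Suc s) (1 + s) + of_nat (1 + s) * x (Suc (1 + s)) (Suc s))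
      + (\<Sum>q=1..M. \<Sum>r\<le>q. x r (1 + q) - x (1 + q) r))
    - ((\<Sum>s<M. y (2 + s) s + y (Suc s) (2 + s) + of_nat s * x (Suc s) (2 + s) + of_nat (2 + s) * x (Suc (2 + s)) (Suc s))
      + (\<Sum>q=1..M. \<Sum>r\<le>q. x r (2 + q) - x (2 + q) r))
    = x 0 2 + y 1 0 + y 1 1 - y 1 2 + x 1 2 + (\<Sum>s<M. y (s + 2) (s + 1) + y (s + 2) (s + 2) - y (s + 2) (s + 3) - y (s + 2) s
        + of_nat (s + 1) * x (s + 2) (s + 2) - of_nat s * x (s + 2) (s + 3) + of_nat s * x (s + 2) (s + 1) - of_nat (s + 1) * x (s + 2) s)"
proof -
  have D: "(\<Sum>q=1..M. \<Sum>r\<le>q. x r (1 + q) - x (1 + q) r) - (\<Sum>q=1..M. \<Sum>r\<le>q. x r (2 + q) - x (2 + q) r)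
      = (x 0 2 - x 2 0) + (\<Sum>q<M. x (q + 1) (q + 2) - x (q + 2) (q + 1))" (is "?D1 - ?D2 = _")
  proof -
    define h where "h q = (\<Sum>r\<le>q. x r (1 + q) - x (1 + q) r)" for q
    define h' where "h' q = (\<Sum>r\<le>q. x r (2 + q) - x (2 + q) r)" for q
    have h': "h' q = h (Suc q) - (x (Suc q) (q + 2) - x (q + 2) (Suc q))" for q
      by (simp add: h_def h'_def)
    have 1: "?D1 = (\<Sum>q<M. h (Suc q))" unfolding h_def[symmetric]
      by (rule sum.reindex_bij_witness[of _ Suc "\<lambda>q. q - 1"]) auto
    have 2: "?D2 = (\<Sum>q<M. h' (Suc q))" unfolding h'_def[symmetric]
      by (rule sum.reindex_bij_witness[of _ Suc "\<lambda>q. q - 1"]) auto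
    have z: "h (Suc M) = 0" "h' M = 0" unfolding h_def h'_def by (auto intro!: sum.neutral simp: x)
    have "?D2 = (\<Sum>q<M. h' q) - h' 0" unfolding 2 sum_shift using z by simp
    also have "h' 0 = x 0 2 - x 2 0" by (simp add: h'_def)
    finally show ?thesis unfolding 1 h' by (simp add: sum_subtractf)
  qed
  have S: "(\<Sum>s<M. F s) = F 0 + (\<Sum>s<M. F (Suc s))" if "F M = 0" for F :: "nat \<Rightarrow> rat"
    using that sum_shift[of F M] by simp
  have 1: "(\<Sum>s<M. y (1 + s) s) = y 1 0 + (\<Sum>s<M. y (s + 2) (s + 1))"
    by (subst S) (auto simp: y)
  have 2: "(\<Sum>s<M. y (Suc s) (1 + s)) = y 1 1 + (\<Sum>s<M. y (s + 2) (s + 2))"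
    by (subst S) (auto simp: y)
  have 3: "(\<Sum>s<M. of_nat s * x (Suc s) (1 + s)) = (\<Sum>s<M. of_nat (s + 1) * x (s + 2) (s + 2))"
    by (subst S) (auto simp: x numeral_2_eq_2)
  have 4: "(\<Sum>s<M. y (Suc s) (2 + s)) = y 1 2 + (\<Sum>s<M. y (s + 2) (s + 3))"
    by (subst S) (auto simp: y numeral_3_eq_3 numeral_2_eq_2)
  have 5: "(\<Sum>s<M. of_nat s * x (Suc s) (2 + s)) = (\<Sum>s<M. of_nat (s + 1) * x (s + 2) (s + 3))"
    by (subst S) (auto simp: x numeral_3_eq_3 numeral_2_eq_2)
  have 6: "(\<Sum>s<M. of_nat (s + 1) * x (s + 2) s) = x 2 0 + (\<Sum>s<M. of_nat (2 + s) * x (Suc (2 + s)) (Suc s))"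
    by (subst S) (auto simp: x numeral_2_eq_2)
  have 7: "(\<Sum>q<M. x (q + 1) (q + 2)) = x 1 2 + (\<Sum>s<M. x (s + 2) (s + 3))"
    by (subst S) (auto simp: x numeral_3_eq_3 numeral_2_eq_2)
  show ?thesis
    using D 1 2 3 4 5 6 7 by (simp add: sum.distrib sum_subtractf algebra_simps)
qed

section \<open>Comparison of the two lowest totals\<close>

definition eta :: "nat multiset \<times> nat \<Rightarrow> rat" where
  "eta p = 2 * alpha 1 p - alpha 0 p"

text \<open>The cofactor of e_{s+2} in the expansion of eta.\<close>

definition eta_term :: "nat \<Rightarrow> nat multiset \<times> nat \<Rightarrow> rat" where
  "eta_term s p = marked_e s p - marked_e (s + 1) p - marked_e (s + 2) p + marked_e (s + 3) p
     - of_nat (s + 1) * alpha (s + 2) p + of_nat s * alpha (s + 3) p - of_nat s * alpha (s + 1) p + of_nat (s + 1) * alpha s p"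

lemma e_mult_eta_term: "e_mult r (eta_term s) p = e_mult r (marked_e s) p - e_mult r (marked_e (s + 1)) p - e_mult r (marked_e (s + 2)) p
    + e_mult r (marked_e (s + 3)) p - of_nat (s + 1) * e_mult r (alpha (s + 2)) p + of_nat s * e_mult r (alpha (s + 3)) p
    - of_nat s * e_mult r (alpha (s + 1)) p + of_nat (s + 1) * e_mult r (alpha s) p"
  unfolding eta_term_def by (simp only: e_mult_linear)

text \<open>Subtracting \<open>alpha_diff\<close> at 0 from that at 1 gives eta - alpha 2. The
  expansion of \<open>ladder_total 0 1\<close> contains alpha 2 with factor e_0, and the two cancel.
  All that is left besides X_1 and X_2 carries some e_r with r > 0 and falls under the
  induction.\<close>

lemma eta_eq:
  assumes "deg p \<le> M"
  shows "eta p = marked_e 1 p - marked_e 0 p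
    + e_mult 1 (\<lambda>p. alpha 0 p - marked_e 0 p - marked_e 1 p + marked_e 2 p - alpha 2 p) p
    + (\<Sum>s<M. e_mult (s + 2) (eta_term s) p)"
proof -
  have "ladder_total 0 1 p - ladder_total 0 2 p = alpha 2 p + e_mult 1 (marked_e 0) p + e_mult 1 (marked_e 1) p - e_mult 1 (marked_e 2) p
      + e_mult 1 (alpha 2) p - (\<Sum>s<M. e_mult (s + 2) (eta_term s) p)"
  proof -
    have "ladder_total 0 1 p - ladder_total 0 2 p = e_mult 0 (alpha 2) p + e_mult 1 (marked_e 0) p + e_mult 1 (marked_e 1) p - e_mult 1 (marked_e 2) p
      + e_mult 1 (alpha 2) p + (\<Sum>s<M. e_mult (s + 2) (marked_e (s + 1)) p + e_mult (s + 2) (marked_e (s + 2)) p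
         - e_mult (s + 2) (marked_e (s + 3)) p - e_mult (s + 2) (marked_e s) p
        + of_nat (s + 1) * e_mult (s + 2) (alpha (s + 2)) p - of_nat s * e_mult (s + 2) (alpha (s + 3)) p
        + of_nat s * e_mult (s + 2) (alpha (s + 1)) p - of_nat (s + 1) * e_mult (s + 2) (alpha s) p)"
      unfolding ladder_total_0_expand[OF order_refl assms] ladder_total_0_expand[OF one_le_numeral assms]
      by (rule eta_aux) (use assms in \<open>auto simp: e_mult_alpha_eq_0 e_mult_marked_e_eq_0\<close>)
    also have "(\<Sum>s<M. e_mult (s + 2) (marked_e (s + 1)) p + e_mult (s + 2) (marked_e (s + 2)) p
         - e_mult (s + 2) (marked_e (s + 3)) p - e_mult (s + 2) (marked_e s) p
        + of_nat (s + 1) * e_mult (s + 2) (alpha (s + 2)) p - of_nat s * e_mult (s + 2) (alpha (s + 3)) p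
        + of_nat s * e_mult (s + 2) (alpha (s + 1)) p - of_nat (s + 1) * e_mult (s + 2) (alpha s) p)
      = - (\<Sum>s<M. e_mult (s + 2) (eta_term s) p)"
      unfolding sum_negf[symmetric] e_mult_eta_term by (rule sum.cong) (auto simp: algebra_simps)
    finally show ?thesis by simp
  qed
  then show ?thesis
    using alpha_diff[of 0 p] alpha_diff[of 1 p]
    by (simp add: eta_def e_mult_linear numeral_2_eq_2)
qed

section \<open>The induction invariant and its consequences\<close>

lemma e_mult_nonneg:
  assumes "0 < r" "\<And>p'. size (fst p') < size (fst p) \<Longrightarrow> 0 \<le> f p'"
  shows "0 \<le> e_mult r f p"
  using e_mult_mono[of r p "\<lambda>_. 0" f] assms by (simp add: e_mult_zero)

lemma marked_e_nonneg [simp]: "0 \<le> marked_e i p"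
  by (simp add: marked_e_def)

lemma e_mult_marked_e_nonneg [simp]: "0 \<le> e_mult r (marked_e i) p"
  by (simp add: e_mult_def)

text \<open>What remains of alpha k - alpha (k+1) after its explicit terms. The last two summands
  telescope in k, so adding up gaps costs a single e_{k+1} X_1. In \<open>gap_step\<close> the final
  one offsets the deficit in eta >= -X_1.\<close>

definition gap :: "nat \<Rightarrow> nat multiset \<times> nat \<Rightarrow> rat" where
  "gap k p = alpha k p - alpha (Suc k) p - marked_e k p - (of_nat k - 1) * e_mult (Suc k) (alpha 0) p
     - e_mult (Suc k) (marked_e 0) p + e_mult (Suc (Suc k)) (marked_e 0) p"

lemma gap_eq_ladder_total: "gap k p = ladder_total 0 (Suc k) p - e_mult (Suc k) (marked_e 0) p + e_mult (Suc (Suc k)) (marked_e 0) p"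
  using alpha_diff[of k p] by (simp add: gap_def)

lemma gap_eq_0: "deg p \<le> k \<Longrightarrow> gap k p = 0"
  by (simp add: gap_def alpha_eq_0 e_mult_eq_0 marked_e_eq_0)

text \<open>The comparison of gaps two apart is needed because \<open>eta_term s\<close> contains
  (s+1) gap s - s gap (s+2). The upper bound on eta says that alpha 0 + alpha 1 is at most 3 (alpha
  0 + e_1 alpha 0 + e_2 alpha 0 + alpha 2).\<close>

definition good :: "nat multiset \<times> nat \<Rightarrow> bool" where
  "good p \<longleftrightarrow> (\<forall>k\<ge>2. 0 \<le> gap k p \<and> marked_e (k + 2) p + gap (k + 2) p \<le> gap k p)
     \<and> 0 \<le> eta p + marked_e 0 p
     \<and> eta p \<le> 3 * alpha 0 p + 6 * e_mult 1 (alpha 0) p + 6 * e_mult 2 (alpha 0) p + 6 * alpha 2 p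
     \<and> 0 \<le> alpha 0 p \<and> (\<forall>l>0. 0 \<le> e_mult l (alpha 0) p)"

text \<open>The definition of \<open>gap\<close> is summed over all indices from k on. In the
  shifted quantity a the X_1 corrections telescope, and only nonnegative terms are then
  dropped.\<close>

lemma alpha_lower:
  assumes k: "1 \<le> k" and S: "finite S" "S \<subseteq> {k<..}" and u: "\<And>l. k \<le> l \<Longrightarrow> 0 \<le> gap l p"
    and e: "\<And>l. 0 < l \<Longrightarrow> 0 \<le> e_mult l (alpha 0) p"
  shows "marked_e k p + gap k p + (\<Sum>l\<in>S. (of_nat l - 2) * e_mult l (alpha 0) p) \<le> alpha k p"
proof -
  define a where "a j = alpha j p - e_mult (Suc j) (marked_e 0) p" for j
  define c where "c l = (of_nat l - 2) * e_mult l (alpha 0) p" for l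
  have step: "a j = marked_e j p + gap j p + c (Suc j) + a (Suc j)" for j
    by (simp add: a_def c_def gap_def)
  have tel: "a k = (\<Sum>t<N. marked_e (k + t) p + gap (k + t) p + c (Suc (k + t))) + a (k + N)" for N
  proof (induction N)
    case (Suc N)
    then show ?case using step[of "k + N"] by simp
  qed simp
  define N where "N = deg p + Suc (Max (insert 0 S))"
  have "Max (insert 0 S) < N" by (simp add: N_def)
  have SN: "S \<subseteq> (\<lambda>t. Suc (k + t)) ` {..<N}"
  proof
    fix l assume "l \<in> S"
    then have "l \<le> Max (insert 0 S)" "k < l" using S by auto
    then show "l \<in> (\<lambda>t. Suc (k + t)) ` {..<N}"
      by (intro image_eqI[of _ _ "l - Suc k"]) (auto simp: N_def)
  qed
  have "a (k + N) = 0" by (simp add: a_def N_def alpha_eq_0 e_mult_eq_0)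
  then have "a k = (\<Sum>t<N. marked_e (k + t) p) + (\<Sum>t<N. gap (k + t) p) + (\<Sum>t<N. c (Suc (k + t)))"
    using tel[of N] by (simp add: sum.distrib)
  moreover have "marked_e (k + 0) p \<le> (\<Sum>t<N. marked_e (k + t) p)"
    by (rule member_le_sum) (auto simp: N_def)
  moreover have "gap (k + 0) p \<le> (\<Sum>t<N. gap (k + t) p)"
    by (rule member_le_sum) (auto simp: N_def u)
  moreover have "(\<Sum>l\<in>S. c l) \<le> (\<Sum>l\<in>(\<lambda>t. Suc (k + t)) ` {..<N}. c l)"
    by (rule sum_mono2) (use SN k e in \<open>auto simp: c_def\<close>)
  moreover have "(\<Sum>l\<in>(\<lambda>t. Suc (k + t)) ` {..<N}. c l) = (\<Sum>t<N. c (Suc (k + t)))"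
    by (subst sum.reindex) (auto simp: inj_on_def)
  moreover have "a k \<le> alpha k p" by (simp add: a_def)
  ultimately show ?thesis by (simp add: c_def)
qed

lemma alpha0_lower:
  assumes "finite S" "finite T" "0 \<notin> S" and alpha: "\<And>k. 2 \<le> k \<Longrightarrow> 0 \<le> alpha k p"
  shows "(\<Sum>t\<in>S. of_nat t * alpha (Suc t) p) + (\<Sum>i\<in>T. marked_e i p) \<le> alpha 0 p"
proof -
  define M where "M = deg p + Suc (Max (insert 0 S) + Max (insert 0 T))"
  have M: "t \<le> M" if "t \<in> S" for t
  proof -
    have "t \<le> Max (insert 0 S)" using that assms(1) by (intro Max_ge) auto
    then show ?thesis by (simp add: M_def)
  qed
  have M': "t < M" if "t \<in> T" for t
  proof -
    have "t \<le> Max (insert 0 T)" using that assms(2) by (intro Max_ge) auto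
    then show ?thesis by (simp add: M_def)
  qed
  have "alpha 0 p = (\<Sum>t=1..M. of_nat t * alpha (Suc t) p) + (\<Sum>i<M. marked_e i p)"
    by (rule alpha_0) (simp add: M_def)
  moreover have "(\<Sum>t\<in>S. of_nat t * alpha (Suc t) p) \<le> (\<Sum>t=1..M. of_nat t * alpha (Suc t) p)"
    by (rule sum_mono2) (use M assms in \<open>auto simp: Suc_le_eq intro: gr0I\<close>)
  moreover have "(\<Sum>i\<in>T. marked_e i p) \<le> (\<Sum>i<M. marked_e i p)"
    by (rule sum_mono2) (use M' in auto)
  ultimately show ?thesis by linarith
qed

lemma good_alpha:
  assumes "good p" "2 \<le> k"
  shows "0 \<le> alpha k p"
  using alpha_lower[of k "{}" p] assms by (auto simp: good_def intro: order_trans[rotated] add_nonneg_nonneg)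

lemma good_alpha_lower:
  assumes "good p" "2 \<le> k" "finite S" "S \<subseteq> {k<..}"
  shows "(\<Sum>l\<in>S. (of_nat l - 2) * e_mult l (alpha 0) p) \<le> alpha k p"
proof -
  have "0 \<le> marked_e k p + gap k p" using assms by (auto simp: good_def intro: add_nonneg_nonneg)
  moreover have "marked_e k p + gap k p + (\<Sum>l\<in>S. (of_nat l - 2) * e_mult l (alpha 0) p) \<le> alpha k p"
    by (rule alpha_lower) (use assms in \<open>auto simp: good_def\<close>)
  ultimately show ?thesis by linarith
qed

lemma good_alpha0_lower:
  assumes "good p" "finite S" "finite T" "0 \<notin> S"
  shows "(\<Sum>t\<in>S. of_nat t * alpha (Suc t) p) + (\<Sum>i\<in>T. marked_e i p) \<le> alpha 0 p"
  using alpha0_lower[of S T p] good_alpha[OF assms(1)] assms by blast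

lemma good_alpha_1_upper:
  assumes "good p"
  shows "alpha 1 p \<le> 2 * alpha 0 p + 3 * e_mult 1 (alpha 0) p + 3 * e_mult 2 (alpha 0) p + 3 * alpha 2 p"
  using assms by (auto simp: good_def eta_def)

lemma good_alpha_1:
  assumes "good p"
  shows "0 \<le> alpha 1 p"
  using assms good_alpha0_lower[OF assms, of "{}" "{0}"] by (auto simp: good_def eta_def)

section \<open>Positivity and monotonicity of the gaps\<close>

lemma sum_triangle: "(\<Sum>i=1..M. \<Sum>q=Suc i..M. h q) = (\<Sum>q=1..M. (of_nat q - 1) * h q)" for h :: "nat \<Rightarrow> rat"
proof (induction M)
  case (Suc M)
  have "(\<Sum>i=1..M. \<Sum>q=Suc i..Suc M. h q) = (\<Sum>i=1..M. (\<Sum>q=Suc i..M. h q) + h (Suc M))"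
    by (rule sum.cong) auto
  then show ?case using Suc by (simp add: sum.distrib)
qed simp

text \<open>The total cofactor of e_{K+q} in the lower bound for gap (K-1). Its first summand comes
  from bounding alpha (K+1), alpha (K+2), ... below by multiples of e_{K+q} alpha 0; the others
  stand in the expansion.\<close>

definition gap_term :: "nat \<Rightarrow> nat \<Rightarrow> nat multiset \<times> nat \<Rightarrow> rat" where
  "gap_term K q p = (of_nat q - 1) * (of_nat (K + q) - 2) * (alpha 0 p + e_mult 1 (alpha 0) p + e_mult 2 (alpha 0) p)
     + marked_e q p + of_nat (K + q - 1) * alpha q p - (\<Sum>r\<le>q. alpha r p) + (if q = 1 then marked_e 0 p else 0)"

text \<open>For q = 1 the term is (K-3) alpha 1 plus eta + X_1 plus X_2. For q = 2 it is at least K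
  (X + alpha 2) - alpha 0 - alpha 1, with X as in the proof, and K >= 3 meets the constant in the
  bound on alpha 1. For larger q the factor of X alone suffices.\<close>

lemma gap_term_nonneg:
  assumes g: "good p" and K: "3 \<le> K" and q: "1 \<le> q"
  shows "0 \<le> gap_term K q p"
proof -
  note g' = g[unfolded good_def]
  have e: "0 \<le> e_mult 1 (alpha 0) p" "0 \<le> e_mult 2 (alpha 0) p" using g' by auto
  define X where "X = alpha 0 p + e_mult 1 (alpha 0) p + e_mult 2 (alpha 0) p"
  have X: "0 \<le> X" "alpha 0 p \<le> X" using e g' by (auto simp: X_def)
  have u: "alpha 1 p \<le> 3 * X - alpha 0 p + 3 * alpha 2 p" using good_alpha_1_upper[OF g] by (simp add: X_def)
  consider "q = 1" | "q = 2" | "3 \<le> q" using q by linarith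
  then show ?thesis
  proof cases
    case 1
    have "0 \<le> (of_nat K - 3) * alpha 1 p" using K good_alpha_1[OF g] by simp
    then show ?thesis using 1 g' marked_e_nonneg[of 1 p] by (simp add: gap_term_def eta_def algebra_simps del: marked_e_nonneg)
  next
    case 2
    have "3 * (X + alpha 2 p) \<le> of_nat K * (X + alpha 2 p)"
      by (rule mult_right_mono) (use K X good_alpha[OF g, of 2] in auto)
    moreover have "{..2::nat} = {0,1,2}" by auto
    ultimately show ?thesis using 2 u marked_e_nonneg[of 2 p]
      unfolding gap_term_def X_def[symmetric] by (simp add: algebra_simps del: marked_e_nonneg)
  next
    case 3
    have "(\<Sum>r=2..q. alpha r p) = (\<Sum>t=1..q-1. alpha (Suc t) p)"
      by (rule sum.reindex_bij_witness[of _ Suc "\<lambda>r. r - 1"]) (use 3 in auto)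
    also have "\<dots> \<le> (\<Sum>t=1..q-1. of_nat t * alpha (Suc t) p)"
    proof (rule sum_mono)
      fix t assume "t \<in> {1..q-1}"
      then show "alpha (Suc t) p \<le> of_nat t * alpha (Suc t) p"
        using mult_right_mono[of 1 "of_nat t" "alpha (Suc t) p"] good_alpha[OF g, of "Suc t"] by simp
    qed
    also have "\<dots> \<le> alpha 0 p" using good_alpha0_lower[OF g, of "{1..q-1}" "{}"] by simp
    finally have s: "(\<Sum>r=2..q. alpha r p) \<le> alpha 0 p" .
    have "{..q} = insert 0 (insert 1 {2..q})" using 3 by auto
    then have s: "(\<Sum>r\<le>q. alpha r p) \<le> 2 * alpha 0 p + alpha 1 p" using s by simp
    \<comment> \<open>The subtracted sum is at most 2 alpha 0 + alpha 1, which is at most alpha 0 +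
      3 X + 3 alpha 2 and so at most 7 X; q and K are at least 3, which gives the factors 2 and
      4.\<close>
    have "(8::rat) = 2 * 4" by simp
    also have "\<dots> \<le> (of_nat q - 1) * (of_nat (K + q) - 2)"
      by (rule mult_mono) (use 3 K in auto)
    finally have "8 * X \<le> (of_nat q - 1) * (of_nat (K + q) - 2) * X" using X by (intro mult_right_mono)
    moreover have "alpha 2 p \<le> alpha 0 p" using good_alpha0_lower[OF g, of "{1}" "{}"] by (simp add: numeral_2_eq_2)
    moreover have "0 \<le> of_nat (K + q - 1) * alpha q p" using good_alpha[OF g, of q] 3 by simp
    ultimately show ?thesis using 3 u s X marked_e_nonneg[of q p] unfolding gap_term_def X_def[symmetric] by (simp del: marked_e_nonneg)
  qed
qed

text \<open>\<open>alpha_lower\<close> is used at each K + i. The term e_{K+q} alpha 0 is collected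
  for every i < q, hence the factor q - 1; a gap is kept only for i = 1.\<close>

lemma sum_alpha_lower:
  assumes u: "\<And>l. K < l \<Longrightarrow> 0 \<le> gap l p" and e: "\<And>l. 0 < l \<Longrightarrow> 0 \<le> e_mult l (alpha 0) p"
  shows "(if 1 \<le> M then marked_e (Suc K) p + gap (Suc K) p else 0)
     + (\<Sum>q=1..M. (of_nat q - 1) * (of_nat (K + q) - 2) * e_mult (K + q) (alpha 0) p) \<le> (\<Sum>q=1..M. alpha (K + q) p)"
proof -
  define h where "h q = (of_nat (K + q) - 2) * e_mult (K + q) (alpha 0) p" for q
  have "(\<Sum>i=1..M. (if i = 1 then marked_e (Suc K) p + gap (Suc K) p else 0) + (\<Sum>q=Suc i..M. h q))
      \<le> (\<Sum>i=1..M. alpha (K + i) p)"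
  proof (rule sum_mono)
    fix i assume i: "i \<in> {1..M}"
    have "marked_e (K + i) p + gap (K + i) p + (\<Sum>l\<in>(+) K ` {Suc i..M}. (of_nat l - 2) * e_mult l (alpha 0) p) \<le> alpha (K + i) p"
      by (rule alpha_lower) (use i u e in auto)
    moreover have "(\<Sum>l\<in>(+) K ` {Suc i..M}. (of_nat l - 2) * e_mult l (alpha 0) p) = (\<Sum>q=Suc i..M. h q)"
      by (subst sum.reindex) (auto simp: h_def)
    moreover have "0 \<le> marked_e (K + i) p + gap (K + i) p" using i u by (intro add_nonneg_nonneg) auto
    ultimately show "(if i = 1 then marked_e (Suc K) p + gap (Suc K) p else 0) + (\<Sum>q=Suc i..M. h q) \<le> alpha (K + i) p"
      by auto
  qed
  moreover have "(\<Sum>i=1..M. (if i = 1 then marked_e (Suc K) p + gap (Suc K) p else 0)) =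
      (if 1 \<le> M then marked_e (Suc K) p + gap (Suc K) p else 0)"
    by (simp add: sum.delta)
  moreover have "(\<Sum>q=1..M. (of_nat q - 1) * (of_nat (K + q) - 2) * e_mult (K + q) (alpha 0) p) = (\<Sum>i=1..M. \<Sum>q=Suc i..M. h q)"
    unfolding sum_triangle by (simp add: h_def mult.assoc)
  ultimately show ?thesis unfolding sum.distrib by linarith
qed

text \<open>The positive part of the expansion contains (1 + e_1 + e_2) W. At p itself, where the
  gaps beyond K are known, W yields gap (K+1) and V; under e_1 and e_2 the bound of W by V is
  available by induction. The three copies of V pay for the negative terms, as
  \<open>gap_term_nonneg\<close> shows under each e_{K+q}.\<close>

lemma gap_step:
  assumes IH: "\<And>p'. size (fst p') < size (fst p) \<Longrightarrow> good p'"
    and K: "3 \<le> K" and u: "\<And>l. K < l \<Longrightarrow> 0 \<le> gap l p"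
  shows "marked_e (K + 1) p + gap (K + 1) p \<le> gap (K - 1) p"
proof -
  define M where "M = deg p"
  have E0: "0 \<le> e_mult l (alpha 0) p" if "0 < l" for l
    by (rule e_mult_nonneg) (use that IH in \<open>auto simp: good_def\<close>)
  have En: "0 \<le> e_mult l (alpha q) p" if "0 < l" "2 \<le> q" for l q
    by (rule e_mult_nonneg) (use that IH good_alpha in auto)
  define W where "W p' = (\<Sum>q=1..M. alpha (K + q) p')" for p'
  define V where "V p' = (\<Sum>q=1..M. (of_nat q - 1) * (of_nat (K + q) - 2) * e_mult (K + q) (alpha 0) p')" for p'
  have W0: "marked_e (Suc K) p + gap (Suc K) p + V p \<le> W p"
  proof (cases "1 \<le> M")
    case True
    then show ?thesis using sum_alpha_lower[of K p M] u E0 by (simp add: W_def V_def)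
  next
    case False
    then show ?thesis by (simp add: W_def V_def M_def gap_eq_0 marked_e_eq_0)
  qed
  have WE: "e_mult l V p \<le> e_mult l W p" if "0 < l" for l
  proof (rule e_mult_mono[OF that])
    fix p' :: "nat multiset \<times> nat" assume "size (fst p') < size (fst p)"
    then have g: "good p'" by (rule IH)
    have "(if 1 \<le> M then marked_e (Suc K) p' + gap (Suc K) p' else 0) + V p' \<le> W p'"
      unfolding W_def V_def by (rule sum_alpha_lower) (use g K in \<open>auto simp: good_def\<close>)
    moreover have "0 \<le> gap (Suc K) p'" using g K by (simp add: good_def)
    ultimately show "V p' \<le> W p'" using marked_e_nonneg[of "Suc K" p'] by (simp split: if_splits del: marked_e_nonneg)
  qed
  define X where "X q p' = marked_e q p' + of_nat (K + q - 1) * alpha q p' - (\<Sum>r\<le>q. alpha r p')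
     + (if q = 1 then marked_e 0 p' else 0)" for q p'
  have EX: "e_mult (K + q) (X q) p = e_mult (K + q) (marked_e q) p + of_nat (K + q - 1) * e_mult (K + q) (alpha q) p
     - (\<Sum>r\<le>q. e_mult (K + q) (alpha r) p) + (if q = 1 then e_mult (K + 1) (marked_e 0) p else 0)" for q
    unfolding X_def by (simp add: e_mult_linear)
  have yX: "gap_term K q = (\<lambda>p'. (of_nat q - 1) * (of_nat (K + q) - 2) * (alpha 0 p' + e_mult 1 (alpha 0) p' + e_mult 2 (alpha 0) p') + X q p')" for q
    by (simp add: fun_eq_iff gap_term_def X_def)
  have Ey: "e_mult (K + q) (gap_term K q) p = (of_nat q - 1) * (of_nat (K + q) - 2) *
      (e_mult (K + q) (alpha 0) p + e_mult 1 (e_mult (K + q) (alpha 0)) p + e_mult 2 (e_mult (K + q) (alpha 0)) p) + e_mult (K + q) (X q) p" for q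
    unfolding yX e_mult_add e_mult_scale e_mult_commute[of "K + q"] ..
  have EV: "e_mult l V p = (\<Sum>q=1..M. (of_nat q - 1) * (of_nat (K + q) - 2) * e_mult l (e_mult (K + q) (alpha 0)) p)" for l
    unfolding V_def e_mult_sum e_mult_scale ..
  have sum_y: "V p + e_mult 1 V p + e_mult 2 V p + (\<Sum>q=1..M. e_mult (K + q) (X q) p) = (\<Sum>q=1..M. e_mult (K + q) (gap_term K q) p)"
    unfolding Ey EV unfolding V_def sum.distrib[symmetric] by (rule sum.cong) (auto simp: algebra_simps)
  have "0 \<le> (\<Sum>q=1..M. e_mult (K + q) (gap_term K q) p)"
    by (intro sum_nonneg e_mult_nonneg) (use K IH gap_term_nonneg in auto)
  have shift: "(\<Sum>s<M. F s) = F 0 + (\<Sum>q=1..M. F q)" if "F M = 0" for F :: "nat \<Rightarrow> rat"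
  proof -
    have "(\<Sum>q=1..M. F q) = (\<Sum>s<M. F (Suc s))"
      by (rule sum.reindex_bij_witness[of _ Suc "\<lambda>q. q - 1"]) auto
    then show ?thesis using sum_shift[of F M] that by simp
  qed
  have shift': "(\<Sum>s<M. F (Suc s)) = (\<Sum>q=1..M. F q)" for F :: "nat \<Rightarrow> rat"
    by (rule sum.reindex_bij_witness[of _ "\<lambda>q. q - 1" Suc]) auto
  have p1: "(\<Sum>s<M. e_mult (K + s) (marked_e s) p) = e_mult K (marked_e 0) p + (\<Sum>q=1..M. e_mult (K + q) (marked_e q) p)"
    by (subst shift) (auto simp: M_def intro!: e_mult_marked_e_eq_0)
  have p2: "(\<Sum>s<M. of_nat s * e_mult (Suc s) (alpha (K + s)) p) = (\<Sum>q=1..M. of_nat q * e_mult (Suc q) (alpha (K + q)) p)"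
    by (subst shift) (auto simp: M_def e_mult_alpha_eq_0)
  have p3: "(\<Sum>s<M. of_nat (K + s) * e_mult (Suc (K + s)) (alpha (Suc s)) p) = (\<Sum>q=1..M. of_nat (K + q - 1) * e_mult (K + q) (alpha q) p)"
    using shift'[of "\<lambda>q. of_nat (K + q - 1) * e_mult (K + q) (alpha q) p"] by simp
  have p4: "0 \<le> (\<Sum>s<M. e_mult (Suc s) (marked_e (K + s)) p)"
    by (intro sum_nonneg) simp
  have p5: "(\<Sum>q=1..M. (if q = 1 then e_mult (K + 1) (marked_e 0) p else 0)) = e_mult (K + 1) (marked_e 0) p"
    using K by (simp add: sum.delta M_def e_mult_eq_0)
  \<comment> \<open>For q = 1 the factors 1 and e_1 come from the inner sum and e_2 from q e_{q+1};
    for q >= 2 the inner sum contains all three.\<close>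
  have p6: "W p + e_mult 1 W p + e_mult 2 W p \<le>
      (\<Sum>q=1..M. of_nat q * e_mult (Suc q) (alpha (K + q)) p + (\<Sum>r\<le>q. e_mult r (alpha (K + q)) p))"
    unfolding W_def e_mult_sum sum.distrib[symmetric]
  proof (rule sum_mono)
    fix q assume "q \<in> {1..M}"
    then consider "q = 1" | "2 \<le> q" by fastforce
    then show "alpha (K + q) p + e_mult 1 (alpha (K + q)) p + e_mult 2 (alpha (K + q)) p
        \<le> of_nat q * e_mult (Suc q) (alpha (K + q)) p + (\<Sum>r\<le>q. e_mult r (alpha (K + q)) p)"
    proof cases
      case 1
      then show ?thesis by (simp add: numeral_2_eq_2)
    next
      case 2
      have "(\<Sum>r\<in>{0,1,2}. e_mult r (alpha (K + q)) p) \<le> (\<Sum>r\<le>q. e_mult r (alpha (K + q)) p)"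
        by (rule sum_mono2) (use 2 K En in auto)
      moreover have "0 \<le> of_nat q * e_mult (Suc q) (alpha (K + q)) p" using En[of "Suc q" "K + q"] K by simp
      ultimately show ?thesis by simp
    qed
  qed
  have u1: "gap (K - 1) p = ladder_total 0 K p - e_mult K (marked_e 0) p + e_mult (K + 1) (marked_e 0) p"
    using gap_eq_ladder_total[of "K - 1" p] K by simp
  have u2: "ladder_total 0 K p = (\<Sum>s<M. e_mult (K + s) (marked_e s) p) + (\<Sum>s<M. e_mult (Suc s) (marked_e (K + s)) p)
      + (\<Sum>s<M. of_nat s * e_mult (Suc s) (alpha (K + s)) p) + (\<Sum>s<M. of_nat (K + s) * e_mult (Suc (K + s)) (alpha (Suc s)) p)
    + (\<Sum>q=1..M. \<Sum>r\<le>q. e_mult r (alpha (K + q)) p) - (\<Sum>q=1..M. \<Sum>r\<le>q. e_mult (K + q) (alpha r) p)"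
    using ladder_total_0_expand[of K p M] K by (simp add: M_def sum.distrib sum_subtractf)
  have "W p + e_mult 1 W p + e_mult 2 W p + (\<Sum>q=1..M. e_mult (K + q) (X q) p) \<le> gap (K - 1) p"
    using u1 u2 p6 p4 unfolding p1 p2 p3 EX sum.distrib sum_subtractf p5 by linarith
  then show ?thesis
    using W0 WE[of 1] WE[of 2] sum_y \<open>0 \<le> (\<Sum>q=1..M. e_mult (K + q) (gap_term K q) p)\<close> by simp
qed

text \<open>Downward induction on k at fixed p, starting where the degree forces gaps to vanish:
  \<open>gap_step\<close> needs the gaps at p above k + 1.\<close>

lemma gap_good:
  assumes IH: "\<And>p'. size (fst p') < size (fst p) \<Longrightarrow> good p'" and "2 \<le> k"
  shows "0 \<le> gap k p \<and> marked_e (k + 2) p + gap (k + 2) p \<le> gap k p"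
  using \<open>2 \<le> k\<close>
proof (induction "deg p - k" arbitrary: k rule: less_induct)
  case less
  show ?case
  proof (cases "deg p \<le> k")
    case True
    then show ?thesis by (simp add: gap_eq_0 marked_e_eq_0)
  next
    case False
    have u: "0 \<le> gap l p" if "Suc k < l" for l
      using less.hyps[of l] less.prems that False by auto
    have "marked_e (k + 2) p + gap (k + 2) p \<le> gap k p"
      using gap_step[OF IH, of p "Suc k"] u less.prems by simp
    moreover have "0 \<le> gap (k + 2) p" using u by simp
    ultimately show ?thesis using marked_e_nonneg[of "k + 2" p] by linarith
  qed
qed

section \<open>Two-sided bounds on eta\<close>

lemma numeral_4_5_eq: "4 = Suc (Suc (Suc (Suc 0)))" "5 = Suc (Suc (Suc (Suc (Suc 0))))"
  by simp_all

lemma alpha_nonneg: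
  assumes "2 \<le> k" "\<And>l. k \<le> l \<Longrightarrow> 0 \<le> gap l p" "\<And>l. 0 < l \<Longrightarrow> 0 \<le> e_mult l (alpha 0) p"
  shows "0 \<le> alpha k p"
proof -
  have "marked_e k p + gap k p + (\<Sum>l\<in>{}. (of_nat l - 2) * e_mult l (alpha 0) p) \<le> alpha k p"
    by (rule alpha_lower) (use assms in auto)
  then show ?thesis using assms(2)[of k] marked_e_nonneg[of k p] unfolding sum.empty by linarith
qed

text \<open>With d_k = alpha k - alpha (k+1), the alpha part of \<open>eta_term s\<close> is (s+1)
  d_s + d_{s+1} - s d_{s+2}.\<close>

lemma eta_term_eq_gap:
  "eta_term s p = (of_nat s + 2) * marked_e s p - (of_nat s + 1) * marked_e (s + 2) p + marked_e (s + 3) p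
     + gap (s + 1) p + (of_nat s + 1) * gap s p - of_nat s * gap (s + 2) p
     + of_nat s * (e_mult (s + 2) (alpha 0) p - e_mult (s + 2) (marked_e 0) p)
     + (of_nat s + 1) * (of_nat s - 1) * e_mult (s + 1) (alpha 0) p + (of_nat s + 1) * e_mult (s + 1) (marked_e 0) p
     - of_nat s * (of_nat s + 1) * e_mult (s + 3) (alpha 0) p - (of_nat s + 1) * e_mult (s + 3) (marked_e 0) p
     + of_nat s * e_mult (s + 4) (marked_e 0) p"
  by (simp add: eta_term_def gap_def algebra_simps numeral_2_eq_2 numeral_3_eq_3 numeral_4_5_eq)

text \<open>The comparison of gap s with gap (s+2), multiplied by s + 1, pays both for -s gap (s+2)
  and for the negative multiple of \<open>marked_e (s + 2)\<close>. This is why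
  \<open>marked_e\<close> appears in that comparison.\<close>

lemma eta_term_lower:
  assumes g: "good p" and s: "2 \<le> s"
    and e: "e_mult (s + 2) (marked_e 0) p \<le> e_mult (s + 2) (alpha 0) p"
  shows "(of_nat s + 1) * (of_nat s - 1) * e_mult (s + 1) (alpha 0) p + (of_nat s + 1) * e_mult (s + 1) (marked_e 0) p
     - of_nat s * (of_nat s + 1) * e_mult (s + 3) (alpha 0) p - (of_nat s + 1) * e_mult (s + 3) (marked_e 0) p \<le> eta_term s p"
proof -
  have u: "0 \<le> gap (s + 1) p" "0 \<le> gap (s + 2) p" "marked_e (s + 2) p + gap (s + 2) p \<le> gap s p"
    using g s by (auto simp: good_def)
  have "(of_nat s + 1) * (marked_e (s + 2) p + gap (s + 2) p) \<le> (of_nat s + 1) * gap s p"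
    using u by (intro mult_left_mono) auto
  moreover have "0 \<le> of_nat s * (e_mult (s + 2) (alpha 0) p - e_mult (s + 2) (marked_e 0) p)"
    using e by simp
  moreover have "0 \<le> (of_nat s + 2) * marked_e s p" "0 \<le> marked_e (s + 3) p"
    "0 \<le> of_nat s * e_mult (s + 4) (marked_e 0) p" by simp_all
  ultimately show ?thesis unfolding eta_term_eq_gap[of s p] distrib_left distrib_right mult_1 using u by linarith
qed

text \<open>The factor s is l - 2 for l = s + 2, the weight of e_l alpha 0 in the lower bound for
  alpha 2; in \<open>eta_upper\<close> these bounds therefore add up to a multiple of alpha
  2.\<close>

lemma eta_term_upper:
  assumes g: "good p" and s: "2 \<le> s"
  shows "eta_term s p \<le> 9 * of_nat s * alpha 0 p"
proof -
  have a: "(of_nat (s - 1) * alpha s p + of_nat (s + 2) * alpha (s + 3) p) + (marked_e s p + marked_e (s + 3) p) \<le> alpha 0 p"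
    using good_alpha0_lower[OF g, of "{s - 1, s + 2}" "{s, s + 3}"] s by (simp add: numeral_3_eq_3)
  have n: "0 \<le> alpha s p" "0 \<le> alpha (s + 1) p" "0 \<le> alpha (s + 2) p" "0 \<le> alpha (s + 3) p"
    using s by (auto intro: good_alpha[OF g])
  \<comment> \<open>Here s >= 2 gives s + 1 \<le> 3 (s - 1), and s - 1 is the weight of alpha s in
    alpha 0.\<close>
  have "of_nat (s + 1) * alpha s p \<le> (3 * of_nat (s - 1)) * alpha s p"
    using s n by (intro mult_right_mono) (auto simp: of_nat_diff)
  moreover have "of_nat s * alpha (s + 3) p \<le> of_nat (s + 2) * alpha (s + 3) p"
    using n by (intro mult_right_mono) auto
  moreover have "0 \<le> of_nat (s + 1) * alpha (s + 2) p" "0 \<le> of_nat s * alpha (s + 1) p" using n by auto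
  moreover have "0 \<le> of_nat (s + 2) * alpha (s + 3) p" using n by simp
  moreover note marked_e_nonneg[of s p] marked_e_nonneg[of "s + 1" p] marked_e_nonneg[of "s + 2" p] marked_e_nonneg[of "s + 3" p]
  ultimately have "eta_term s p \<le> 3 * alpha 0 p" using a unfolding eta_term_def mult.assoc by linarith
  also have "\<dots> \<le> 9 * of_nat s * alpha 0 p"
    using s g by (intro mult_right_mono) (auto simp: good_def)
  finally show ?thesis .
qed

text \<open>The slack 6 e_3 alpha 0, multiplied by e_2, cancels a cross term that the bound on
  \<open>eta_term 1\<close> produces under e_3. The slack in \<open>eta_head_bounds\<close> does the
  same with e_1.\<close>

lemma eta_term_0_bounds:
  assumes g: "good p"
  shows "0 \<le> eta_term 0 p" "eta_term 0 p + 6 * e_mult 3 (alpha 0) p \<le> 6 * alpha 0 p"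
proof -
  have 1: "alpha 2 p + (marked_e 1 p + marked_e 2 p) \<le> alpha 0 p"
    using good_alpha0_lower[OF g, of "{1}" "{1,2}"] by (simp add: numeral_2_eq_2)
  have 2: "alpha 2 p + (marked_e 0 p + marked_e 3 p) \<le> alpha 0 p"
    using good_alpha0_lower[OF g, of "{1}" "{0,3}"] by (simp add: numeral_2_eq_2)
  have 3: "e_mult 3 (alpha 0) p \<le> alpha 2 p"
    using good_alpha_lower[OF g, of 2 "{3}"] by simp
  note z = marked_e_nonneg[of 0 p] marked_e_nonneg[of 1 p] marked_e_nonneg[of 2 p] marked_e_nonneg[of 3 p]
  have b: "eta_term 0 p = marked_e 0 p - marked_e 1 p - marked_e 2 p + marked_e 3 p - alpha 2 p + alpha 0 p"
    by (simp add: eta_term_def numeral_2_eq_2 numeral_3_eq_3)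
  show "0 \<le> eta_term 0 p" "eta_term 0 p + 6 * e_mult 3 (alpha 0) p \<le> 6 * alpha 0 p"
    unfolding b using 1 2 3 z by linarith+
qed

text \<open>This summand contains 2 alpha 1 = eta + alpha 0, so both bounds on eta re-enter here, at
  pairs with fewer parts.\<close>

lemma eta_term_1_bounds:
  assumes g: "good p"
  shows "0 \<le> eta_term 1 p" "eta_term 1 p \<le> 9 * alpha 0 p + 6 * e_mult 1 (alpha 0) p + 6 * e_mult 2 (alpha 0) p"
proof -
  have 1: "alpha 2 p + 2 * alpha 3 p + (marked_e 0 p + marked_e 2 p + marked_e 3 p) \<le> alpha 0 p"
    using good_alpha0_lower[OF g, of "{1,2}" "{0,2,3}"] by (simp add: numeral_2_eq_2 numeral_3_eq_3)
  have 2: "alpha 2 p + 3 * alpha 4 p + (marked_e 1 p + marked_e 4 p) \<le> alpha 0 p"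
    using good_alpha0_lower[OF g, of "{1,3}" "{1,4}"] by (simp add: numeral_2_eq_2 numeral_3_eq_3 numeral_4_5_eq)
  have n: "0 \<le> alpha 3 p" "0 \<le> alpha 4 p" by (auto intro: good_alpha[OF g])
  have e: "0 \<le> eta p + marked_e 0 p" "eta p \<le> 3 * alpha 0 p + 6 * e_mult 1 (alpha 0) p + 6 * e_mult 2 (alpha 0) p + 6 * alpha 2 p"
    using g by (auto simp: good_def)
  note z = marked_e_nonneg[of 1 p] marked_e_nonneg[of 2 p] marked_e_nonneg[of 3 p] marked_e_nonneg[of 4 p]
  have b: "eta_term 1 p = marked_e 1 p - marked_e 2 p - marked_e 3 p + marked_e 4 p - 2 * alpha 3 p + alpha 4 p - alpha 2 p + (eta p + alpha 0 p)"
    by (simp add: eta_term_def eta_def numeral_2_eq_2 numeral_3_eq_3 numeral_4_5_eq)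
  show "0 \<le> eta_term 1 p" "eta_term 1 p \<le> 9 * alpha 0 p + 6 * e_mult 1 (alpha 0) p + 6 * e_mult 2 (alpha 0) p"
    unfolding b using 1 2 n e z by linarith+
qed

definition eta_head :: "nat multiset \<times> nat \<Rightarrow> rat" where
  "eta_head p = alpha 0 p - marked_e 0 p - marked_e 1 p + marked_e 2 p - alpha 2 p"

lemma eta_head_bounds:
  assumes g: "good p"
  shows "0 \<le> eta_head p" "eta_head p + 6 * e_mult 3 (alpha 0) p \<le> 6 * alpha 0 p"
proof -
  have 1: "alpha 2 p + (marked_e 0 p + marked_e 1 p) \<le> alpha 0 p"
    using good_alpha0_lower[OF g, of "{1}" "{0,1}"] by (simp add: numeral_2_eq_2)
  have 2: "alpha 2 p + marked_e 2 p \<le> alpha 0 p"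
    using good_alpha0_lower[OF g, of "{1}" "{2}"] by (simp add: numeral_2_eq_2)
  have 3: "e_mult 3 (alpha 0) p \<le> alpha 2 p"
    using good_alpha_lower[OF g, of 2 "{3}"] by simp
  note z = marked_e_nonneg[of 0 p] marked_e_nonneg[of 1 p] marked_e_nonneg[of 2 p]
  show "0 \<le> eta_head p" "eta_head p + 6 * e_mult 3 (alpha 0) p \<le> 6 * alpha 0 p"
    unfolding eta_head_def using 1 2 3 z by linarith+
qed

lemma eta_split:
  "eta p = marked_e 1 p - marked_e 0 p + e_mult 1 eta_head p + e_mult 2 (eta_term 0) p + e_mult 3 (eta_term 1) p
     + (\<Sum>s<deg p. e_mult (s + 4) (eta_term (s + 2)) p)"
  using eta_eq[of p "Suc (Suc (deg p))"]
  by (simp add: eta_head_def[abs_def] sum.lessThan_Suc_shift numeral_2_eq_2 numeral_3_eq_3 numeral_4_5_eq del: sum.lessThan_Suc)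

lemma telescope_le:
  fixes f c :: "nat \<Rightarrow> rat"
  assumes "\<And>s. c s - c (Suc s) \<le> f s"
  shows "c 0 - c N \<le> (\<Sum>s<N. f s)"
  using sum_mono[of "{..<N}" "\<lambda>s. c s - c (Suc s)" f] assms by (simp add: sum_lessThan_telescope')

text \<open>The negative part of each summand is absorbed by the next one, as \<open>e_mult r\<close> and \<open>e_mult (r + 1)\<close> commute.\<close>

lemma eta_lower:
  assumes IH: "\<And>p'. size (fst p') < size (fst p) \<Longrightarrow> good p'"
  shows "0 \<le> eta p + marked_e 0 p"
proof -
  have a0: "marked_e 0 p' \<le> alpha 0 p'" if "good p'" for p'
    using good_alpha0_lower[OF that, of "{}" "{0}"] by simp
  have nn: "0 \<le> e_mult r (e_mult s (alpha 0)) p" if "0 < r" "0 < s" for r s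
    by (rule e_mult_nonneg) (use that IH in \<open>auto simp: good_def\<close>)
  have nz: "0 \<le> e_mult r (e_mult s (marked_e 0)) p" if "0 < r" for r s
    by (rule e_mult_nonneg) (use that in auto)
  \<comment> \<open>The positive part of the bound from \<open>eta_term_lower\<close> at s + 2,
    multiplied by e_{s+4}; the negative part of summand s is at most c (s+1) in size.\<close>
  define c where "c s = (of_nat s + 3) * (of_nat s + 1) * e_mult (s + 4) (e_mult (s + 3) (alpha 0)) p
    + (of_nat s + 3) * e_mult (s + 4) (e_mult (s + 3) (marked_e 0)) p" for s
  have "c s - c (Suc s) \<le> e_mult (s + 4) (eta_term (s + 2)) p" for s
  proof -
    define A where "A = e_mult (s + 4) (e_mult (s + 5) (alpha 0)) p"
    define Z where "Z = e_mult (s + 4) (e_mult (s + 5) (marked_e 0)) p"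
    have A: "0 \<le> A" and Z: "0 \<le> Z" unfolding A_def Z_def by (auto intro: nn nz)
    have "e_mult (s + 4) (\<lambda>p. (of_nat s + 3) * (of_nat s + 1) * e_mult (s + 3) (alpha 0) p + (of_nat s + 3) * e_mult (s + 3) (marked_e 0) p
       - (of_nat s + 2) * (of_nat s + 3) * e_mult (s + 5) (alpha 0) p - (of_nat s + 3) * e_mult (s + 5) (marked_e 0) p) p
       \<le> e_mult (s + 4) (eta_term (s + 2)) p"
    proof (rule e_mult_mono)
      fix p' :: "nat multiset \<times> nat" assume p': "size (fst p') < size (fst p)"
      have "e_mult (s + 2 + 2) (marked_e 0) p' \<le> e_mult (s + 2 + 2) (alpha 0) p'"
        by (rule e_mult_mono) (use p' IH a0 in auto)
      from eta_term_lower[OF IH[OF p'] _ this]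
      show "(of_nat s + 3) * (of_nat s + 1) * e_mult (s + 3) (alpha 0) p' + (of_nat s + 3) * e_mult (s + 3) (marked_e 0) p'
       - (of_nat s + 2) * (of_nat s + 3) * e_mult (s + 5) (alpha 0) p' - (of_nat s + 3) * e_mult (s + 5) (marked_e 0) p'
       \<le> eta_term (s + 2) p'" by (simp add: add.commute add.left_commute numeral_2_eq_2 numeral_3_eq_3 numeral_4_5_eq)
    qed simp
    then have l: "(of_nat s + 3) * (of_nat s + 1) * e_mult (s + 4) (e_mult (s + 3) (alpha 0)) p + (of_nat s + 3) * e_mult (s + 4) (e_mult (s + 3) (marked_e 0)) p
       - (of_nat s + 2) * (of_nat s + 3) * A - (of_nat s + 3) * Z \<le> e_mult (s + 4) (eta_term (s + 2)) p"
      by (simp only: e_mult_linear A_def Z_def)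
    have "c (Suc s) = (of_nat s + 4) * (of_nat s + 2) * A + (of_nat s + 4) * Z"
      using e_mult_commute[of "s + 5" "s + 4" "alpha 0" p] e_mult_commute[of "s + 5" "s + 4" "marked_e 0" p]
      by (simp add: c_def A_def Z_def numeral_4_5_eq numeral_3_eq_3 algebra_simps)
    moreover have "(of_nat s + 2) * (of_nat s + 3) * A \<le> (of_nat s + 4) * (of_nat s + 2) * A"
      using A by (intro mult_right_mono) (auto simp: algebra_simps)
    moreover have "(of_nat s + 3) * Z \<le> (of_nat s + 4) * Z"
      using Z by (intro mult_right_mono) auto
    ultimately show ?thesis using l unfolding c_def[of s] by linarith
  qed
  then have "c 0 - c (deg p) \<le> (\<Sum>s<deg p. e_mult (s + 4) (eta_term (s + 2)) p)" by (rule telescope_le)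
  moreover have "c (deg p) = 0" by (simp add: c_def e_mult_eq_0)
  moreover have "0 \<le> c 0" using nn[of 4 3] nz[of 4 3] by (simp add: c_def)
  moreover have "0 \<le> e_mult 1 eta_head p" "0 \<le> e_mult 2 (eta_term 0) p" "0 \<le> e_mult 3 (eta_term 1) p"
    by (auto intro!: e_mult_nonneg eta_head_bounds eta_term_0_bounds eta_term_1_bounds IH simp del: One_nat_def)
  ultimately show ?thesis using eta_split[of p] marked_e_nonneg[of 1 p] by linarith
qed

text \<open>The cross terms e_3 e_1 alpha 0 and e_3 e_2 alpha 0 cancel among the first three
  summands. What then remains under e_3, e_4, ... is at most 9 alpha 2; six of these stay, three are
  bounded by alpha 0, and that last bound also leaves room for X_2.\<close>

lemma eta_upper:
  assumes IH: "\<And>p'. size (fst p') < size (fst p) \<Longrightarrow> good p'"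
    and u: "\<And>k. 2 \<le> k \<Longrightarrow> 0 \<le> gap k p"
  shows "eta p \<le> 3 * alpha 0 p + 6 * e_mult 1 (alpha 0) p + 6 * e_mult 2 (alpha 0) p + 6 * alpha 2 p"
proof -
  have E0: "0 \<le> e_mult l (alpha 0) p" if "0 < l" for l
    by (rule e_mult_nonneg) (use that IH in \<open>auto simp: good_def\<close>)
  have alpha: "0 \<le> alpha k p" if "2 \<le> k" for k
    by (rule alpha_nonneg) (use that u E0 in auto)
  have "e_mult 1 (\<lambda>p. eta_head p + 6 * e_mult 3 (alpha 0) p) p \<le> e_mult 1 (\<lambda>p. 6 * alpha 0 p) p"
    by (rule e_mult_mono) (use IH eta_head_bounds in auto)
  then have 1: "e_mult 1 eta_head p + 6 * e_mult 3 (e_mult 1 (alpha 0)) p \<le> 6 * e_mult 1 (alpha 0) p"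
    by (simp only: e_mult_linear e_mult_commute[of 3 1])
  have "e_mult 2 (\<lambda>p. eta_term 0 p + 6 * e_mult 3 (alpha 0) p) p \<le> e_mult 2 (\<lambda>p. 6 * alpha 0 p) p"
    by (rule e_mult_mono) (use IH eta_term_0_bounds in auto)
  then have 2: "e_mult 2 (eta_term 0) p + 6 * e_mult 3 (e_mult 2 (alpha 0)) p \<le> 6 * e_mult 2 (alpha 0) p"
    by (simp only: e_mult_linear e_mult_commute[of 3 2])
  have "e_mult 3 (eta_term 1) p \<le> e_mult 3 (\<lambda>p. 9 * alpha 0 p + 6 * e_mult 1 (alpha 0) p + 6 * e_mult 2 (alpha 0) p) p"
    by (rule e_mult_mono) (use IH eta_term_1_bounds in auto)
  then have 3: "e_mult 3 (eta_term 1) p \<le> 9 * e_mult 3 (alpha 0) p + 6 * e_mult 3 (e_mult 1 (alpha 0)) p + 6 * e_mult 3 (e_mult 2 (alpha 0)) p"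
    by (simp only: e_mult_linear)
  have 4: "(\<Sum>s<deg p. e_mult (s + 4) (eta_term (s + 2)) p) \<le> (\<Sum>s<deg p. 9 * (of_nat (s + 2) * e_mult (s + 4) (alpha 0) p))"
  proof (rule sum_mono)
    fix s
    have "e_mult (s + 4) (eta_term (s + 2)) p \<le> e_mult (s + 4) (\<lambda>p. 9 * of_nat (s + 2) * alpha 0 p) p"
      by (rule e_mult_mono) (use IH eta_term_upper[of _ "s + 2"] in auto)
    then show "e_mult (s + 4) (eta_term (s + 2)) p \<le> 9 * (of_nat (s + 2) * e_mult (s + 4) (alpha 0) p)"
      by (simp only: e_mult_linear mult.assoc)
  qed
  define S where "S = insert 3 ((\<lambda>s. s + 4) ` {..<deg p})"
  have "marked_e 2 p + gap 2 p + (\<Sum>l\<in>S. (of_nat l - 2) * e_mult l (alpha 0) p) \<le> alpha 2 p"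
    by (rule alpha_lower) (use u E0 in \<open>auto simp: S_def\<close>)
  moreover have "(\<Sum>l\<in>S. (of_nat l - 2) * e_mult l (alpha 0) p) = e_mult 3 (alpha 0) p + (\<Sum>s<deg p. of_nat (s + 2) * e_mult (s + 4) (alpha 0) p)"
    unfolding S_def by (subst sum.insert) (auto simp: sum.reindex inj_on_def add.commute)
  moreover have "alpha 2 p + marked_e 1 p \<le> alpha 0 p"
    using alpha0_lower[of "{1}" "{1}" p] alpha by (simp add: numeral_2_eq_2)
  ultimately show ?thesis
    using 1 2 3 4 eta_split[of p] u[of 2] marked_e_nonneg[of 0 p] marked_e_nonneg[of 1 p] marked_e_nonneg[of 2 p]
    unfolding sum_distrib_left[symmetric] by linarith
qed

lemma good: "good p"
proof (induction "size (fst p)" arbitrary: p rule: less_induct)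
  case less
  have IH: "good p'" if "size (fst p') < size (fst p)" for p' using less that by blast
  have u: "0 \<le> gap k p \<and> marked_e (k + 2) p + gap (k + 2) p \<le> gap k p" if "2 \<le> k" for k
    using gap_good[OF IH that] .
  have E0: "0 \<le> e_mult l (alpha 0) p" if "0 < l" for l
    by (rule e_mult_nonneg) (use that IH in \<open>auto simp: good_def\<close>)
  have alpha: "0 \<le> alpha k p" if "2 \<le> k" for k
    by (rule alpha_nonneg) (use that u E0 in auto)
  have "0 \<le> alpha 0 p" using alpha0_lower[of "{}" "{}" p] alpha by simp
  then show ?case
    unfolding good_def using u E0 eta_lower[OF IH] eta_upper[OF IH] by blast
qed

lemma ladder_nonneg:
  assumes "2 \<le> i" "deg p = n + i + 1"
  shows "0 \<le> ladder n i 0 p"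
  using good_alpha[OF good assms(1), of p] assms(2) by (simp add: ladder_total_def)

text \<open>The clique index grows at every step, so starting from m >= 1 only ladders with index at
  least 2 occur, ending in a single X_b.\<close>

lemma lollipop_nonneg: "1 \<le> m \<Longrightarrow> deg p = n + m + 1 \<Longrightarrow> 0 \<le> lollipop n m p"
proof (induction n arbitrary: m)
  case (Suc n)
  then show ?case using ladder_nonneg[of "Suc m" p n] by simp
qed simp

section \<open>The chromatic symmetric function of the graph\<close>

lemma chrom_Y_eq_nc_ind:
  "chrom_Y d E = nc_ind d (\<lambda>t. \<forall>u\<in>{1..d}. \<forall>v\<in>{1..d}. {u, v} \<in> E \<longrightarrow> t u \<noteq> t v)"
  unfolding chrom_Y_def proper_colourings_def monomial_sum_eq_nc_ind ..

lemma chrom_Y_in_span: "chrom_Y d E \<in> NC.span (nc_e_basis d)"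
proof -
  have "chrom_Y d E = nc_ind d (\<lambda>t. \<forall>u\<in>{1..d}. \<forall>v\<in>{1..d}. {u, v} \<in> E \<longrightarrow> (u, v) \<notin> krel d t)"
    unfolding chrom_Y_eq_nc_ind by (rule nc_ind_cong) (auto simp: krel_def)
  also have "\<dots> \<in> NC.span (nc_e_basis d)" by (rule nc_ind_in_span)
  finally show ?thesis .
qed

lemma marked_poly_chrom_Y_edges_of_seq:
  assumes "1 \<le> d"
  shows "marked_poly N c d (chrom_Y d (edges_of_seq d w)) = (\<Sum>t | t \<in> ep.cols N d w \<and> t d = c. \<Prod>i=1..d. var (t i))"
proof -
  have "(\<forall>u\<in>{1..d}. \<forall>v\<in>{1..d}. {u, v} \<in> edges_of_seq d w \<longrightarrow> t u \<noteq> t v)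
      \<longleftrightarrow> (\<forall>u v. 1 \<le> u \<and> u < v \<and> v \<le> d \<and> w v \<le> u \<longrightarrow> t u \<noteq> t v)" (is "?L \<longleftrightarrow> ?R") for t :: "nat \<Rightarrow> nat"
  proof
    assume L: ?L
    show ?R
    proof (intro allI impI)
      fix u v assume uv: "1 \<le> u \<and> u < v \<and> v \<le> d \<and> w v \<le> u"
      then have "{u, v} \<in> edges_of_seq d w" unfolding doubleton_in_edges_of_seq by blast
      moreover have "u \<in> {1..d}" "v \<in> {1..d}" using uv by auto
      ultimately show "t u \<noteq> t v" using L by blast
    qed
  next
    assume ?R
    then show ?L unfolding doubleton_in_edges_of_seq by metis
  qed
  then show ?thesis
    unfolding chrom_Y_eq_nc_ind marked_poly_nc_ind[OF assms] ep.cols_def by (simp only: mem_Collect_eq conj_assoc)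
qed

theorem proposition5p7:
  fixes m n k :: nat
  assumes "m \<ge> 4" and "1 \<le> k" and "k \<le> m - 2"
  shows "e_positive (m + n) (WL m n k)"
  unfolding e_positive_def chrom_y_def
proof
  fix p assume p: "p \<in> ubc_index (m + n)"
  define h where "h p = of_nat (fact (m - 3) * k) * ladder (Suc n) (m - 2) 0 p
    + of_nat (fact (m - 3) * (m - 2 - k)) * lollipop (Suc n) (m - 2) p" for p
  have d1: "1 \<le> m + n" using assms(1) by simp
  have d: "m + n = Suc n + (m - 2) + 1" using assms(1) by simp
  have "Poly_Mapping.lookup (nu (m + n) (chrom_Y (m + n) (WL m n k))) p = h p / of_nat (type_fact p)"
  proof (rule lookup_nu[OF chrom_Y_in_span d1 _ p])
    fix N c :: nat assume c: "c \<in> {0<..N}"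
    have "marked_poly N c (m + n) (chrom_Y (m + n) (WL m n k))
        = of_nat (fact (m - 3)) * (of_nat k * ep.ladder_poly N c (Suc n) (m - 2) 0 + of_nat (m - 2 - k) * ep.lollipop_poly N c (Suc n) (m - 2))"
      unfolding WL_def marked_poly_chrom_Y_edges_of_seq[OF d1] by (rule ep.sum_cols_WL[OF assms])
    also have "\<dots> = ubc_eval N c (m + n) h"
      unfolding h_def[abs_def] ubc_eval_linear
        ubc_eval_ladder[OF c, of "Suc n" "m - 2" 0, unfolded add_0_right, folded d]
        ubc_eval_lollipop[OF c, of "Suc n" "m - 2", folded d]
      by (simp only: of_nat_mult distrib_left mult.assoc)
    finally show "marked_poly N c (m + n) (chrom_Y (m + n) (WL m n k))
        = (\<Sum>p\<in>ubc_index (m + n). Poly_Mapping.single 0 (h p) * type_poly N c p)"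
      unfolding ubc_eval_def .
  qed
  \<comment> \<open>The degree matches ladder length n + 1 and clique index m - 2, which is at least
    2 because m >= 4.\<close>
  moreover have "deg p = Suc n + (m - 2) + 1" using p d by (auto simp: ubc_index_def deg_def)
  then have "0 \<le> h p"
    using assms(1) unfolding h_def by (intro add_nonneg_nonneg mult_nonneg_nonneg ladder_nonneg lollipop_nonneg) auto
  ultimately show "0 \<le> Poly_Mapping.lookup (nu (m + n) (chrom_Y (m + n) (WL m n k))) p" by simp
qed

end
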